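(* Let $k \in \frac{1}{2} + \mathbb{Z}$, let $\Gamma \subseteq \mathrm{Mp}_1(\mathbb{Z})$ be a subgroup of finite index, and let $\rho$ be a finite-dimensional complex representation of $\Gamma$. (1) Let $f \neq 0$ be a weakly holomorphic modular form of weight $k$ and type $\rho$ for $\Gamma$. Then the $(\mathfrak{g},K)$-module $\varpi(f,k)$ is isomorphic to $\varpi^+(k-1)$. (2) Let $f$ be a harmonic weak Maaß form of weight $k$ and type $\rho$ for $\Gamma$ that is not weakly holomorphic. Then $\varpi(f,k)$ fits into a nonsplit short exact sequence of $(\mathfrak{g},K)$-modules $$0 \longrightarrow \varpi^-(1-k) \longrightarrow \varpi(f,k) \longrightarrow \varpi^+(k-1) \longrightarrow 0.$$
   Context: **Metaplectic group.** $\mathbb{H}$ is the upper half plane, $\tau = u+iv \in \mathbb{H}$. $\mathrm{Mp}_1(\mathbb{R})$ is the group of pairs $(g,\omega)$ with $g = \begin{pmatrix} a & b\\ c& d\end{pmatrix} \in \mathrm{SL}_2(\mathbb{R})$ and $\omega : \mathbb{H} \to \mathbb{C}$ holomorphic with $\omega(\tau)^2 = c\tau+d$, with group law $(g,\omega)(g',\omega') = (gg', \tau \mapsto \omega(g'\tau)\omega'(\tau))$. It is a connected double cover of $\mathrm{SL}_2(\mathbb{R})$ via $(g,\omega) \mapsto g$, and acts on $\mathbb{H}$ through $\mathrm{SL}_2(\mathbb{R})$ by Möbius transformations. $\mathrm{Mp}_1(\mathbb{Z})$ is the preimage of $\mathrm{SL}_2(\mathbb{Z})$ and $K$ is the preimage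 of $\mathrm{SO}_2(\mathbb{R})$. Elements of $K$ are $k(\theta) = \left(\begin{pmatrix} \cos\theta & \sin\theta\\ -\sin\theta & \cos\theta\end{pmatrix}, \omega_{k(\theta)}\right)$, $\theta \in \mathbb{R}$, where $\omega_{k(\theta)}$ is determined by $\omega_{k(\theta)}(i) = \exp(-i\theta/2)$. Put $n(b) = \left(\begin{pmatrix}1&b\\0&1\end{pmatrix},1\right)$ for $b \in \mathbb{R}$ and, for $a>0$, $m(a,1) = \left(\begin{pmatrix}a&0\\0&a^{-1}\end{pmatrix}, a^{-1/2}\right)$ with the positive square root. **Lie algebra.** $\mathfrak{g} = \mathrm{Lie}(\mathrm{Mp}_1(\mathbb{R}))$, whose complexification is identified with the traceless matrices in $\mathrm{Mat}_2(\mathbb{C})$, with basis $$H = i\begin{pmatrix}0&-1\\1&0\end{pmatrix},\quad X_+ = \tfrac12\begin{pmatrix}1&i\\i&-1\end{pmatrix},\quad X_- = \tfrac12\begin{pmatrix}1&-i\\-i&-1\end{pmatrix}.$$ For $X,Y \in \mathfrak{g}$, $X+iY$ acts on smooth functions on $\mathrm{Mp}_1(\mathbb{R})$ by $((X+iY)\tilde f)(g) = \partial_{t=0}\tilde f(g\exp(tX)) + i\,\partial_{t=0}\tilde f(g\exp(tY))$; $K$ acts by right translation. **Harmonic weak Maaß forms.** For $k \in \frac12\mathbb{Z}$ and $(\gamma,\omega)\in\mathrm{Mp}_1(\mathbb{R})$ put $(f|_k(\gamma,\omega))(\tau) = \omega(\tau)^{-2k} f(\gamma\tau)$. Put $R_k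 = 2i\partial_\tau + kv^{-1}$, $L_k = -2iv^2\partial_{\bar\tau}$, $\Delta_k = -R_{k-2}L_k$. Let $\rho$ be a finite-dimensional complex representation, with representation space $V(\rho)$, of a finite index subgroup $\Gamma \subseteq \mathrm{Mp}_1(\mathbb{Z})$. A harmonic weak Maaß form of weight $k$ and type $\rho$ for $\Gamma$ is a smooth function $f:\mathbb{H}\to V(\rho)$ such that $\Delta_k f = 0$; $\rho(\gamma)^{-1}(f|_k\gamma) = f$ for all $\gamma\in\Gamma$; and, for some norm on $V(\rho)$, there is $a \in \mathbb{R}$ such that for all $\gamma\in\mathrm{Mp}_1(\mathbb{Z})$, $\|(f|_k\gamma)(\tau)\| \ll \exp(av)$ as $v\to\infty$, uniformly in $u$. It is called weakly holomorphic (a weakly holomorphic modular form) if it is moreover holomorphic on $\mathbb{H}$, equivalently $L_kf=0$ (the growth condition then says that it has at most poles of finite order at the cusps). **The module $\varpi(f,k)$.** For such $f$ define $\tilde f : \mathrm{Mp}_1(\mathbb{R})\to V(\rho)$ by $\tilde f((g,\omega)) = \omega(i)^{-2k} f(gi)$. Then $\varpi(f,k)$ is the $(\mathfrak{g},K)$-module generated by $\tilde f$, i.e. the smallest complex subspace of the smooth $V(\rho)$-valued functions on $\mathrm{Mp}_1(\mathbb{R})$ that contains $\tilde f$ and is stable under $\mathfrak{g}$ and $K$. **The modules $\varpi^{\pm}(\nu)$.** For $\epsilon \in (\frac12+\mathbb{Z})/2\mathbb{Z}$ and $\nu\in\mathbb{C}$, let $I(\epsilon,\nu)$ be the principal series $(\mathfrak{g},K)$-module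 with basis $\phi_j$, $j\in\epsilon+2\mathbb{Z}$, where $\phi_j:\mathrm{Mp}_1(\mathbb{R})\to\mathbb{C}$ is the function $\phi_j(n(b)\,m(a,1)\,k(\theta)) = a^{\nu+1}\exp(ij\theta)$ for $b\in\mathbb{R}$, $a>0$, $\theta\in\mathbb{R}$. One has $X_\pm\phi_j = \frac12(\nu+1\pm j)\phi_{j\pm2}$ and $H\phi_j = j\phi_j$. For $\nu\in\frac12+\mathbb{Z}$: - $\varpi^+(\nu)$ is the irreducible submodule of $I(\epsilon,\nu)$, with $\epsilon \equiv \nu+1 \pmod{2}$, spanned by $\phi_{\nu+1},\phi_{\nu+3},\phi_{\nu+5},\ldots$; - $\varpi^-(\nu)$ is the irreducible submodule of $I(\epsilon,\nu)$, with $\epsilon\equiv\nu\equiv-\nu-1\pmod 2$, spanned by $\phi_{-\nu-1},\phi_{-\nu-3},\phi_{-\nu-5},\ldots$. *)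

theory Defs
  imports
    "HOL-Analysis.Analysis"
    "HOL-Algebra.Coset"
    "HOL-Library.Function_Algebras"
begin

section \<open>The metaplectic group\<close>

definition uhp :: "complex set" where
  "uhp = {\<tau>. Im \<tau> > 0}"

definition mat_act :: "real^2^2 \<Rightarrow> complex \<Rightarrow> complex" where
  "mat_act A = moebius (of_real (A$1$1)) (of_real (A$1$2)) (of_real (A$2$1)) (of_real (A$2$2))"

definition aut_factor :: "real^2^2 \<Rightarrow> complex \<Rightarrow> complex" where
  "aut_factor A \<tau> = of_real (A$2$1) * \<tau> + of_real (A$2$2)"

text \<open>
  The second component is a function on the upper half plane; as a total function it is made
  unique by requiring it to be \<open>extensional\<close>.
\<close>

typedef mp1 = "{(A :: real^2^2, \<omega> :: complex \<Rightarrow> complex).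
    det A = 1 \<and> \<omega> \<in> extensional uhp \<and> \<omega> holomorphic_on uhp \<and>
    (\<forall>\<tau>\<in>uhp. (\<omega> \<tau>)\<^sup>2 = aut_factor A \<tau>)}"
proof -
  have "(\<lambda>\<tau>\<in>uhp. 1 :: complex) holomorphic_on uhp"
    by (rule holomorphic_transform[of "\<lambda>_. 1"]) auto
  then have "(mat 1, \<lambda>\<tau>\<in>uhp. 1) \<in> {(A :: real^2^2, \<omega> :: complex \<Rightarrow> complex).
    det A = 1 \<and> \<omega> \<in> extensional uhp \<and> \<omega> holomorphic_on uhp \<and>
    (\<forall>\<tau>\<in>uhp. (\<omega> \<tau>)\<^sup>2 = aut_factor A \<tau>)}"
    by (simp add: aut_factor_def) (simp add: mat_def)
  then show ?thesis by blast
qed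

definition mp_mat :: "mp1 \<Rightarrow> real^2^2" where
  "mp_mat x = fst (Rep_mp1 x)"

definition mp_root :: "mp1 \<Rightarrow> complex \<Rightarrow> complex" where
  "mp_root x = snd (Rep_mp1 x)"

definition mp_act :: "mp1 \<Rightarrow> complex \<Rightarrow> complex" where
  "mp_act x = mat_act (mp_mat x)"

definition mp_mult :: "mp1 \<Rightarrow> mp1 \<Rightarrow> mp1" where
  "mp_mult x y = Abs_mp1 (mp_mat x ** mp_mat y,
     \<lambda>\<tau>\<in>uhp. mp_root x (mp_act y \<tau>) * mp_root y \<tau>)"

definition Mp1R :: "mp1 monoid" where
  "Mp1R = \<lparr>carrier = UNIV, mult = mp_mult, one = Abs_mp1 (mat 1, \<lambda>\<tau>\<in>uhp. 1)\<rparr>"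

definition Mp1Z :: "mp1 monoid" where
  "Mp1Z = Mp1R\<lparr>carrier := {x. \<forall>i j. mp_mat x $ i $ j \<in> \<int>}\<rparr>"

definition mp_K :: "mp1 set" where
  "mp_K = {x. rotation_matrix (mp_mat x)}"

definition mp_k :: "real \<Rightarrow> mp1" where
  "mp_k \<theta> = (THE x. mp_mat x = vector [vector [cos \<theta>, sin \<theta>], vector [- sin \<theta>, cos \<theta>]] \<and>
                    mp_root x \<i> = exp (- \<i> * of_real \<theta> / 2))"

definition mp_n :: "real \<Rightarrow> mp1" where
  "mp_n b = Abs_mp1 (vector [vector [1, b], vector [0, 1]], \<lambda>\<tau>\<in>uhp. 1)"

text \<open>Only meaningful for \<open>a > 0\<close>.\<close>

definition mp_m :: "real \<Rightarrow> mp1" where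
  "mp_m a = Abs_mp1 (vector [vector [a, 0], vector [0, inverse a]],
     \<lambda>\<tau>\<in>uhp. of_real (a powr (- 1/2)))"


subsection \<open>Group axioms\<close>

lemma mp_mat_det: "det (mp_mat x) = 1"
  and mp_root_ext: "mp_root x \<in> extensional uhp"
  and mp_root_holo: "mp_root x holomorphic_on uhp"
  and mp_root_sq: "\<tau> \<in> uhp \<Longrightarrow> (mp_root x \<tau>)\<^sup>2 = aut_factor (mp_mat x) \<tau>"
  using Rep_mp1[of x] by (auto simp: mp_mat_def mp_root_def case_prod_beta)

lemma mp1_eqI:
  assumes "mp_mat x = mp_mat y" "\<And>\<tau>. \<tau> \<in> uhp \<Longrightarrow> mp_root x \<tau> = mp_root y \<tau>"
  shows "x = y"
proof -
  have "mp_root x = mp_root y"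
    by (rule extensionalityI[OF mp_root_ext mp_root_ext]) (use assms in auto)
  with assms(1) have "Rep_mp1 x = Rep_mp1 y"
    by (simp add: mp_mat_def mp_root_def prod_eq_iff)
  then show ?thesis by (simp add: Rep_mp1_inject)
qed

lemma mp_mat_Abs:
  assumes "det A = 1" "w holomorphic_on uhp" "\<And>\<tau>. \<tau> \<in> uhp \<Longrightarrow> (w \<tau>)\<^sup>2 = aut_factor A \<tau>"
  shows "mp_mat (Abs_mp1 (A, \<lambda>\<tau>\<in>uhp. w \<tau>)) = A"
    and "mp_root (Abs_mp1 (A, \<lambda>\<tau>\<in>uhp. w \<tau>)) = (\<lambda>\<tau>\<in>uhp. w \<tau>)"
proof -
  have "(\<lambda>\<tau>\<in>uhp. w \<tau>) holomorphic_on uhp"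
    by (rule holomorphic_transform[OF assms(2)]) auto
  then have "(A, \<lambda>\<tau>\<in>uhp. w \<tau>) \<in> {(A :: real^2^2, \<omega> :: complex \<Rightarrow> complex).
    det A = 1 \<and> \<omega> \<in> extensional uhp \<and> \<omega> holomorphic_on uhp \<and>
    (\<forall>\<tau>\<in>uhp. (\<omega> \<tau>)\<^sup>2 = aut_factor A \<tau>)}"
    using assms by auto
  then show "mp_mat (Abs_mp1 (A, \<lambda>\<tau>\<in>uhp. w \<tau>)) = A"
    "mp_root (Abs_mp1 (A, \<lambda>\<tau>\<in>uhp. w \<tau>)) = (\<lambda>\<tau>\<in>uhp. w \<tau>)"
    by (simp_all add: mp_mat_def mp_root_def Abs_mp1_inverse)
qed

lemma aut_factor_nz:
  assumes "det A = 1" "\<tau> \<in> uhp"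
  shows "aut_factor A \<tau> \<noteq> 0"
proof
  assume *: "aut_factor A \<tau> = 0"
  from * have "A$2$1 * Im \<tau> = 0" by (simp add: aut_factor_def complex_eq_iff)
  with assms(2) have c: "A$2$1 = 0" by (simp add: uhp_def)
  with * have "A$2$2 = 0" by (simp add: aut_factor_def)
  with c assms(1) show False by (simp add: det_2)
qed

lemma mat_act_eq:
  "mat_act A \<tau> = (of_real (A$1$1) * \<tau> + of_real (A$1$2)) / aut_factor A \<tau>"
  by (simp add: mat_act_def moebius_def aut_factor_def)

lemma mat_act_uhp:
  assumes "det A = 1" "\<tau> \<in> uhp"
  shows "mat_act A \<tau> \<in> uhp"
proof -
  have nz: "aut_factor A \<tau> \<noteq> 0" by (rule aut_factor_nz[OF assms])
  have "Im (mat_act A \<tau>) = Im \<tau> / (cmod (aut_factor A \<tau>))\<^sup>2"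
  proof -
    have "Im (mat_act A \<tau>) = (A$1$1 * A$2$2 - A$1$2 * A$2$1) * Im \<tau> / (cmod (aut_factor A \<tau>))\<^sup>2"
      unfolding mat_act_eq complex_div_cnj[of _ "aut_factor A \<tau>"]
      by (simp add: aut_factor_def algebra_simps diff_divide_distrib
          flip: of_real_power)
    then show ?thesis using assms(1) by (simp add: det_2)
  qed
  then show ?thesis using assms(2) nz by (simp add: uhp_def)
qed

lemma mat_mult_2:
  fixes A B :: "real^2^2"
  shows "(A ** B)$i$j = A$i$1 * B$1$j + A$i$2 * B$2$j"
  by (simp add: matrix_matrix_mult_def sum_2)

lemma aut_factor_mult:
  assumes "det B = 1" "\<tau> \<in> uhp"
  shows "aut_factor (A ** B) \<tau> = aut_factor A (mat_act B \<tau>) * aut_factor B \<tau>"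
  using aut_factor_nz[OF assms]
  by (simp add: mat_act_eq aut_factor_def[of A] field_simps)
     (simp add: aut_factor_def mat_mult_2 algebra_simps)

lemma mat_act_mult:
  assumes "det A = 1" "det B = 1" "\<tau> \<in> uhp"
  shows "mat_act (A ** B) \<tau> = mat_act A (mat_act B \<tau>)"
proof -
  have nB: "aut_factor B \<tau> \<noteq> 0" using aut_factor_nz assms by blast
  have nA: "aut_factor A (mat_act B \<tau>) \<noteq> 0" using aut_factor_nz mat_act_uhp assms by blast
  have "of_real ((A ** B)$1$1) * \<tau> + of_real ((A ** B)$1$2)
      = (of_real (A$1$1) * mat_act B \<tau> + of_real (A$1$2)) * aut_factor B \<tau>"
    using nB by (simp add: mat_act_eq[of B] field_simps)
       (simp add: aut_factor_def mat_mult_2 algebra_simps)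
  then show ?thesis
    using nA nB by (simp add: mat_act_eq[of "A ** B"] mat_act_eq[of A] aut_factor_mult assms)
qed

lemma mp_act_uhp: "\<tau> \<in> uhp \<Longrightarrow> mp_act x \<tau> \<in> uhp"
  by (simp add: mp_act_def mat_act_uhp mp_mat_det)

lemma mp_act_holo: "mp_act x holomorphic_on uhp"
proof -
  have "(\<lambda>\<tau>. mat_act (mp_mat x) \<tau>) holomorphic_on uhp"
    unfolding mat_act_eq
    by (intro holomorphic_intros) (auto simp: aut_factor_nz mp_mat_det, 
        auto simp: aut_factor_def intro!: holomorphic_intros)
  then show ?thesis by (simp add: mp_act_def)
qed

lemma mp_mat_mult: "mp_mat (mp_mult x y) = mp_mat x ** mp_mat y"
  and mp_root_mult: "\<tau> \<in> uhp \<Longrightarrow>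
        mp_root (mp_mult x y) \<tau> = mp_root x (mp_act y \<tau>) * mp_root y \<tau>"
proof -
  have 1: "det (mp_mat x ** mp_mat y) = 1" by (simp add: det_mul mp_mat_det)
  have "mp_root x \<circ> mp_act y holomorphic_on uhp"
    by (rule holomorphic_on_compose_gen[OF mp_act_holo mp_root_holo]) (auto intro: mp_act_uhp)
  then have 2: "(\<lambda>\<tau>. mp_root x (mp_act y \<tau>) * mp_root y \<tau>) holomorphic_on uhp"
    by (intro holomorphic_intros mp_root_holo) (simp add: o_def)
  have 3: "(mp_root x (mp_act y \<tau>) * mp_root y \<tau>)\<^sup>2 = aut_factor (mp_mat x ** mp_mat y) \<tau>"
    if "\<tau> \<in> uhp" for \<tau>
    using that mp_root_sq[OF that, of y] mp_root_sq[OF mp_act_uhp[OF that], of x y]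
    by (simp add: power_mult_distrib aut_factor_mult mp_mat_det mp_act_def)
  show "mp_mat (mp_mult x y) = mp_mat x ** mp_mat y"
    unfolding mp_mult_def by (rule mp_mat_Abs(1)[OF 1 2 3])
  show "mp_root (mp_mult x y) \<tau> = mp_root x (mp_act y \<tau>) * mp_root y \<tau>" if "\<tau> \<in> uhp"
  proof -
    have "mp_root (mp_mult x y) = (\<lambda>\<tau>\<in>uhp. mp_root x (mp_act y \<tau>) * mp_root y \<tau>)"
      unfolding mp_mult_def by (rule mp_mat_Abs(2)[OF 1 2 3])
    then show ?thesis using that by simp
  qed
qed

lemma mp_mat_one: "mp_mat \<one>\<^bsub>Mp1R\<^esub> = mat 1"
  and mp_root_one: "\<tau> \<in> uhp \<Longrightarrow> mp_root \<one>\<^bsub>Mp1R\<^esub> \<tau> = 1"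
proof -
  have 3: "\<And>\<tau>. \<tau> \<in> uhp \<Longrightarrow> (1::complex)\<^sup>2 = aut_factor (mat 1) \<tau>"
    by (simp add: aut_factor_def mat_def)
  note * = mp_mat_Abs[of "mat 1" "\<lambda>_. 1", OF det_I holomorphic_on_const 3]
  show "mp_mat \<one>\<^bsub>Mp1R\<^esub> = mat 1" by (simp add: Mp1R_def *)
  show "mp_root \<one>\<^bsub>Mp1R\<^esub> \<tau> = 1" if "\<tau> \<in> uhp" using that by (simp add: Mp1R_def *)
qed

lemma mat_act_one: "mat_act (mat 1) \<tau> = \<tau>"
  by (simp add: mat_act_def moebius_def mat_def)

lemma mp_left_inverse: "\<exists>y. mp_mult y x = \<one>\<^bsub>Mp1R\<^esub>"
proof -
  define A where "A = mp_mat x"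
  define B :: "real^2^2" where "B = vector [vector [A$2$2, - A$1$2], vector [- A$2$1, A$1$1]]"
  have dA: "det A = 1" by (simp add: A_def mp_mat_det)
  have dB: "det B = 1" using dA by (simp add: B_def det_2 algebra_simps)
  have AB: "A ** B = mat 1" and BA: "B ** A = mat 1"
    using dA by (simp_all add: vec_eq_iff forall_2 mat_mult_2 B_def mat_def det_2 algebra_simps)
  define w where "w = (\<lambda>\<tau>. 1 / mp_root x (mat_act B \<tau>))"
  have Bu: "mat_act B \<tau> \<in> uhp" if "\<tau> \<in> uhp" for \<tau> by (rule mat_act_uhp[OF dB that])
  have nz: "mp_root x \<tau> \<noteq> 0" if "\<tau> \<in> uhp" for \<tau>
    using mp_root_sq[OF that, of x] aut_factor_nz[OF mp_mat_det that] by auto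
  have "(\<lambda>\<tau>. mat_act B \<tau>) holomorphic_on uhp"
    unfolding mat_act_eq
    by (intro holomorphic_intros) (auto simp: aut_factor_nz dB,
        auto simp: aut_factor_def intro!: holomorphic_intros)
  then have "mp_root x \<circ> mat_act B holomorphic_on uhp"
    by (intro holomorphic_on_compose_gen[OF _ mp_root_holo]) (auto intro: Bu)
  then have w1: "w holomorphic_on uhp"
    unfolding w_def by (intro holomorphic_intros) (auto simp: o_def nz Bu)
  have w2: "(w \<tau>)\<^sup>2 = aut_factor B \<tau>" if "\<tau> \<in> uhp" for \<tau>
  proof -
    have "aut_factor A (mat_act B \<tau>) * aut_factor B \<tau> = 1"
      using aut_factor_mult[OF dB that, of A] by (simp add: AB) (simp add: aut_factor_def mat_def)
    then show ?thesis
      using aut_factor_nz[OF dA Bu[OF that]]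
      by (simp add: w_def power_divide mp_root_sq[OF Bu[OF that]] flip: A_def)
         (simp add: field_simps)
  qed
  define y where "y = Abs_mp1 (B, \<lambda>\<tau>\<in>uhp. w \<tau>)"
  have y: "mp_mat y = B" "mp_root y = (\<lambda>\<tau>\<in>uhp. w \<tau>)"
    unfolding y_def using mp_mat_Abs[OF dB w1 w2] by auto
  have "mp_mult y x = \<one>\<^bsub>Mp1R\<^esub>"
  proof (rule mp1_eqI)
    show "mp_mat (mp_mult y x) = mp_mat \<one>\<^bsub>Mp1R\<^esub>"
      using BA by (simp add: mp_mat_mult y mp_mat_one A_def)
    fix \<tau> assume t: "\<tau> \<in> uhp"
    have "mat_act B (mp_act x \<tau>) = \<tau>"
      using mat_act_mult[OF dB dA t] by (simp add: BA mat_act_one mp_act_def flip: A_def)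
    then show "mp_root (mp_mult y x) \<tau> = mp_root \<one>\<^bsub>Mp1R\<^esub> \<tau>"
      using t nz by (simp add: mp_root_mult y mp_act_uhp w_def mp_root_one)
  qed
  then show ?thesis by blast
qed

lemma group_Mp1R: "group Mp1R"
proof (rule groupI)
  fix x y z assume "x \<in> carrier Mp1R" "y \<in> carrier Mp1R" "z \<in> carrier Mp1R"
  have "mp_mult (mp_mult x y) z = mp_mult x (mp_mult y z)"
    by (rule mp1_eqI)
       (simp_all add: mp_mat_mult mp_root_mult mp_act_uhp matrix_mul_assoc,
        simp add: mp_act_def mp_mat_mult mat_act_mult mp_mat_det)
  then show "x \<otimes>\<^bsub>Mp1R\<^esub> y \<otimes>\<^bsub>Mp1R\<^esub> z = x \<otimes>\<^bsub>Mp1R\<^esub> (y \<otimes>\<^bsub>Mp1R\<^esub> z)"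
    by (simp add: Mp1R_def)
next
  fix x
  have "mp_mult \<one>\<^bsub>Mp1R\<^esub> x = x"
    by (rule mp1_eqI) (simp_all add: mp_mat_mult mp_root_mult mp_mat_one mp_root_one mp_act_uhp)
  then show "\<one>\<^bsub>Mp1R\<^esub> \<otimes>\<^bsub>Mp1R\<^esub> x = x" by (simp add: Mp1R_def)
  show "\<exists>y\<in>carrier Mp1R. y \<otimes>\<^bsub>Mp1R\<^esub> x = \<one>\<^bsub>Mp1R\<^esub>"
    using mp_left_inverse[of x] by (simp add: Mp1R_def)
qed (simp_all add: Mp1R_def)


section \<open>Smooth functions and the Lie algebra action\<close>

primrec Ck_on :: "nat \<Rightarrow> ('a::real_normed_vector \<Rightarrow> 'b::real_normed_vector) \<Rightarrow> 'a set \<Rightarrow> bool" where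
  "Ck_on 0 f S \<longleftrightarrow> continuous_on S f"
| "Ck_on (Suc n) f S \<longleftrightarrow> (\<forall>x\<in>S. f differentiable at x) \<and>
     (\<forall>v. Ck_on n (\<lambda>x. frechet_derivative f (at x) v) S)"

text \<open>For open \<open>S\<close>.\<close>

definition smooth_on :: "('a::real_normed_vector \<Rightarrow> 'b::real_normed_vector) \<Rightarrow> 'a set \<Rightarrow> bool" where
  "smooth_on f S \<longleftrightarrow> (\<forall>n. Ck_on n f S)"

text \<open>
  The Iwasawa map \<open>(b, a, \<theta>) \<mapsto> n(b) m(a) k(\<theta>)\<close> is a smooth covering of the metaplectic group by
  \<open>\<real> \<times> \<real>\<^sub>>\<^sub>0 \<times> \<real>\<close>, so smoothness on the group can be tested after pulling back along it.
\<close>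

definition mp_smooth :: "(mp1 \<Rightarrow> 'v::real_normed_vector) \<Rightarrow> bool" where
  "mp_smooth F \<longleftrightarrow>
     smooth_on (\<lambda>(b, a, \<theta>). F (mp_n b \<otimes>\<^bsub>Mp1R\<^esub> mp_m a \<otimes>\<^bsub>Mp1R\<^esub> mp_k \<theta>))
       (UNIV \<times> {0::real<..} \<times> UNIV)"

text \<open>
  One-parameter subgroups with velocity \<open>X\<close>. The group carries the topology induced by
  \<open>(g, \<omega>) \<mapsto> (g, \<omega>(\<i>))\<close>, and tangent vectors at the identity are identified with those
  of \<open>SL\<^sub>2(\<real>)\<close> via the covering map.
\<close>

definition one_param_subgroup :: "real^2^2 \<Rightarrow> (real \<Rightarrow> mp1) \<Rightarrow> bool" where
  "one_param_subgroup X c \<longleftrightarrow>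
     (\<forall>s t. c (s + t) = c s \<otimes>\<^bsub>Mp1R\<^esub> c t) \<and>
     continuous_on UNIV (\<lambda>t. (mp_mat (c t), mp_root (c t) \<i>)) \<and>
     ((\<lambda>t. mp_mat (c t)) has_vector_derivative X) (at 0)"

text \<open>The Lie group exponential; \<open>X\<close> is meant to be traceless.\<close>

definition mp_exp :: "real^2^2 \<Rightarrow> mp1" where
  "mp_exp X = (THE c. one_param_subgroup X c) 1"

definition lie_deriv :: "real^2^2 \<Rightarrow> (mp1 \<Rightarrow> 'v::real_normed_vector) \<Rightarrow> mp1 \<Rightarrow> 'v" where
  "lie_deriv X F g = vector_derivative (\<lambda>t. F (g \<otimes>\<^bsub>Mp1R\<^esub> mp_exp (t *\<^sub>R X))) (at 0)"

definition sl2C :: "(complex^2^2) set" where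
  "sl2C = {Z. trace Z = 0}"

text \<open>
  The action of \<open>Z = X + \<i>Y\<close> with \<open>X\<close>, \<open>Y\<close> real. The argument \<open>s\<close> is the complex scalar
  multiplication of the vector space in which \<open>F\<close> takes its values.
\<close>

definition lie_act ::
  "(complex \<Rightarrow> 'v \<Rightarrow> 'v) \<Rightarrow> complex^2^2 \<Rightarrow> (mp1 \<Rightarrow> 'v::real_normed_vector) \<Rightarrow> mp1 \<Rightarrow> 'v" where
  "lie_act s Z F g =
     lie_deriv (\<chi> i j. Re (Z$i$j)) F g + s \<i> (lie_deriv (\<chi> i j. Im (Z$i$j)) F g)"


section \<open>$(\mathfrak g, K)$-modules\<close>

text \<open>
  Carrier, scalar multiplication, action of the complexified Lie algebra and action of \<open>K\<close>;
  addition is that of the ambient type. All modules considered are submodules of spaces of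
  smooth functions on the metaplectic group.
\<close>

record 'a gk_module =
  gk_space :: "'a set"
  gk_scale :: "complex \<Rightarrow> 'a \<Rightarrow> 'a"
  gk_lie :: "complex^2^2 \<Rightarrow> 'a \<Rightarrow> 'a"
  gk_K :: "mp1 \<Rightarrow> 'a \<Rightarrow> 'a"

definition gk_hom ::
  "('a::ab_group_add) gk_module \<Rightarrow> ('b::ab_group_add) gk_module \<Rightarrow> ('a \<Rightarrow> 'b) \<Rightarrow> bool" where
  "gk_hom M N T \<longleftrightarrow>
     (\<forall>x\<in>gk_space M. T x \<in> gk_space N) \<and>
     (\<forall>x\<in>gk_space M. \<forall>y\<in>gk_space M. T (x + y) = T x + T y) \<and>
     (\<forall>c. \<forall>x\<in>gk_space M. T (gk_scale M c x) = gk_scale N c (T x)) \<and>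
     (\<forall>Z\<in>sl2C. \<forall>x\<in>gk_space M. T (gk_lie M Z x) = gk_lie N Z (T x)) \<and>
     (\<forall>\<kappa>\<in>mp_K. \<forall>x\<in>gk_space M. T (gk_K M \<kappa> x) = gk_K N \<kappa> (T x))"

definition gk_isomorphic ::
  "('a::ab_group_add) gk_module \<Rightarrow> ('b::ab_group_add) gk_module \<Rightarrow> bool" where
  "gk_isomorphic M N \<longleftrightarrow> (\<exists>T. gk_hom M N T \<and> bij_betw T (gk_space M) (gk_space N))"

text \<open>\<open>0 \<longrightarrow> A \<longrightarrow> B \<longrightarrow> C \<longrightarrow> 0\<close> with maps \<open>i\<close> and \<open>p\<close>.\<close>

definition gk_short_exact ::
  "('a::ab_group_add) gk_module \<Rightarrow> ('b::ab_group_add) gk_module \<Rightarrow> ('c::ab_group_add) gk_module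
    \<Rightarrow> ('a \<Rightarrow> 'b) \<Rightarrow> ('b \<Rightarrow> 'c) \<Rightarrow> bool" where
  "gk_short_exact A B C i p \<longleftrightarrow>
     gk_hom A B i \<and> gk_hom B C p \<and>
     inj_on i (gk_space A) \<and>
     i ` gk_space A = {x \<in> gk_space B. p x = 0} \<and>
     p ` gk_space B = gk_space C"

definition gk_splits ::
  "('b::ab_group_add) gk_module \<Rightarrow> ('c::ab_group_add) gk_module \<Rightarrow> ('b \<Rightarrow> 'c) \<Rightarrow> bool" where
  "gk_splits B C p \<longleftrightarrow> (\<exists>\<sigma>. gk_hom C B \<sigma> \<and> (\<forall>x\<in>gk_space C. p (\<sigma> x) = x))"

definition gk_submodule :: "('a::ab_group_add) set \<Rightarrow> 'a gk_module \<Rightarrow> bool" where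
  "gk_submodule W M \<longleftrightarrow>
     W \<subseteq> gk_space M \<and> module.subspace (gk_scale M) W \<and>
     (\<forall>Z\<in>sl2C. \<forall>x\<in>W. gk_lie M Z x \<in> W) \<and>
     (\<forall>\<kappa>\<in>mp_K. \<forall>x\<in>W. gk_K M \<kappa> x \<in> W)"

definition gk_generated :: "('a::ab_group_add) gk_module \<Rightarrow> 'a set \<Rightarrow> 'a gk_module" where
  "gk_generated M S = M\<lparr>gk_space := \<Inter>{W. gk_submodule W M \<and> S \<subseteq> W}\<rparr>"

text \<open>
  The ambient space of smooth functions with values in the complex vector space whose scalar
  multiplication is \<open>s\<close>; \<open>K\<close> acts by right translation.
\<close>

definition smooth_module ::
  "(complex \<Rightarrow> 'v \<Rightarrow> 'v) \<Rightarrow> (mp1 \<Rightarrow> 'v::real_normed_vector) gk_module" where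
  "smooth_module s =
     \<lparr>gk_space = {F. mp_smooth F},
      gk_scale = (\<lambda>c F g. s c (F g)),
      gk_lie = lie_act s,
      gk_K = (\<lambda>\<kappa> F g. F (g \<otimes>\<^bsub>Mp1R\<^esub> \<kappa>))\<rparr>"


section \<open>Principal series\<close>

text \<open>
  Well defined for \<open>j \<in> 1/2 + \<int>\<close>: in the Iwasawa decomposition \<open>a\<close> and \<open>b\<close> are unique and
  \<open>\<theta>\<close> is unique up to \<open>4\<pi>\<int>\<close>.
\<close>

definition ps_phi :: "complex \<Rightarrow> real \<Rightarrow> mp1 \<Rightarrow> complex" where
  "ps_phi \<nu> j = (THE F. \<forall>b a \<theta>. a > 0 \<longrightarrow>
     F (mp_n b \<otimes>\<^bsub>Mp1R\<^esub> mp_m a \<otimes>\<^bsub>Mp1R\<^esub> mp_k \<theta>)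
       = of_real a powr (\<nu> + 1) * exp (\<i> * of_real j * of_real \<theta>))"

definition principal_series :: "real \<Rightarrow> complex \<Rightarrow> (mp1 \<Rightarrow> complex) gk_module" where
  "principal_series \<epsilon> \<nu> = (smooth_module (\<lambda>c x. c * x))
     \<lparr>gk_space := module.span (gk_scale (smooth_module (\<lambda>c x. c * x)))
        {ps_phi \<nu> (\<epsilon> + 2 * of_int n) | n. True}\<rparr>"

definition varpi_plus :: "real \<Rightarrow> (mp1 \<Rightarrow> complex) gk_module" where
  "varpi_plus \<nu> = (let I = principal_series (\<nu> + 1) (of_real \<nu>) in
     I\<lparr>gk_space := module.span (gk_scale I)
        {ps_phi (of_real \<nu>) (\<nu> + 1 + 2 * of_nat n) | n. True}\<rparr>)"

definition varpi_minus :: "real \<Rightarrow> (mp1 \<Rightarrow> complex) gk_module" where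
  "varpi_minus \<nu> = (let I = principal_series (- \<nu> - 1) (of_real \<nu>) in
     I\<lparr>gk_space := module.span (gk_scale I)
        {ps_phi (of_real \<nu>) (- \<nu> - 1 - 2 * of_nat n) | n. True}\<rparr>)"


section \<open>Harmonic weak Maass forms\<close>

text \<open>
  Weights are real numbers \<open>k\<close> with \<open>2k\<close> an integer, so that \<open>\<lfloor>- 2 * k\<rfloor>\<close> is \<open>-2k\<close>.
\<close>

definition slash :: "real \<Rightarrow> (complex \<Rightarrow> complex^'n) \<Rightarrow> mp1 \<Rightarrow> complex \<Rightarrow> complex^'n" where
  "slash k f \<gamma> \<tau> = (mp_root \<gamma> \<tau> powi \<lfloor>- 2 * k\<rfloor>) *s f (mp_act \<gamma> \<tau>)"

definition d_tau :: "(complex \<Rightarrow> complex^'n) \<Rightarrow> complex \<Rightarrow> complex^'n" where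
  "d_tau f \<tau> = (1/2) *s (frechet_derivative f (at \<tau>) 1 - \<i> *s frechet_derivative f (at \<tau>) \<i>)"

definition d_taubar :: "(complex \<Rightarrow> complex^'n) \<Rightarrow> complex \<Rightarrow> complex^'n" where
  "d_taubar f \<tau> = (1/2) *s (frechet_derivative f (at \<tau>) 1 + \<i> *s frechet_derivative f (at \<tau>) \<i>)"

definition raise_op :: "real \<Rightarrow> (complex \<Rightarrow> complex^'n) \<Rightarrow> complex \<Rightarrow> complex^'n" where
  "raise_op k f \<tau> = (2 * \<i>) *s d_tau f \<tau> + of_real (k / Im \<tau>) *s f \<tau>"

definition lower_op :: "(complex \<Rightarrow> complex^'n) \<Rightarrow> complex \<Rightarrow> complex^'n" where
  "lower_op f \<tau> = (- 2 * \<i> * of_real ((Im \<tau>)\<^sup>2)) *s d_taubar f \<tau>"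

definition laplace_op :: "real \<Rightarrow> (complex \<Rightarrow> complex^'n) \<Rightarrow> complex \<Rightarrow> complex^'n" where
  "laplace_op k f \<tau> = - raise_op (k - 2) (lower_op f) \<tau>"

definition GL :: "(complex^'n^'n) monoid" where
  "GL = \<lparr>carrier = {A. invertible A}, mult = (\<lambda>A B. A ** B), one = mat 1\<rparr>"

definition mp_representation :: "mp1 set \<Rightarrow> (mp1 \<Rightarrow> complex^'n^'n) \<Rightarrow> bool" where
  "mp_representation \<Gamma> \<rho> \<longleftrightarrow> \<rho> \<in> hom (Mp1R\<lparr>carrier := \<Gamma>\<rparr>) GL"

definition harmonic_weak_maass_form ::
  "real \<Rightarrow> mp1 set \<Rightarrow> (mp1 \<Rightarrow> complex^'n^'n) \<Rightarrow> (complex \<Rightarrow> complex^'n) \<Rightarrow> bool" where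
  "harmonic_weak_maass_form k \<Gamma> \<rho> f \<longleftrightarrow>
     smooth_on f uhp \<and>
     (\<forall>\<tau>\<in>uhp. laplace_op k f \<tau> = 0) \<and>
     (\<forall>\<gamma>\<in>\<Gamma>. \<forall>\<tau>\<in>uhp. matrix_inv (\<rho> \<gamma>) *v slash k f \<gamma> \<tau> = f \<tau>) \<and>
     (\<exists>a. \<forall>\<gamma>\<in>carrier Mp1Z. \<exists>C. \<exists>v\<^sub>0>0. \<forall>u v. v \<ge> v\<^sub>0 \<longrightarrow>
        norm (slash k f \<gamma> (Complex u v)) \<le> C * exp (a * v))"

definition weakly_holomorphic_form ::
  "real \<Rightarrow> mp1 set \<Rightarrow> (mp1 \<Rightarrow> complex^'n^'n) \<Rightarrow> (complex \<Rightarrow> complex^'n) \<Rightarrow> bool" where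
  "weakly_holomorphic_form k \<Gamma> \<rho> f \<longleftrightarrow>
     harmonic_weak_maass_form k \<Gamma> \<rho> f \<and> (\<forall>i. (\<lambda>\<tau>. f \<tau> $ i) holomorphic_on uhp)"

definition mp_lift :: "(complex \<Rightarrow> complex^'n) \<Rightarrow> real \<Rightarrow> mp1 \<Rightarrow> complex^'n" where
  "mp_lift f k x = (mp_root x \<i> powi \<lfloor>- 2 * k\<rfloor>) *s f (mp_act x \<i>)"

definition varpi :: "(complex \<Rightarrow> complex^'n) \<Rightarrow> real \<Rightarrow> (mp1 \<Rightarrow> complex^'n) gk_module" where
  "varpi f k = gk_generated (smooth_module (\<lambda>c x. c *s x)) {mp_lift f k}"

end

theory Submission
  imports Defs
begin

text \<open>
  Lifting functions from the upper half plane to the group turns the Lie algebra action into the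
  classical operators: on a lift of weight \<open>j\<close>, \<open>H\<close> is multiplication by \<open>j\<close>, \<open>X\<^sub>+\<close> is \<open>R\<^sub>j\<close> and
  \<open>X\<^sub>-\<close> is \<open>L\<close> (\<open>lie_act_lift\<close>), while \<open>K\<close> acts by a character that determines \<open>j\<close>.

  Let \<open>F\<close> be the lift of a harmonic form \<open>f\<close> of weight \<open>k\<close>. Harmonicity says \<open>X\<^sub>+ X\<^sub>- F = 0\<close>. Together
  with \<open>X\<^sub>+ X\<^sub>- - X\<^sub>- X\<^sub>+ = H\<close>, which is \<open>lower_raise\<close> on the upper half plane, induction gives
    \<open>X\<^sub>- X\<^sub>+\<^sup>n\<^sup>+\<^sup>1 F = - (n + 1) (k + n) X\<^sub>+\<^sup>n F\<close> and, for \<open>G = X\<^sub>- F\<close>,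
    \<open>X\<^sub>+ X\<^sub>-\<^sup>n\<^sup>+\<^sup>1 G = (n + 1) (k - 2 - n) X\<^sub>-\<^sup>n G\<close>.
  As \<open>k\<close> is half of an odd number, no constant vanishes. So the module generated by \<open>F\<close> is spanned
  by the vectors \<open>X\<^sub>+\<^sup>n F\<close> and \<open>X\<^sub>-\<^sup>n G\<close>. Rescaled, they form a sequence \<open>e\<^sub>m\<close>, \<open>m \<in> \<int>\<close>, with \<open>e\<^sub>m\<close> of
  weight \<open>k + 2 m\<close>, on which \<open>X\<^sub>+\<close> and \<open>X\<^sub>-\<close> act by fixed numbers \<open>up k m\<close> and \<open>down k m\<close>: a ladder
  (\<open>ladder_maass\<close>, \<open>ladder_generated\<close>). The functions \<open>\<phi>\<^sub>j\<close> of the principal series, being lifts of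
  powers of \<open>Im \<tau>\<close>, form ladders with the same numbers: those spanning \<open>\<varpi>\<^sup>+(k - 1)\<close> for \<open>m \<ge> 0\<close>,
  those spanning \<open>\<varpi>\<^sup>-(1 - k)\<close> for \<open>m < 0\<close>.

  Nonzero vectors with different \<open>K\<close>-types are linearly independent, so a linear map may be
  prescribed on the rungs of a ladder, and matching rungs of two ladders is a homomorphism
  (\<open>ladder_hom\<close>). If \<open>f\<close> is holomorphic, then \<open>G = 0\<close>, only the rungs with \<open>m \<ge> 0\<close> survive, and
  matching them with \<open>\<varpi>\<^sup>+(k - 1)\<close> is an isomorphism. If \<open>f\<close> is not holomorphic, no rung vanishes;
  matching with the two halves gives the maps of the exact sequence. A splitting would send
  \<open>\<phi>\<^sub>k\<close>, which \<open>X\<^sub>-\<close> annihilates, to a vector of weight \<open>k\<close> above \<open>\<phi>\<^sub>k\<close>. The only such vector is \<open>F\<close>,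
  and \<open>X\<^sub>- F = G\<close> is not zero.
\<close>

section \<open>Smooth functions and mixed partial derivatives\<close>

lemma Ck_on_cong:
  assumes "open S" "\<And>x. x \<in> S \<Longrightarrow> f x = g x"
  shows "Ck_on n f S \<longleftrightarrow> Ck_on n g S"
  using assms(2)
proof (induction n arbitrary: f g)
  case 0
  then show ?case by (auto intro: continuous_on_cong)
next
  case (Suc n)
  have d: "(f has_derivative D) (at x) \<longleftrightarrow> (g has_derivative D) (at x)" if "x \<in> S" for x D
    using Suc.prems has_derivative_transform_within_open[OF _ assms(1) that, of f D UNIV g]
      has_derivative_transform_within_open[OF _ assms(1) that, of g D UNIV f] by auto
  then have "frechet_derivative f (at x) = frechet_derivative g (at x)" if "x \<in> S" for x
    using that unfolding frechet_derivative_def by simp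
  then have "Ck_on n (\<lambda>x. frechet_derivative f (at x) v) S
      \<longleftrightarrow> Ck_on n (\<lambda>x. frechet_derivative g (at x) v) S" for v
    by (intro Suc.IH) simp
  then show ?case using d by (auto simp: differentiable_def)
qed

lemma Ck_on_SucI:
  assumes "open S" "\<And>x. x \<in> S \<Longrightarrow> (f has_derivative f' x) (at x)"
    "\<And>v. Ck_on n (\<lambda>x. f' x v) S"
  shows "Ck_on (Suc n) f S"
proof -
  have "Ck_on n (\<lambda>x. frechet_derivative f (at x) v) S" for v
    using assms(3)[of v] Ck_on_cong[OF assms(1), of "\<lambda>x. frechet_derivative f (at x) v" "\<lambda>x. f' x v" n]
      frechet_derivative_at[OF assms(2)] by simp
  then show ?thesis using assms(2) by (auto simp: differentiable_def)
qed

lemma Ck_on_SucD: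
  assumes "Ck_on (Suc n) f S" "x \<in> S"
  shows "(f has_derivative frechet_derivative f (at x)) (at x)"
  using assms by (simp add: frechet_derivative_works)

lemma Ck_on_lower: "Ck_on (Suc n) f S \<Longrightarrow> Ck_on n f S"
proof (induction n arbitrary: f)
  case 0
  then show ?case
    by (auto intro!: continuous_at_imp_continuous_on differentiable_imp_continuous_within)
next
  case (Suc n)
  then show ?case by (metis Ck_on.simps(2))
qed

lemma Ck_on_const: "Ck_on n (\<lambda>x. c) S"
  by (induction n arbitrary: c) auto

lemma Ck_on_bounded_linear:
  assumes "bounded_linear f" "open S" shows "Ck_on n f S"
proof (cases n)
  case 0
  then show ?thesis using assms by (simp add: linear_continuous_on)
next
  case (Suc m)
  show ?thesis unfolding Suc
    by (rule Ck_on_SucI[OF assms(2) bounded_linear_imp_has_derivative[OF assms(1)] Ck_on_const])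
qed

lemma Ck_on_add:
  "open S \<Longrightarrow> Ck_on n f S \<Longrightarrow> Ck_on n g S \<Longrightarrow> Ck_on n (\<lambda>x. f x + g x) S"
proof (induction n arbitrary: f g)
  case 0
  then show ?case by (auto intro: continuous_intros)
next
  case (Suc n)
  show ?case
    by (rule Ck_on_SucI[OF Suc.prems(1) has_derivative_add[OF Ck_on_SucD[OF Suc.prems(2)] Ck_on_SucD[OF Suc.prems(3)]]])
       (use Suc in auto)
qed

lemma Ck_on_sum:
  "open S \<Longrightarrow> (\<And>i. i \<in> I \<Longrightarrow> Ck_on n (f i) S) \<Longrightarrow> Ck_on n (\<lambda>x. \<Sum>i\<in>I. f i x) S"
  by (induction I rule: infinite_finite_induct) (auto intro: Ck_on_add Ck_on_const)

lemma Ck_on_bilinear: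
  assumes "bounded_bilinear pr" "open S"
  shows "Ck_on n f S \<Longrightarrow> Ck_on n g S \<Longrightarrow> Ck_on n (\<lambda>x. pr (f x) (g x)) S"
proof (induction n arbitrary: f g)
  case 0
  then show ?case by (auto intro: bounded_bilinear.continuous_on[OF assms(1)])
next
  case (Suc n)
  show ?case
    by (rule Ck_on_SucI[OF assms(2) bounded_bilinear.FDERIV[OF assms(1) Ck_on_SucD[OF Suc.prems(1)] Ck_on_SucD[OF Suc.prems(2)]]])
       (use Suc.prems Suc.IH Ck_on_lower[OF Suc.prems(1)] Ck_on_lower[OF Suc.prems(2)] in
         \<open>auto intro!: Ck_on_add[OF assms(2)]\<close>)
qed

text \<open>
  The derivative of \<open>f \<circ> g\<close> along \<open>v\<close> is the derivative of \<open>f\<close> in a direction that moves with the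
  point. Expanding this direction in a basis leaves finitely many products of a component of
  \<open>Dg v\<close> with a partial derivative of \<open>f\<close> along a constant vector, and induction applies to these.
\<close>

lemma Ck_on_compose:
  fixes g :: "'a::real_normed_vector \<Rightarrow> 'b::euclidean_space"
  assumes "open S" "open T" "g ` S \<subseteq> T"
  shows "Ck_on n f T \<Longrightarrow> Ck_on n g S \<Longrightarrow> Ck_on n (\<lambda>x. f (g x)) S"
proof (induction n arbitrary: f)
  case 0
  then show ?case using assms(3) continuous_on_compose2 by auto
next
  case (Suc n)
  let ?D = "\<lambda>f y. frechet_derivative f (at y)"
  have D: "((\<lambda>x. f (g x)) has_derivative (\<lambda>v. \<Sum>b\<in>Basis. (?D g x v \<bullet> b) *\<^sub>R ?D f (g x) b)) (at x)"
    if "x \<in> S" for x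
  proof -
    have f: "(f has_derivative ?D f (g x)) (at (g x))"
      using Ck_on_SucD[OF Suc.prems(1)] assms(3) that by auto
    have lin: "linear (?D f (g x))" using f has_derivative_bounded_linear bounded_linear.linear by blast
    have rep: "?D f (g x) w = (\<Sum>b\<in>Basis. (w \<bullet> b) *\<^sub>R ?D f (g x) b)" for w
    proof -
      have "?D f (g x) w = ?D f (g x) (\<Sum>b\<in>Basis. (w \<bullet> b) *\<^sub>R b)"
        by (simp add: euclidean_representation)
      then show ?thesis by (simp only: linear_sum[OF lin] linear_scale[OF lin])
    qed
    show ?thesis
      unfolding rep[symmetric] by (rule has_derivative_compose[OF Ck_on_SucD[OF Suc.prems(2) that] f])
  qed
  have "Ck_on n (\<lambda>x. \<Sum>b\<in>Basis. (?D g x v \<bullet> b) *\<^sub>R ?D f (g x) b) S" for v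
  proof (intro Ck_on_sum Ck_on_bilinear[OF bounded_bilinear_scaleR assms(1)] assms(1))
    fix b :: 'b
    show "Ck_on n (\<lambda>x. ?D g x v \<bullet> b) S"
      using Suc.prems(2) by (intro Ck_on_bilinear[OF bounded_bilinear_inner assms(1)] Ck_on_const) simp
    show "Ck_on n (\<lambda>x. ?D f (g x) b) S"
      using Suc.prems by (intro Suc.IH Ck_on_lower[of n g]) auto
  qed
  then show ?case by (intro Ck_on_SucI[OF assms(1) D])
qed

lemma smooth_on_cong:
  "open S \<Longrightarrow> (\<And>x. x \<in> S \<Longrightarrow> f x = g x) \<Longrightarrow> smooth_on f S \<longleftrightarrow> smooth_on g S"
  unfolding smooth_on_def using Ck_on_cong by blast

lemma smooth_on_const: "smooth_on (\<lambda>x. c) S"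
  by (simp add: smooth_on_def Ck_on_const)

lemma smooth_on_bounded_linear: "bounded_linear f \<Longrightarrow> open S \<Longrightarrow> smooth_on f S"
  by (simp add: smooth_on_def Ck_on_bounded_linear)

lemma smooth_on_add: "open S \<Longrightarrow> smooth_on f S \<Longrightarrow> smooth_on g S \<Longrightarrow> smooth_on (\<lambda>x. f x + g x) S"
  by (simp add: smooth_on_def Ck_on_add)

lemma smooth_on_bilinear:
  "bounded_bilinear pr \<Longrightarrow> open S \<Longrightarrow> smooth_on f S \<Longrightarrow> smooth_on g S \<Longrightarrow>
    smooth_on (\<lambda>x. pr (f x) (g x)) S"
  by (simp add: smooth_on_def Ck_on_bilinear)

lemma smooth_on_compose:
  fixes g :: "'a::real_normed_vector \<Rightarrow> 'b::euclidean_space"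
  shows "open S \<Longrightarrow> open T \<Longrightarrow> g ` S \<subseteq> T \<Longrightarrow> smooth_on f T \<Longrightarrow> smooth_on g S \<Longrightarrow>
    smooth_on (\<lambda>x. f (g x)) S"
  by (simp add: smooth_on_def Ck_on_compose)

lemma smooth_on_derivative: "smooth_on f S \<Longrightarrow> smooth_on (\<lambda>x. frechet_derivative f (at x) v) S"
  unfolding smooth_on_def by (metis Ck_on.simps(2))

lemma smooth_on_has_derivative:
  "smooth_on f S \<Longrightarrow> x \<in> S \<Longrightarrow> (f has_derivative frechet_derivative f (at x)) (at x)"
  unfolding smooth_on_def using Ck_on_SucD by blast

lemma smooth_on_exp: "smooth_on (exp :: complex \<Rightarrow> complex) UNIV"
proof -
  have "Ck_on n (exp :: complex \<Rightarrow> complex) UNIV" for n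
  proof (induction n)
    case (Suc n)
    have "(exp has_derivative (\<lambda>v. exp z * v)) (at z)" for z :: complex
      using DERIV_exp[of z] by (simp add: has_field_derivative_def)
    then show ?case
      by (rule Ck_on_SucI[OF open_UNIV])
         (intro Ck_on_bilinear[OF bounded_bilinear_mult] Suc Ck_on_const open_UNIV)
  qed (simp add: continuous_on_exp)
  then show ?thesis by (simp add: smooth_on_def)
qed

lemma smooth_on_powr: "smooth_on (\<lambda>x::real. x powr a) {0<..}"
proof -
  have "Ck_on n (\<lambda>x::real. x powr a) {0<..}" for n
  proof (induction n arbitrary: a)
    case (Suc n)
    have D: "((\<lambda>x. x powr a) has_derivative (\<lambda>v. (a * x powr (a - 1)) * v)) (at x)" if "x \<in> {0<..}" for x :: real
      using has_real_derivative_powr[of x a] that by (simp add: has_field_derivative_def)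
    show ?case
      by (rule Ck_on_SucI[OF open_greaterThan D], assumption)
         (intro Ck_on_bilinear[OF bounded_bilinear_mult] Suc Ck_on_const open_greaterThan)
  qed (auto intro!: continuous_intros)
  then show ?thesis by (simp add: smooth_on_def)
qed


text \<open>
  The theorem of Schwarz: two applications of the mean value theorem, in either order, write the
  second difference of \<open>F\<close> over a small square of side \<open>h\<close> as \<open>h\<^sup>2\<close> times either mixed partial
  derivative at some point of the square.
\<close>

lemma real_mixed_partials:
  fixes F :: "real \<times> real \<Rightarrow> real"
  assumes S: "open S" "p \<in> S" and F: "Ck_on (Suc (Suc 0)) F S"
  shows "frechet_derivative (\<lambda>x. frechet_derivative F (at x) (1,0)) (at p) (0,1)
       = frechet_derivative (\<lambda>x. frechet_derivative F (at x) (0,1)) (at p) (1,0)"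
    (is "?A p = ?B p")
proof (rule ccontr)
  assume neq: "?A p \<noteq> ?B p"
  define e where "e = \<bar>?A p - ?B p\<bar> / 2"
  have e: "e > 0" using neq by (simp add: e_def)
  have cont: "continuous_on S ?A" "continuous_on S ?B" using F by auto
  then have "isCont ?A p" "isCont ?B p" using S by (simp_all add: continuous_on_eq_continuous_at)
  then have "\<exists>d>0. \<forall>x. dist x p < d \<longrightarrow> \<bar>?A x - ?A p\<bar> < e"
      "\<exists>d>0. \<forall>x. dist x p < d \<longrightarrow> \<bar>?B x - ?B p\<bar> < e"
    using e unfolding continuous_at_eps_delta dist_real_def by blast+
  then obtain d1 d2 where d: "d1 > 0" "\<And>x. dist x p < d1 \<Longrightarrow> \<bar>?A x - ?A p\<bar> < e"
      "d2 > 0" "\<And>x. dist x p < d2 \<Longrightarrow> \<bar>?B x - ?B p\<bar> < e"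
    by blast
  obtain d3 where d3: "d3 > 0" "ball p d3 \<subseteq> S" using S open_contains_ball by blast
  \<comment> \<open>The divisor \<open>4\<close> keeps the whole square, whose points have distance at most \<open>2 h\<close> from \<open>p\<close>, strictly inside.\<close>
  define h where "h = min d1 (min d2 d3) / 4"
  have h: "h > 0" using d d3 by (simp add: h_def)
  obtain a b where p: "p = (a, b)" by fastforce
  have near: "dist (x, y) p < d1 \<and> dist (x, y) p < d2 \<and> (x, y) \<in> S"
    if "x \<in> {a..a+h}" "y \<in> {b..b+h}" for x y
  proof -
    have "dist (x, y) p \<le> \<bar>x - a\<bar> + \<bar>y - b\<bar>"
      unfolding p dist_Pair_Pair dist_real_def using sqrt_sum_squares_le_sum_abs[of "x - a" "y - b"] by simp
    also have "\<dots> \<le> 2 * h" using that by auto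
    also have "\<dots> < min d1 (min d2 d3)" using h by (auto simp: h_def)
    finally show ?thesis using d3 by (auto simp: dist_commute)
  qed
  let ?Fx = "\<lambda>x. frechet_derivative F (at x) (1,0)" and ?Fy = "\<lambda>x. frechet_derivative F (at x) (0,1)"
  have Dx: "((\<lambda>x. G (x, y)) has_real_derivative frechet_derivative G (at (x, y)) (1,0)) (at x)"
    and Dy: "((\<lambda>y. G (x, y)) has_real_derivative frechet_derivative G (at (x, y)) (0,1)) (at y)"
    if "G differentiable at (x, y)" for G :: "real \<times> real \<Rightarrow> real" and x y
  proof -
    let ?D = "frechet_derivative G (at (x, y))"
    have G: "(G has_derivative frechet_derivative G (at (x, y))) (at (x, y))"
      using that by (simp add: frechet_derivative_works)
    then have lin: "linear (frechet_derivative G (at (x, y)))"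
      using has_derivative_bounded_linear bounded_linear.linear by blast
    have "((\<lambda>x. G (x, y)) has_derivative (\<lambda>v. frechet_derivative G (at (x, y)) (v, 0))) (at x)"
      by (rule has_derivative_compose[of "\<lambda>x. (x, y)" "\<lambda>v. (v, 0)" x UNIV G])
         (use G in \<open>auto intro!: derivative_eq_intros\<close>)
    moreover have "(\<lambda>v. frechet_derivative G (at (x, y)) (v, 0)) = (*) (frechet_derivative G (at (x, y)) (1, 0))"
    proof
      fix v
      have "?D (v, 0) = ?D (v *\<^sub>R (1,0))" by simp
      also have "\<dots> = v *\<^sub>R ?D (1,0)" by (rule linear_scale[OF lin])
      also have "\<dots> = ?D (1,0) * v" by (simp only: real_scaleR_def mult.commute)
      finally show "?D (v, 0) = ?D (1,0) * v" .
    qed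
    ultimately show "((\<lambda>x. G (x, y)) has_real_derivative frechet_derivative G (at (x, y)) (1,0)) (at x)"
      by (simp only: has_field_derivative_def)
    have "((\<lambda>y. G (x, y)) has_derivative (\<lambda>v. frechet_derivative G (at (x, y)) (0, v))) (at y)"
      by (rule has_derivative_compose[of "\<lambda>y. (x, y)" "\<lambda>v. (0, v)" y UNIV G])
         (use G in \<open>auto intro!: derivative_eq_intros\<close>)
    moreover have "(\<lambda>v. frechet_derivative G (at (x, y)) (0, v)) = (*) (frechet_derivative G (at (x, y)) (0, 1))"
    proof
      fix v
      have "?D (0, v) = ?D (v *\<^sub>R (0,1))" by simp
      also have "\<dots> = v *\<^sub>R ?D (0,1)" by (rule linear_scale[OF lin])
      also have "\<dots> = ?D (0,1) * v" by (simp only: real_scaleR_def mult.commute)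
      finally show "?D (0, v) = ?D (0,1) * v" .
    qed
    ultimately show "((\<lambda>y. G (x, y)) has_real_derivative frechet_derivative G (at (x, y)) (0,1)) (at y)"
      by (simp only: has_field_derivative_def)
  qed
  have dF: "F differentiable at q" "?Fx differentiable at q" "?Fy differentiable at q" if "q \<in> S" for q
    using F that by auto
  define \<Delta> where "\<Delta> = F (a+h, b+h) - F (a+h, b) - F (a, b+h) + F (a, b)"
  have "\<exists>x>a. x < a + h \<and> (F (a+h, b+h) - F (a+h, b)) - (F (a, b+h) - F (a, b))
      = ((a+h) - a) * (?Fx (x, b+h) - ?Fx (x, b))"
    by (rule MVT2) (use h near dF in \<open>auto intro!: DERIV_diff Dx\<close>)
  then obtain x where x: "a < x" "x < a+h" "\<Delta> = h * (?Fx (x, b+h) - ?Fx (x, b))"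
    by (auto simp: \<Delta>_def algebra_simps)
  have "\<exists>y>b. y < b + h \<and> ?Fx (x, b+h) - ?Fx (x, b) = ((b+h) - b) * ?A (x, y)"
    by (rule MVT2) (use h near dF x in \<open>auto intro!: Dy\<close>)
  then obtain y where y: "b < y" "y < b+h" "\<Delta> = h * (h * ?A (x, y))" using x by auto
  have "\<exists>y>b. y < b + h \<and> (F (a+h, b+h) - F (a, b+h)) - (F (a+h, b) - F (a, b))
      = ((b+h) - b) * (?Fy (a+h, y) - ?Fy (a, y))"
    by (rule MVT2) (use h near dF in \<open>auto intro!: DERIV_diff Dy\<close>)
  then obtain y' where y': "b < y'" "y' < b+h" "\<Delta> = h * (?Fy (a+h, y') - ?Fy (a, y'))"
    by (auto simp: \<Delta>_def algebra_simps)
  have "\<exists>x>a. x < a + h \<and> ?Fy (a+h, y') - ?Fy (a, y') = ((a+h) - a) * ?B (x, y')"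
    by (rule MVT2) (use h near dF y' in \<open>auto intro!: Dx\<close>)
  then obtain x' where x': "a < x'" "x' < a+h" "\<Delta> = h * (h * ?B (x', y'))" using y' by auto
  have "?A (x, y) = ?B (x', y')" using x' y h by auto
  moreover have "\<bar>?A (x, y) - ?A p\<bar> < e" "\<bar>?B (x', y') - ?B p\<bar> < e"
    using d near[of x y] near[of x' y'] x y x' y' by auto
  moreover have "2 * e = \<bar>?A p - ?B p\<bar>" by (simp add: e_def)
  ultimately show False by linarith
qed


text \<open>
  Pairing with a vector \<open>c\<close> and writing the argument in real coordinates reduces the claim to
  real functions of two real variables.
\<close>

lemma mixed_partials:
  fixes f :: "complex \<Rightarrow> 'v::euclidean_space"
  assumes S: "open S" "\<tau> \<in> S" and f: "smooth_on f S"
  shows "frechet_derivative (\<lambda>z. frechet_derivative f (at z) 1) (at \<tau>) \<i>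
       = frechet_derivative (\<lambda>z. frechet_derivative f (at z) \<i>) (at \<tau>) 1"
proof (rule euclidean_eqI)
  fix c :: 'v
  let ?C = "\<lambda>q. Complex (fst q) (snd q)"
  let ?P = "\<lambda>G q. G (?C q) \<bullet> c"
  have C: "?C q = of_real (fst q) + \<i> * of_real (snd q)" for q by (simp add: complex_eq_iff)
  have blC: "bounded_linear ?C"
    unfolding C by (intro bounded_linear_add bounded_linear_compose[OF bounded_linear_mult_right]
      bounded_linear_compose[OF bounded_linear_of_real] bounded_linear_fst bounded_linear_snd)
  let ?S = "?C -` S"
  have openS: "open ?S"
    using S(1) blC by (intro open_vimage) (auto simp: linear_continuous_on)
  have D: "frechet_derivative (?P G) (at q) w = frechet_derivative G (at (?C q)) (?C w) \<bullet> c"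
    if "smooth_on G S" "q \<in> ?S" for G :: "complex \<Rightarrow> 'v" and q w
  proof -
    have "((\<lambda>q. G (?C q)) has_derivative (\<lambda>w. frechet_derivative G (at (?C q)) (?C w))) (at q)"
      by (rule has_derivative_compose[of ?C ?C q UNIV G])
         (use that smooth_on_has_derivative blC in \<open>auto intro: bounded_linear_imp_has_derivative\<close>)
    then have "(?P G has_derivative (\<lambda>w. frechet_derivative G (at (?C q)) (?C w) \<bullet> c)) (at q)"
      by (rule has_derivative_inner_left)
    from fun_cong[OF frechet_derivative_at[OF this]] show ?thesis by (rule sym)
  qed
  let ?p = "(Re \<tau>, Im \<tau>)"
  have p: "?p \<in> ?S" "?C ?p = \<tau>" using S by simp_all
  have smooth: "smooth_on (?P f) ?S"
    by (intro smooth_on_bilinear[OF bounded_bilinear_inner] smooth_on_const openS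
        smooth_on_compose[OF openS S(1) _ f] smooth_on_bounded_linear blC) auto
  have second: "frechet_derivative (\<lambda>q. frechet_derivative (?P f) (at q) v) (at ?p) w
      = frechet_derivative (\<lambda>z. frechet_derivative f (at z) (?C v)) (at \<tau>) (?C w) \<bullet> c" for v w
  proof -
    let ?G = "\<lambda>z. frechet_derivative f (at z) (?C v)"
    have 1: "((\<lambda>q. frechet_derivative (?P f) (at q) v) has_derivative
        frechet_derivative (\<lambda>q. frechet_derivative (?P f) (at q) v) (at ?p)) (at ?p)"
      using smooth_on_has_derivative[OF smooth_on_derivative[OF smooth] p(1)] .
    have "(?P ?G has_derivative
        frechet_derivative (\<lambda>q. frechet_derivative (?P f) (at q) v) (at ?p)) (at ?p)"
      by (rule has_derivative_transform_within_open[OF 1 openS p(1)]) (use D[OF f] in simp)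
    from fun_cong[OF frechet_derivative_at[OF this], of w] show ?thesis
      using D[OF smooth_on_derivative[OF f] p(1), of "?C v" w] p(2) by simp
  qed
  have "Ck_on (Suc (Suc 0)) (?P f) ?S" using smooth unfolding smooth_on_def by blast
  from real_mixed_partials[OF openS p(1) this]
  show "frechet_derivative (\<lambda>z. frechet_derivative f (at z) 1) (at \<tau>) \<i> \<bullet> c
      = frechet_derivative (\<lambda>z. frechet_derivative f (at z) \<i>) (at \<tau>) 1 \<bullet> c"
    unfolding second by (simp add: Complex_eq)
qed

section \<open>Raising and lowering operators on the upper half plane\<close>

lemma open_uhp: "open uhp"
  by (simp add: uhp_def open_halfspace_Im_gt)

lemma smooth_on_Im_powr: "smooth_on (\<lambda>z. complex_of_real (Im z powr a)) uhp"
proof -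
  have "smooth_on (\<lambda>z. Im z powr a) uhp"
    by (rule smooth_on_compose[OF open_uhp open_greaterThan _ smooth_on_powr
          smooth_on_bounded_linear[OF bounded_linear_Im open_uhp]])
       (auto simp: uhp_def)
  then show ?thesis
    by (intro smooth_on_compose[OF open_uhp open_UNIV subset_UNIV
        smooth_on_bounded_linear[OF bounded_linear_of_real open_UNIV]])
qed

text \<open>
  The complex vector space in which functions take their values. It is used for \<open>\<complex>\<^sup>n\<close>, where the
  forms live, and for \<open>\<complex>\<close>, where the principal series lives, so the scalar multiplication is a
  parameter, as it is in \<^const>\<open>lie_act\<close>.
\<close>

locale complex_normed = vector_space s + bounded_bilinear s
  for s :: "complex \<Rightarrow> 'v::euclidean_space \<Rightarrow> 'v" +
  assumes scale_of_real: "s (of_real r) x = r *\<^sub>R x"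
begin

abbreviation D :: "(complex \<Rightarrow> 'v) \<Rightarrow> complex \<Rightarrow> complex \<Rightarrow> 'v" where
  "D h \<tau> \<equiv> frechet_derivative h (at \<tau>)"

definition wirtinger :: "(complex \<Rightarrow> 'v) \<Rightarrow> complex \<Rightarrow> 'v" where
  "wirtinger h \<tau> = s (1/2) (D h \<tau> 1 - s \<i> (D h \<tau> \<i>))"

definition wirtinger_bar :: "(complex \<Rightarrow> 'v) \<Rightarrow> complex \<Rightarrow> 'v" where
  "wirtinger_bar h \<tau> = s (1/2) (D h \<tau> 1 + s \<i> (D h \<tau> \<i>))"

definition raise :: "real \<Rightarrow> (complex \<Rightarrow> 'v) \<Rightarrow> complex \<Rightarrow> 'v" where
  "raise j h \<tau> = s (2 * \<i>) (wirtinger h \<tau>) + s (of_real (j / Im \<tau>)) (h \<tau>)"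

definition lower :: "(complex \<Rightarrow> 'v) \<Rightarrow> complex \<Rightarrow> 'v" where
  "lower h \<tau> = s (- 2 * \<i> * of_real ((Im \<tau>)\<^sup>2)) (wirtinger_bar h \<tau>)"

lemma smooth_on_scale:
  "smooth_on c uhp \<Longrightarrow> smooth_on h uhp \<Longrightarrow> smooth_on (\<lambda>z. s (c z) (h z)) uhp"
  by (rule smooth_on_bilinear[OF bounded_bilinear_axioms open_uhp])

lemma smooth_on_raise:
  assumes "smooth_on h uhp" shows "smooth_on (raise j h) uhp"
proof -
  have "smooth_on (\<lambda>z. s (2 * \<i>) (s (1/2) (D h z 1 + s (- \<i>) (D h z \<i>)))
      + s (of_real j * of_real (Im z powr - 1)) (h z)) uhp"
    by (intro smooth_on_add open_uhp smooth_on_scale smooth_on_const smooth_on_derivative assms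
        smooth_on_bilinear[OF bounded_bilinear_mult] smooth_on_Im_powr)
  then show ?thesis
    by (rule smooth_on_cong[OF open_uhp, THEN iffD1, rotated])
       (simp add: raise_def wirtinger_def uhp_def powr_neg_one)
qed

lemma smooth_on_lower:
  assumes "smooth_on h uhp" shows "smooth_on (lower h) uhp"
proof -
  have "smooth_on (\<lambda>z. s ((- 2 * \<i>) * of_real (Im z powr 2)) (s (1/2) (D h z 1 + s \<i> (D h z \<i>)))) uhp"
    by (intro smooth_on_add open_uhp smooth_on_scale smooth_on_const smooth_on_derivative assms
        smooth_on_bilinear[OF bounded_bilinear_mult] smooth_on_Im_powr)
  then show ?thesis
    by (rule smooth_on_cong[OF open_uhp, THEN iffD1, rotated])
       (simp add: lower_def wirtinger_bar_def uhp_def)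
qed

lemma frechet_derivative_cong_uhp:
  assumes "\<tau> \<in> uhp" "\<And>z. z \<in> uhp \<Longrightarrow> g z = h z"
  shows "D g \<tau> = D h \<tau>"
proof -
  have "(g has_derivative G) (at \<tau>) \<longleftrightarrow> (h has_derivative G) (at \<tau>)" for G
    using assms has_derivative_transform_within_open[OF _ open_uhp assms(1), of g G UNIV h]
      has_derivative_transform_within_open[OF _ open_uhp assms(1), of h G UNIV g] by auto
  then show ?thesis unfolding frechet_derivative_def by simp
qed

lemma raise_cong: "\<tau> \<in> uhp \<Longrightarrow> (\<And>z. z \<in> uhp \<Longrightarrow> g z = h z) \<Longrightarrow> raise j g \<tau> = raise j h \<tau>"
  using frechet_derivative_cong_uhp[of \<tau> g h] by (simp add: raise_def wirtinger_def)

lemma lower_cong: "\<tau> \<in> uhp \<Longrightarrow> (\<And>z. z \<in> uhp \<Longrightarrow> g z = h z) \<Longrightarrow> lower g \<tau> = lower h \<tau>"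
  using frechet_derivative_cong_uhp[of \<tau> g h] by (simp add: lower_def wirtinger_bar_def)

lemma D_scale_const:
  assumes "smooth_on h uhp" "\<tau> \<in> uhp"
  shows "D (\<lambda>z. s c (h z)) \<tau> = (\<lambda>w. s c (D h \<tau> w))"
  using frechet_derivative_at[OF bounded_linear.has_derivative[OF bounded_linear_right
      smooth_on_has_derivative[OF assms]]] by metis

lemma raise_scale:
  assumes "smooth_on h uhp" "\<tau> \<in> uhp"
  shows "raise j (\<lambda>z. s c (h z)) \<tau> = s c (raise j h \<tau>)"
  by (simp add: raise_def wirtinger_def D_scale_const[OF assms] scale_right_distrib
      scale_right_diff_distrib mult_ac)

lemma lower_scale:
  assumes "smooth_on h uhp" "\<tau> \<in> uhp"
  shows "lower (\<lambda>z. s c (h z)) \<tau> = s c (lower h \<tau>)"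
  by (simp add: lower_def wirtinger_bar_def D_scale_const[OF assms] scale_right_distrib
      scale_right_diff_distrib mult_ac)

end

context complex_normed begin

lemma D_raise:
  assumes h: "smooth_on h uhp" and t: "\<tau> \<in> uhp"
  shows "D (raise j h) \<tau> w =
    s (2 * \<i>) (s (1/2) (D (\<lambda>z. D h z 1) \<tau> w - s \<i> (D (\<lambda>z. D h z \<i>) \<tau> w))) +
    (s (of_real (j / Im \<tau>)) (D h \<tau> w) + s (of_real (- j * Im w / (Im \<tau>)\<^sup>2)) (h \<tau>))"
proof -
  have c: "((\<lambda>z. complex_of_real (j / Im z)) has_derivative (\<lambda>w. of_real (- j * Im w / (Im \<tau>)\<^sup>2))) (at \<tau>)"
    using t by (auto intro!: derivative_eq_intros simp: uhp_def power2_eq_square field_simps)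
  show ?thesis
    unfolding raise_def wirtinger_def
    by (rule fun_cong[OF frechet_derivative_at[symmetric]])
       (intro has_derivative_add has_derivative_diff bounded_linear.has_derivative[OF bounded_linear_right]
          FDERIV c smooth_on_has_derivative[OF _ t] smooth_on_derivative h)
qed

lemma D_lower:
  assumes h: "smooth_on h uhp" and t: "\<tau> \<in> uhp"
  shows "D (lower h) \<tau> w =
    s (- 2 * \<i> * of_real ((Im \<tau>)\<^sup>2)) (s (1/2) (D (\<lambda>z. D h z 1) \<tau> w + s \<i> (D (\<lambda>z. D h z \<i>) \<tau> w))) +
    s (- 4 * \<i> * of_real (Im \<tau> * Im w)) (s (1/2) (D h \<tau> 1 + s \<i> (D h \<tau> \<i>)))"
proof -
  have c: "((\<lambda>z. - 2 * \<i> * complex_of_real ((Im z)\<^sup>2)) has_derivative (\<lambda>w. - 4 * \<i> * of_real (Im \<tau> * Im w))) (at \<tau>)"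
    by (auto intro!: derivative_eq_intros)
  show ?thesis
    unfolding lower_def wirtinger_bar_def
    by (rule fun_cong[OF frechet_derivative_at[symmetric]])
       (intro has_derivative_add bounded_linear.has_derivative[OF bounded_linear_right]
          FDERIV c smooth_on_has_derivative[OF _ t] smooth_on_derivative h)
qed

end

lemma norm_vector_scalar_mult: "norm (c *s (x :: complex^'n)) = cmod c * norm x"
  by (simp add: norm_vec_def norm_mult L2_set_right_distrib)

interpretation cvec: complex_normed "(*s) :: complex \<Rightarrow> complex^'n \<Rightarrow> complex^'n"
proof unfold_locales
  show "\<exists>K. \<forall>c (x :: complex^'n). norm (c *s x) \<le> norm c * norm x * K"
    by (intro exI[of _ 1]) (simp add: norm_vector_scalar_mult)
qed (simp_all add: vec_eq_iff algebra_simps scaleR_conv_of_real[where 'a=complex])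

interpretation cplx: complex_normed "(*) :: complex \<Rightarrow> complex \<Rightarrow> complex"
  by unfold_locales (auto simp: algebra_simps scaleR_conv_of_real norm_mult intro!: exI[of _ 1])

text \<open>
  The commutation relation of \<open>X\<^sub>+\<close> and \<open>X\<^sub>-\<close> on functions of weight \<open>j\<close>. The second order terms
  agree because mixed partial derivatives do; differentiating the factors \<open>j / Im \<tau>\<close> and
  \<open>(Im \<tau>)\<^sup>2\<close> leaves first order terms, which cancel after the shift of the weight by \<open>2\<close>, and the
  term \<open>j f\<close>.
\<close>

lemma lower_raise:
  fixes f :: "complex \<Rightarrow> complex^'n"
  assumes f: "smooth_on f uhp" and t: "\<tau> \<in> uhp"
  shows "cvec.lower (cvec.raise j f) \<tau> = cvec.raise (j - 2) (cvec.lower f) \<tau> - of_real j *s f \<tau>"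
proof -
  have v: "complex_of_real (Im \<tau>) \<noteq> 0" using t by (simp add: uhp_def)
  show ?thesis
    unfolding cvec.lower_def[of "cvec.raise j f"] cvec.wirtinger_bar_def[of "cvec.raise j f"]
      cvec.raise_def[of _ "cvec.lower f"] cvec.wirtinger_def[of "cvec.lower f"]
      cvec.D_raise[OF f t] cvec.D_lower[OF f t] mixed_partials[OF open_uhp t f]
    unfolding cvec.lower_def cvec.wirtinger_bar_def
    using v by (simp add: vec_eq_iff divide_simps power2_eq_square) (simp add: algebra_simps)
qed

section \<open>Elements of the metaplectic group\<close>

lemma i_uhp: "\<i> \<in> uhp" by (simp add: uhp_def)

lemma convex_uhp: "convex uhp"
  by (simp add: uhp_def convex_halfspace_Im_gt)

text \<open>
  The quotient of the two roots is continuous and takes only the values \<open>1\<close> and \<open>-1\<close>.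
\<close>

lemma continuous_roots_agree:
  fixes f g :: "'a::topological_space \<Rightarrow> complex"
  assumes "connected S" "continuous_on S f" "continuous_on S g"
    and sq: "\<And>x. x \<in> S \<Longrightarrow> (f x)\<^sup>2 = (g x)\<^sup>2" and nz: "\<And>x. x \<in> S \<Longrightarrow> g x \<noteq> 0"
    and a: "a \<in> S" "f a = g a" and x: "x \<in> S"
  shows "f x = g x"
proof -
  have "continuous_on S (\<lambda>x. f x / g x)"
    using assms by (intro continuous_intros) auto
  moreover have "finite ((\<lambda>x. f x / g x) ` S)"
  proof (rule finite_subset[of _ "{1, -1}"])
    show "(\<lambda>x. f x / g x) ` S \<subseteq> {1, - 1}"
    proof (rule image_subsetI)
      fix x assume "x \<in> S"
      then have "(f x / g x)\<^sup>2 = 1" using sq nz by (simp add: power_divide)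
      then show "f x / g x \<in> {1, - 1}" by (simp add: power2_eq_1_iff)
    qed
  qed simp
  ultimately have "(\<lambda>x. f x / g x) constant_on S"
    using continuous_finite_range_constant assms(1) by blast
  then have "f x / g x = f a / g a" unfolding constant_on_def using a(1) x by metis
  then show ?thesis using a nz[OF a(1)] nz[OF x] by simp
qed

lemma mp_root_nz: "\<tau> \<in> uhp \<Longrightarrow> mp_root x \<tau> \<noteq> 0"
  using mp_root_sq[of \<tau> x] aut_factor_nz[OF mp_mat_det, of \<tau> x] by auto

lemma mp_mult_eq: "x \<otimes>\<^bsub>Mp1R\<^esub> y = mp_mult x y"
  by (simp add: Mp1R_def)

lemma mp_act_mult: "\<tau> \<in> uhp \<Longrightarrow> mp_act (mp_mult x y) \<tau> = mp_act x (mp_act y \<tau>)"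
  by (simp add: mp_act_def mp_mat_mult mat_act_mult mp_mat_det)

lemma mp1_eqI_mat:
  assumes "mp_mat x = mp_mat y" "mp_root x \<i> = mp_root y \<i>"
  shows "x = y"
proof (rule mp1_eqI[OF assms(1)])
  fix \<tau> assume "\<tau> \<in> uhp"
  then show "mp_root x \<tau> = mp_root y \<tau>"
    by (intro continuous_roots_agree[OF convex_connected[OF convex_uhp], of "mp_root x" "mp_root y" \<i> \<tau>])
       (auto simp: holomorphic_on_imp_continuous_on mp_root_holo mp_root_sq mp_root_nz assms i_uhp)
qed

lemma mat_eq_iff:
  fixes A B :: "'a^2^2"
  shows "A = B \<longleftrightarrow> A$1$1 = B$1$1 \<and> A$1$2 = B$1$2 \<and> A$2$1 = B$2$1 \<and> A$2$2 = B$2$2"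
  by (auto simp: vec_eq_iff forall_2)

text \<open>
  An element is determined by where it moves \<open>\<i>\<close> and by its root there: the square of the root is
  \<open>c \<i> + d\<close> and so gives the bottom row of the matrix, and the image of \<open>\<i>\<close> then gives the top row.
\<close>

lemma mp1_eqI_point:
  assumes act: "mp_act x \<i> = mp_act y \<i>" and root: "mp_root x \<i> = mp_root y \<i>"
  shows "x = y"
proof (rule mp1_eqI_mat[OF _ root])
  have bot: "aut_factor (mp_mat x) \<i> = aut_factor (mp_mat y) \<i>"
    using mp_root_sq[OF i_uhp] root by metis
  with act aut_factor_nz[OF mp_mat_det i_uhp, of y]
  have "of_real (mp_mat x$1$1) * \<i> + of_real (mp_mat x$1$2)
      = of_real (mp_mat y$1$1) * \<i> + complex_of_real (mp_mat y$1$2)"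
    by (simp add: mp_act_def mat_act_eq)
  with bot show "mp_mat x = mp_mat y"
    by (simp add: mat_eq_iff aut_factor_def complex_eq_iff)
qed

text \<open>
  On the upper half plane \<open>c \<tau> + d\<close> is never real if \<open>c \<noteq> 0\<close>, and it is a nonzero real constant if
  \<open>c = 0\<close>. So \<open>c \<tau> + d\<close> or its negative avoids the half line where the principal square root jumps.
\<close>

lemma holomorphic_root_exists:
  assumes "det A = 1"
  obtains w where "w holomorphic_on uhp" "\<And>\<tau>. \<tau> \<in> uhp \<Longrightarrow> (w \<tau>)\<^sup>2 = aut_factor A \<tau>"
proof (cases "A$2$1 > 0 \<or> A$2$1 = 0 \<and> A$2$2 > 0")
  case True
  have "aut_factor A \<tau> \<notin> \<real>\<^sub>\<le>\<^sub>0" if "\<tau> \<in> uhp" for \<tau>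
    using True that by (auto simp: aut_factor_def complex_nonpos_Reals_iff uhp_def)
  then have "(\<lambda>\<tau>. csqrt (aut_factor A \<tau>)) holomorphic_on uhp"
    by (intro holomorphic_intros) (auto simp: aut_factor_def intro!: holomorphic_intros)
  then show thesis by (rule that) simp
next
  case False
  have "- aut_factor A \<tau> \<notin> \<real>\<^sub>\<le>\<^sub>0" if "\<tau> \<in> uhp" for \<tau>
    using False that assms
    by (auto simp: aut_factor_def complex_nonpos_Reals_iff uhp_def det_2 mult_less_0_iff)
  then have "(\<lambda>\<tau>. \<i> * csqrt (- aut_factor A \<tau>)) holomorphic_on uhp"
    by (intro holomorphic_intros) (auto simp: aut_factor_def intro!: holomorphic_intros)
  then show thesis by (rule that) (simp add: power_mult_distrib)
qed

lemma mp1_exists: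
  assumes "det A = 1" "z\<^sup>2 = aut_factor A \<i>"
  obtains x where "mp_mat x = A" "mp_root x \<i> = z"
proof -
  obtain w where w: "w holomorphic_on uhp" "\<And>\<tau>. \<tau> \<in> uhp \<Longrightarrow> (w \<tau>)\<^sup>2 = aut_factor A \<tau>"
    using holomorphic_root_exists[OF assms(1)] by blast
  \<comment> \<open>The sign that turns the root \<open>w\<close> into the one with value \<open>z\<close> at \<open>\<i>\<close>.\<close>
  define e :: complex where "e = (if w \<i> = z then 1 else - 1)"
  have "w \<i> = z \<or> w \<i> = - z"
    using w(2)[OF i_uhp] assms(2) by (metis power2_eq_iff)
  then have e: "e\<^sup>2 = 1" "e * w \<i> = z" by (auto simp: e_def)
  have "(\<lambda>\<tau>. e * w \<tau>) holomorphic_on uhp" using w by (intro holomorphic_intros)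
  moreover have "(e * w \<tau>)\<^sup>2 = aut_factor A \<tau>" if "\<tau> \<in> uhp" for \<tau>
    using w that e by (simp add: power_mult_distrib)
  ultimately show thesis
    using that[of "Abs_mp1 (A, \<lambda>\<tau>\<in>uhp. e * w \<tau>)"] mp_mat_Abs[OF assms(1), of "\<lambda>\<tau>. e * w \<tau>"] e i_uhp
    by simp
qed

section \<open>Iwasawa decomposition\<close>

lemma mp_k:
  shows mp_mat_k: "mp_mat (mp_k \<theta>) = vector [vector [cos \<theta>, sin \<theta>], vector [- sin \<theta>, cos \<theta>]]"
    and mp_root_k: "mp_root (mp_k \<theta>) \<i> = exp (- \<i> * of_real \<theta> / 2)"
proof -
  let ?A = "vector [vector [cos \<theta>, sin \<theta>], vector [- sin \<theta>, cos \<theta>]] :: real^2^2"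
  have "(exp (- \<i> * of_real \<theta> / 2))\<^sup>2 = exp (- (\<i> * of_real \<theta>))"
    by (simp add: exp_double[symmetric])
  also have "\<dots> = aut_factor ?A \<i>"
    by (simp add: aut_factor_def exp_minus_Euler cos_of_real sin_of_real)
  finally have sq: "(exp (- \<i> * of_real \<theta> / 2))\<^sup>2 = aut_factor ?A \<i>" .
  have "det ?A = 1" by (simp add: det_2)
  then obtain x where x: "mp_mat x = ?A" "mp_root x \<i> = exp (- \<i> * of_real \<theta> / 2)"
    using mp1_exists[OF _ sq] by metis
  have "mp_mat (mp_k \<theta>) = ?A \<and> mp_root (mp_k \<theta>) \<i> = exp (- \<i> * of_real \<theta> / 2)"
    unfolding mp_k_def
    by (rule theI[of _ x]) (use x in \<open>auto intro: mp1_eqI_mat\<close>)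
  then show "mp_mat (mp_k \<theta>) = ?A" "mp_root (mp_k \<theta>) \<i> = exp (- \<i> * of_real \<theta> / 2)" by auto
qed

lemma mp_n:
  shows mp_act_n: "mp_act (mp_n b) \<tau> = \<tau> + of_real b"
    and mp_root_n: "\<tau> \<in> uhp \<Longrightarrow> mp_root (mp_n b) \<tau> = 1"
proof -
  let ?A = "vector [vector [1, b], vector [0, 1]] :: real^2^2"
  have *: "det ?A = 1" "(\<lambda>_. 1::complex) holomorphic_on uhp" "\<And>\<tau>. \<tau> \<in> uhp \<Longrightarrow> (1::complex)\<^sup>2 = aut_factor ?A \<tau>"
    by (simp_all add: det_2 aut_factor_def)
  show "mp_act (mp_n b) \<tau> = \<tau> + of_real b"
    using mp_mat_Abs(1)[OF *] by (simp add: mp_act_def mp_n_def mat_act_eq aut_factor_def)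
  show "mp_root (mp_n b) \<tau> = 1" if "\<tau> \<in> uhp"
    using mp_mat_Abs(2)[OF *] that by (simp add: mp_n_def)
qed

lemma mp_m:
  assumes "a > 0"
  shows mp_act_m: "mp_act (mp_m a) \<tau> = of_real (a\<^sup>2) * \<tau>"
    and mp_root_m: "\<tau> \<in> uhp \<Longrightarrow> mp_root (mp_m a) \<tau> = of_real (a powr (- 1/2))"
proof -
  let ?A = "vector [vector [a, 0], vector [0, inverse a]] :: real^2^2"
  have "(complex_of_real (a powr (- 1/2)))\<^sup>2 = of_real (a powr - 1)"
    using assms by (simp add: power2_eq_square powr_add[symmetric] of_real_mult[symmetric] del: of_real_mult)
  also have "\<dots> = inverse (of_real a)"
    using assms by (simp add: powr_neg_one inverse_eq_divide)
  finally have *: "det ?A = 1" "(\<lambda>_. complex_of_real (a powr (- 1/2))) holomorphic_on uhp"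
     "\<And>\<tau>. \<tau> \<in> uhp \<Longrightarrow> (complex_of_real (a powr (- 1/2)))\<^sup>2 = aut_factor ?A \<tau>"
    using assms by (simp_all add: det_2 aut_factor_def)
  show "mp_act (mp_m a) \<tau> = of_real (a\<^sup>2) * \<tau>"
  proof -
    have "mp_mat (mp_m a) = ?A" using mp_mat_Abs(1)[OF *] by (simp add: mp_m_def)
    then show ?thesis using assms by (simp add: mp_act_def mat_act_eq aut_factor_def field_simps power2_eq_square)
  qed
  show "mp_root (mp_m a) \<tau> = of_real (a powr (- 1/2))" if "\<tau> \<in> uhp"
    using mp_mat_Abs(2)[OF *] that by (simp add: mp_m_def)
qed

lemma mp_act_k: "mp_act (mp_k \<theta>) \<i> = \<i>"
proof -
  have "aut_factor (mp_mat (mp_k \<theta>)) \<i> \<noteq> 0" by (rule aut_factor_nz[OF mp_mat_det i_uhp])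
  then show ?thesis
    by (simp add: mp_act_def mat_act_eq field_simps) (simp add: mp_mat_k aut_factor_def algebra_simps)
qed

abbreviation iwasawa :: "real \<Rightarrow> real \<Rightarrow> real \<Rightarrow> mp1" where
  "iwasawa b a \<theta> \<equiv> mp_n b \<otimes>\<^bsub>Mp1R\<^esub> mp_m a \<otimes>\<^bsub>Mp1R\<^esub> mp_k \<theta>"

lemma iwasawa:
  assumes "a > 0"
  shows mp_act_iwasawa: "mp_act (iwasawa b a \<theta>) \<i> = Complex b (a\<^sup>2)"
    and mp_root_iwasawa: "mp_root (iwasawa b a \<theta>) \<i> = of_real (a powr (- 1/2)) * exp (- \<i> * of_real \<theta> / 2)"
proof -
  have m: "mp_act (mp_m a) \<i> \<in> uhp" by (rule mp_act_uhp[OF i_uhp])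
  show "mp_act (iwasawa b a \<theta>) \<i> = Complex b (a\<^sup>2)"
    by (simp add: mp_mult_eq mp_act_mult i_uhp mp_act_k mp_act_n mp_act_m assms Complex_eq)
  show "mp_root (iwasawa b a \<theta>) \<i> = of_real (a powr (- 1/2)) * exp (- \<i> * of_real \<theta> / 2)"
    by (simp add: mp_mult_eq mp_root_mult i_uhp mp_act_k mp_root_n mp_root_m mp_root_k assms m)
qed

lemma Im_mp_act: "Im (mp_act x \<i>) = 1 / (cmod (mp_root x \<i>))^4"
proof -
  let ?A = "mp_mat x"
  have d: "?A$1$1 * ?A$2$2 - ?A$1$2 * ?A$2$1 = 1" using mp_mat_det[of x] by (simp add: det_2)
  have re: "Re (aut_factor ?A \<i>) = ?A$2$2" "Im (aut_factor ?A \<i>) = ?A$2$1"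
    by (simp_all add: aut_factor_def)
  have "Im (mp_act x \<i>) = (?A$1$1 * ?A$2$2 - ?A$1$2 * ?A$2$1) / ((?A$2$2)\<^sup>2 + (?A$2$1)\<^sup>2)"
    unfolding mp_act_def mat_act_eq Im_divide re by simp
  then have "Im (mp_act x \<i>) = 1 / (cmod (aut_factor ?A \<i>))\<^sup>2"
    unfolding d cmod_power2 re .
  then show ?thesis
    by (simp add: mp_root_sq[OF i_uhp, symmetric] norm_power power_mult[symmetric])
qed

text \<open>
  The image of \<open>\<i>\<close> gives \<open>b\<close> and \<open>a\<close>, and the argument of the root at \<open>\<i>\<close> gives \<open>\<theta>\<close>, including the
  sheet of the covering; \<open>mp1_eqI_point\<close> says that nothing else has to be matched.
\<close>

lemma iwasawa_exists: "\<exists>b a \<theta>. a > 0 \<and> x = iwasawa b a \<theta>"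
proof -
  let ?z = "mp_root x \<i>"
  have z: "cmod ?z > 0" using mp_root_nz[OF i_uhp] by simp
  define a where "a = (cmod ?z) powr - 2"
  have a: "a > 0" using z by (simp add: a_def)
  have a2: "a\<^sup>2 = Im (mp_act x \<i>)"
  proof -
    have "a = 1 / (cmod ?z)\<^sup>2" using z by (simp add: a_def powr_minus_divide)
    then show ?thesis by (simp add: Im_mp_act power_divide flip: power_mult)
  qed
  have "a powr (- 1/2) = cmod ?z" using z by (simp add: a_def powr_powr)
  then have "mp_root x \<i> = mp_root (iwasawa (Re (mp_act x \<i>)) a (- 2 * Arg ?z)) \<i>"
    using z by (simp add: mp_root_iwasawa[OF a] Arg_eq[symmetric])
  moreover have "mp_act x \<i> = mp_act (iwasawa (Re (mp_act x \<i>)) a (- 2 * Arg ?z)) \<i>"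
    by (simp add: mp_act_iwasawa[OF a] a2)
  ultimately have "x = iwasawa (Re (mp_act x \<i>)) a (- 2 * Arg ?z)" by (intro mp1_eqI_point)
  then show ?thesis using a by blast
qed

text \<open>
  For a matrix in \<open>SL\<^sub>2(\<real>)\<close> with orthonormal rows the squares \<open>(a - d)\<^sup>2 + (b + c)\<^sup>2\<close> add up to
  \<open>1 + 1 - 2 (a d - b c) = 0\<close>, and a matrix with \<open>a = d\<close>, \<open>b = - c\<close> fixes \<open>\<i>\<close>.
\<close>

lemma mp_act_K:
  assumes "\<kappa> \<in> mp_K" shows "mp_act \<kappa> \<i> = \<i>"
proof -
  let ?A = "mp_mat \<kappa>"
  have o: "transpose ?A ** ?A = mat 1" "?A ** transpose ?A = mat 1"
    using assms by (simp_all add: mp_K_def rotation_matrix_def orthogonal_matrix_def)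
  have d: "?A$1$1 * ?A$2$2 - ?A$1$2 * ?A$2$1 = 1" using mp_mat_det[of \<kappa>] by (simp add: det_2)
  from o have e: "?A$1$1 * ?A$1$1 + ?A$1$2 * ?A$1$2 = 1" "?A$2$1 * ?A$2$1 + ?A$2$2 * ?A$2$2 = 1"
    by (simp_all add: mat_eq_iff mat_mult_2 transpose_def mat_def)
  have "(?A$1$1 - ?A$2$2)\<^sup>2 + (?A$1$2 + ?A$2$1)\<^sup>2 = 0"
    using d e by (simp add: power2_eq_square algebra_simps)
  then have "?A$1$1 = ?A$2$2" "?A$1$2 = - ?A$2$1" by (auto dest!: sum_power2_eq_zero_iff[THEN iffD1])
  then show ?thesis
    using aut_factor_nz[OF mp_mat_det i_uhp, of \<kappa>]
    by (simp add: mp_act_def mat_act_eq field_simps) (simp add: aut_factor_def algebra_simps)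
qed

lemma mp_k_in_K: "mp_k \<theta> \<in> mp_K"
  by (simp add: mp_K_def rotation_matrix_def mp_mat_det orthogonal_matrix mp_mat_k mat_eq_iff
      mat_mult_2 transpose_def mat_def power2_eq_square[symmetric])

section \<open>One-parameter subgroups\<close>

interpretation matmul: bounded_bilinear "(**) :: real^2^2 \<Rightarrow> real^2^2 \<Rightarrow> real^2^2"
proof -
  have "bilinear ((**) :: real^2^2 \<Rightarrow> real^2^2 \<Rightarrow> real^2^2)"
    by (auto simp: bilinear_def intro!: linearI simp: mat_eq_iff mat_mult_2 algebra_simps)
  then show "bounded_bilinear ((**) :: real^2^2 \<Rightarrow> real^2^2 \<Rightarrow> real^2^2)"
    by (simp add: bilinear_conv_bounded_bilinear)
qed

lemma one_param_mat:
  assumes "one_param_subgroup X c"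
  shows "mp_mat (c (s + t)) = mp_mat (c s) ** mp_mat (c t)" "c 0 = \<one>\<^bsub>Mp1R\<^esub>"
    "((\<lambda>t. mp_mat (c t)) has_vector_derivative mp_mat (c t) ** X) (at t)"
proof -
  have add: "c (s + t) = c s \<otimes>\<^bsub>Mp1R\<^esub> c t" for s t
    using assms by (simp add: one_param_subgroup_def)
  then show m: "mp_mat (c (s + t)) = mp_mat (c s) ** mp_mat (c t)" for s t
    by (simp add: mp_mult_eq mp_mat_mult)
  interpret group Mp1R by (rule group_Mp1R)
  have "c 0 \<otimes>\<^bsub>Mp1R\<^esub> c 0 = c 0" using add[of 0 0] by simp
  then show "c 0 = \<one>\<^bsub>Mp1R\<^esub>" using r_cancel_one[of "c 0" "c 0"] by (simp add: Mp1R_def)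
  have "((\<lambda>h. mp_mat (c t) ** mp_mat (c h)) has_vector_derivative mp_mat (c t) ** X) (at 0)"
    using assms unfolding one_param_subgroup_def
    by (intro matmul.has_vector_derivative[OF has_vector_derivative_const, simplified]) simp
  then have *: "((\<lambda>h. mp_mat (c (t + h))) has_vector_derivative mp_mat (c t) ** X) (at 0)"
    by (simp add: m)
  have "((\<lambda>u. u - t) has_real_derivative 1) (at t)" by (auto intro!: derivative_eq_intros)
  from vector_diff_chain_at[OF this[unfolded has_real_derivative_iff_has_vector_derivative], of "\<lambda>h. mp_mat (c (t + h))" "mp_mat (c t) ** X"]
  show "((\<lambda>t. mp_mat (c t)) has_vector_derivative mp_mat (c t) ** X) (at t)"
    using * by (simp add: o_def)
qed

lemma one_param_root_continuous:
  "one_param_subgroup X c \<Longrightarrow> continuous_on UNIV (\<lambda>t. mp_root (c t) \<i>)"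
  unfolding one_param_subgroup_def using continuous_on_snd by fastforce

text \<open>
  For the matrices this is uniqueness for the linear equation \<open>M' = M X\<close>: the product of one
  solution with the inverse of the other has derivative zero. The roots at \<open>\<i>\<close> are then continuous
  square roots of the same function that agree at \<open>0\<close>.
\<close>

lemma one_param_unique:
  assumes c: "one_param_subgroup X c" and d: "one_param_subgroup X d"
  shows "c = d"
proof
  let ?M = "\<lambda>t. mp_mat (c t)" and ?N = "\<lambda>t. mp_mat (d t)"
  have one: "?M 0 = mat 1" "?N 0 = mat 1"
    using one_param_mat(2)[OF c] one_param_mat(2)[OF d] by (simp_all add: mp_mat_one)
  have N: "?N (s + t) = ?N s ** ?N t" for s t by (rule one_param_mat(1)[OF d])
  have comm: "?N s ** X = X ** ?N s" for s
  proof -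
    have "((\<lambda>h. ?N h ** ?N s) has_vector_derivative X ** ?N s) (at 0)"
      using d unfolding one_param_subgroup_def
      by (intro matmul.has_vector_derivative[OF _ has_vector_derivative_const, simplified]) simp
    moreover have "((\<lambda>h. ?N s ** ?N h) has_vector_derivative ?N s ** X) (at 0)"
      using d unfolding one_param_subgroup_def
      by (intro matmul.has_vector_derivative[OF has_vector_derivative_const, simplified]) simp
    moreover have "?N h ** ?N s = ?N s ** ?N h" for h
      using N[of h s] N[of s h] by (simp add: add.commute)
    ultimately show ?thesis by (simp add: vector_derivative_unique_at)
  qed
  have neg: "((\<lambda>t. ?N (- t)) has_vector_derivative - (?N (- t) ** X)) (at t)" for t
  proof -
    have "((\<lambda>u. - u) has_vector_derivative (- 1 :: real)) (at t)" by (auto intro!: derivative_eq_intros)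
    from vector_diff_chain_at[OF this one_param_mat(3)[OF d]]
    show ?thesis by (simp add: o_def)
  qed
  have "((\<lambda>t. ?M t ** ?N (- t)) has_vector_derivative 0) (at t)" for t
  proof -
    have "((\<lambda>t. ?M t ** ?N (- t)) has_vector_derivative
        ?M t ** (- (?N (- t) ** X)) + (?M t ** X) ** ?N (- t)) (at t)"
      by (rule matmul.has_vector_derivative[OF one_param_mat(3)[OF c] neg])
    moreover have "?M t ** (- (?N (- t) ** X)) + (?M t ** X) ** ?N (- t) = 0"
      by (simp add: matmul.minus_right comm matrix_mul_assoc)
    ultimately show ?thesis by simp
  qed
  then have inv: "?M t ** ?N (- t) = mat 1" for t
    using has_derivative_zero_unique[of UNIV "\<lambda>t. ?M t ** ?N (- t)" 0 t] one
    by (simp add: has_vector_derivative_def)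
  have mat: "?M t = ?N t" for t
  proof -
    have "?N (- t) ** ?N t = mat 1" using N[of "- t" t] one by simp
    then have "?M t = ?M t ** (?N (- t) ** ?N t)" by simp
    then show ?thesis using inv[of t] by (simp add: matrix_mul_assoc)
  qed
  fix t
  have "mp_root (c t) \<i> = mp_root (d t) \<i>"
  proof (rule continuous_roots_agree[of UNIV "\<lambda>t. mp_root (c t) \<i>" "\<lambda>t. mp_root (d t) \<i>" 0 t])
    show "mp_root (c 0) \<i> = mp_root (d 0) \<i>"
      using one_param_mat(2)[OF c] one_param_mat(2)[OF d] by simp
  qed (auto simp: one_param_root_continuous[OF c] one_param_root_continuous[OF d]
      mp_root_sq i_uhp mat mp_root_nz)
  then show "c t = d t" using mat by (intro mp1_eqI_mat)
qed

text \<open>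
  If \<open>X\<close> is traceless, then \<open>X\<^sup>2 = q\<close> with \<open>q = - det X\<close>, so \<open>exp (t X) = C t + S t X\<close>, where \<open>C\<close> and \<open>S\<close>
  are the power series \<open>\<Sum> q\<^sup>n t\<^sup>2\<^sup>n / (2 n)!\<close> and \<open>\<Sum> q\<^sup>n t\<^sup>2\<^sup>n\<^sup>+\<^sup>1 / (2 n + 1)!\<close>. According to the sign of
  \<open>q\<close> these are hyperbolic, linear or trigonometric functions.
\<close>

lemma exponential_coefficients:
  fixes q :: real
  obtains C S :: "real \<Rightarrow> real"
    where "C 0 = 1" "S 0 = 0"
      "\<And>t. (C has_real_derivative q * S t) (at t)" "\<And>t. (S has_real_derivative C t) (at t)"
      "\<And>s t. C (s + t) = C s * C t + q * S s * S t" "\<And>s t. S (s + t) = S s * C t + C s * S t"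
      "\<And>t. (C t)\<^sup>2 - q * (S t)\<^sup>2 = 1"
proof -
  consider "q = 0" | r where "r > 0" "q = r\<^sup>2" | r where "r > 0" "q = - (r\<^sup>2)"
    by (metis linorder_less_linear minus_minus neg_0_less_iff_less real_sqrt_gt_0_iff real_sqrt_pow2 less_imp_le)
  then show thesis
  proof cases
    case 1
    show thesis
      by (rule that[of "\<lambda>_. 1" "\<lambda>t. t"]) (auto simp: 1 intro!: derivative_eq_intros)
  next
    case (2 r)
    show thesis
      by (rule that[of "\<lambda>t. cosh (r * t)" "\<lambda>t. sinh (r * t) / r"])
         (use 2 in \<open>auto intro!: derivative_eq_intros simp: power2_eq_square cosh_add sinh_add
           field_simps cosh_square_eq[unfolded power2_eq_square]\<close>)
  next
    case (3 r)
    show thesis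
      by (rule that[of "\<lambda>t. cos (r * t)" "\<lambda>t. sin (r * t) / r"])
         (use 3 in \<open>auto intro!: derivative_eq_intros simp: power2_eq_square cos_add sin_add field_simps\<close>)
  qed
qed

text \<open>
  The curve \<open>exp (t X)\<close> is lifted through the double cover by choosing a continuous square root of
  \<open>c \<i> + d\<close> along it. That the lift is a homomorphism holds up to sign at each point, hence everywhere
  by continuity.
\<close>

lemma one_param_exists:
  assumes "trace X = 0"
  obtains c where "one_param_subgroup X c"
proof -
  obtain C S :: "real \<Rightarrow> real" where CS: "C 0 = 1" "S 0 = 0"
      "\<And>t. (C has_real_derivative - det X * S t) (at t)" "\<And>t. (S has_real_derivative C t) (at t)"
      "\<And>s t. C (s + t) = C s * C t + - det X * S s * S t" "\<And>s t. S (s + t) = S s * C t + C s * S t"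
      "\<And>t. (C t)\<^sup>2 - - det X * (S t)\<^sup>2 = 1"
    using exponential_coefficients[of "- det X"] by metis
  define E where "E t = C t *\<^sub>R mat 1 + S t *\<^sub>R X" for t
  have X: "X$2$2 = - X$1$1" using assms by (simp add: trace_def sum_2)
  have E_nth: "E t$1$1 = C t + S t * X$1$1" "E t$1$2 = S t * X$1$2"
    "E t$2$1 = S t * X$2$1" "E t$2$2 = C t - S t * X$1$1" for t
    by (simp_all add: E_def mat_def X)
  have E_add: "E (s + t) = E s ** E t" for s t
    by (simp add: mat_eq_iff mat_mult_2 E_nth CS det_2 X algebra_simps)
  have E_det: "det (E t) = 1" for t
    using CS(7)[of t] by (simp add: det_2 E_nth X power2_eq_square algebra_simps)
  have E_deriv: "(E has_vector_derivative X) (at 0)"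
  proof -
    have "(E has_vector_derivative (- det X * S 0) *\<^sub>R mat 1 + C 0 *\<^sub>R X) (at 0)"
      unfolding E_def using CS(3,4)[of 0]
      by (auto intro!: derivative_eq_intros simp: has_real_derivative_iff_has_vector_derivative)
    then show ?thesis by (simp add: CS)
  qed
  have contE: "continuous_on UNIV E"
    unfolding E_def using CS(3,4) by (intro continuous_intros) (auto simp: continuous_on_eq_continuous_at intro: DERIV_isCont)
  have cont_aut: "continuous_on UNIV (\<lambda>t. aut_factor (E t) \<i>)"
    unfolding aut_factor_def using contE by (intro continuous_intros)
  obtain w0 where w0: "continuous_on UNIV w0" "\<And>t. aut_factor (E t) \<i> = (w0 t)\<^sup>2"
  proof (rule continuous_sqrt_on_contractible[OF cont_aut contractible_UNIV])
    show "aut_factor (E t) \<i> \<noteq> 0" for t by (rule aut_factor_nz[OF E_det i_uhp])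
  qed auto
  have w00: "(w0 0)\<^sup>2 = 1" using w0(2)[of 0] by (simp add: aut_factor_def E_nth CS)
  \<comment> \<open>The factor \<open>w0 0 = \<plusminus>1\<close> normalises the root to \<open>1\<close> at the identity.\<close>
  define w where "w t = w0 0 * w0 t" for t
  have w: "continuous_on UNIV w" "\<And>t. (w t)\<^sup>2 = aut_factor (E t) \<i>" "w 0 = 1"
    using w0 w00 unfolding w_def by (auto intro!: continuous_intros simp: power_mult_distrib power2_eq_square)
  have "\<exists>x. mp_mat x = E t \<and> mp_root x \<i> = w t" for t
    using mp1_exists[OF E_det w(2)] by metis
  then obtain c where c: "\<And>t. mp_mat (c t) = E t" "\<And>t. mp_root (c t) \<i> = w t" by metis
  have "one_param_subgroup X c"
    unfolding one_param_subgroup_def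
  proof (intro conjI allI)
    show "continuous_on UNIV (\<lambda>t. (mp_mat (c t), mp_root (c t) \<i>))"
      using contE w by (auto simp: c intro!: continuous_intros)
    show "((\<lambda>t. mp_mat (c t)) has_vector_derivative X) (at 0)" using E_deriv by (simp add: c)
    fix s t
    have act: "continuous_on UNIV (\<lambda>t. mp_act (c t) \<i>)"
      unfolding mp_act_def mat_act_eq c using aut_factor_nz[OF E_det i_uhp]
      by (intro continuous_intros contE cont_aut) auto
    have "w (s + t) = mp_root (c s) (mp_act (c t) \<i>) * w t"
    proof (rule continuous_roots_agree[of UNIV "\<lambda>t. w (s + t)" "\<lambda>t. mp_root (c s) (mp_act (c t) \<i>) * w t" 0 t])
      show "continuous_on UNIV (\<lambda>t. w (s + t))"
        by (rule continuous_on_compose2[OF w(1)]) (auto intro!: continuous_intros)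
      show "continuous_on UNIV (\<lambda>t. mp_root (c s) (mp_act (c t) \<i>) * w t)"
        by (intro continuous_intros w(1) continuous_on_compose2[OF holomorphic_on_imp_continuous_on[OF mp_root_holo] act])
           (auto intro: mp_act_uhp i_uhp)
      show "(w (s + x))\<^sup>2 = (mp_root (c s) (mp_act (c x) \<i>) * w x)\<^sup>2" for x
        using aut_factor_mult[OF E_det i_uhp, of "E s" x] mp_root_sq[OF mp_act_uhp[OF i_uhp], of "c s" "c x"]
        by (simp add: power_mult_distrib w(2) c E_add mp_act_def)
      show "mp_root (c s) (mp_act (c x) \<i>) * w x \<noteq> 0" for x
        using mp_root_nz[OF mp_act_uhp[OF i_uhp]] mp_root_nz[OF i_uhp, of "c x"] c by auto
      have "mp_act (c 0) \<i> = \<i>" by (simp add: mp_act_def mat_act_eq aut_factor_def c E_nth CS)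
      then show "w (s + 0) = mp_root (c s) (mp_act (c 0) \<i>) * w 0" using w c by simp
    qed auto
    then show "c (s + t) = c s \<otimes>\<^bsub>Mp1R\<^esub> c t"
      by (intro mp1_eqI_mat) (simp_all add: mp_mult_eq mp_mat_mult mp_root_mult i_uhp c E_add)
  qed
  then show thesis by (rule that)
qed

text \<open>
  The exponential only sees a one-parameter subgroup at time \<open>1\<close>; rescaling the velocity recovers it
  at every time.
\<close>

lemma mp_exp_scale:
  assumes "one_param_subgroup X c"
  shows "mp_exp (t *\<^sub>R X) = c t"
proof -
  have "one_param_subgroup (t *\<^sub>R X) (\<lambda>u. c (t * u))"
    unfolding one_param_subgroup_def
  proof (intro conjI allI)
    show "c (t * (u + v)) = c (t * u) \<otimes>\<^bsub>Mp1R\<^esub> c (t * v)" for u v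
      using assms by (simp add: one_param_subgroup_def distrib_left)
    have "continuous_on UNIV (\<lambda>t. (mp_mat (c t), mp_root (c t) \<i>))"
      using assms by (simp add: one_param_subgroup_def)
    from continuous_on_compose2[OF this, of UNIV "\<lambda>u. t * u"]
    show "continuous_on UNIV (\<lambda>u. (mp_mat (c (t * u)), mp_root (c (t * u)) \<i>))"
      by (auto intro!: continuous_intros)
    have "((\<lambda>u. t * u) has_vector_derivative t) (at 0)"
      by (auto intro!: derivative_eq_intros)
    from vector_diff_chain_at[OF this, of "\<lambda>t. mp_mat (c t)" X]
    show "((\<lambda>u. mp_mat (c (t * u))) has_vector_derivative t *\<^sub>R X) (at 0)"
      using assms by (simp add: one_param_subgroup_def o_def)
  qed
  then have "(THE c. one_param_subgroup (t *\<^sub>R X) c) = (\<lambda>u. c (t * u))"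
    by (intro the_equality one_param_unique)
  then show ?thesis by (simp add: mp_exp_def)
qed

section \<open>Lifting functions to the metaplectic group\<close>

text \<open>
  Near \<open>a\<close> the quotient \<open>w t / w a\<close> has positive real part, so there \<open>w\<close> is \<open>w a\<close> times the principal
  root of \<open>\<alpha> t / (w a)\<^sup>2\<close>, which is differentiable.
\<close>

lemma has_vector_derivative_root:
  fixes w \<alpha> :: "real \<Rightarrow> complex"
  assumes w: "continuous_on UNIV w" "\<And>t. (w t)\<^sup>2 = \<alpha> t" "w a \<noteq> 0"
    and \<alpha>: "(\<alpha> has_vector_derivative \<alpha>') (at a)"
  shows "(w has_vector_derivative \<alpha>' / (2 * w a)) (at a)"
proof -
  let ?U = "{t. Re (w t / w a) > 0}"
  have "continuous_on UNIV (\<lambda>t. Re (w t / w a))"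
    using w by (intro continuous_intros) auto
  then have U: "open ?U" "a \<in> ?U"
    using w(3) open_Collect_less[OF continuous_on_const[of UNIV 0]] by auto
  have csqrt: "(csqrt has_field_derivative 1 / (2 * csqrt 1)) (at (\<alpha> a / (w a)\<^sup>2))"
  proof -
    have "\<alpha> a / (w a)\<^sup>2 = 1" using w(2)[of a, symmetric] w(3) by simp
    then show ?thesis using has_field_derivative_csqrt[of 1] by (simp add: inverse_eq_divide)
  qed
  have "((\<lambda>t. w a * csqrt (\<alpha> t / (w a)\<^sup>2)) has_vector_derivative w a * ((\<alpha>' / (w a)\<^sup>2) * (1 / (2 * csqrt 1)))) (at a)"
  proof (rule has_vector_derivative_mult_right)
    have "((\<lambda>t. \<alpha> t / (w a)\<^sup>2) has_vector_derivative \<alpha>' / (w a)\<^sup>2) (at a)"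
      using \<alpha> by (rule has_vector_derivative_divide)
    from field_vector_diff_chain_at[OF this csqrt]
    show "((\<lambda>t. csqrt (\<alpha> t / (w a)\<^sup>2)) has_vector_derivative (\<alpha>' / (w a)\<^sup>2) * (1 / (2 * csqrt 1))) (at a)"
      by (simp add: o_def)
  qed
  then have "(w has_vector_derivative w a * ((\<alpha>' / (w a)\<^sup>2) * (1 / (2 * csqrt 1)))) (at a)"
  proof (rule has_vector_derivative_transform_within_open[OF _ U])
    fix t assume "t \<in> ?U"
    then have "csqrt ((w t / w a)\<^sup>2) = w t / w a" by (intro csqrt_square) auto
    then show "w a * csqrt (\<alpha> t / (w a)\<^sup>2) = w t"
      using w(2)[of t, symmetric] w(3) by (simp add: power_divide)
  qed
  then show ?thesis using w(3) by (simp add: power2_eq_square mult.commute)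
qed

text \<open>
  The two coordinates of \<open>mp1_eqI_point\<close> along the curve \<open>x exp (t X)\<close>. At \<open>t = 0\<close> the point \<open>exp (t X) \<i>\<close>
  has velocity \<open>X$1$2 + X$2$1 + 2 X$1$1 \<i>\<close>, and the Moebius transformation of \<open>x\<close> has derivative
  \<open>\<omega>\<^sup>-\<^sup>4\<close> at \<open>\<i>\<close>, where \<open>\<omega>\<close> is the root of \<open>x\<close> there.
\<close>

lemma group_point_derivative:
  fixes x :: mp1
  assumes c: "one_param_subgroup X c" and X: "trace X = 0"
  defines "A \<equiv> mp_mat x"
  shows "((\<lambda>t. mp_act (x \<otimes>\<^bsub>Mp1R\<^esub> c t) \<i>) has_vector_derivative
      (of_real (X$1$2 + X$2$1) + 2 * of_real (X$1$1) * \<i>) / (mp_root x \<i>)^4) (at 0)" (is ?act)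
    and "((\<lambda>t. mp_root (x \<otimes>\<^bsub>Mp1R\<^esub> c t) \<i>) has_vector_derivative
      (of_real (X$1$1) * (of_real (A$2$1) * \<i> - of_real (A$2$2)) + of_real (A$2$2 * X$2$1) * \<i>
        + of_real (A$2$1 * X$1$2)) / (2 * mp_root x \<i>)) (at 0)" (is ?root)
proof -
  have X22: "X$2$2 = - X$1$1" using X by (simp add: trace_def sum_2)
  let ?E = "\<lambda>t. A ** mp_mat (c t)"
  have c0: "mp_mat (c 0) = mat 1" "mp_act (c 0) \<i> = \<i>"
    by (simp_all add: one_param_mat(2)[OF c] mp_mat_one mp_act_def mat_act_one)
  have d: "((\<lambda>t. mp_mat (c t)) has_vector_derivative X) (at 0)"
    using c by (simp add: one_param_subgroup_def)
  have nth: "((\<lambda>t. complex_of_real (mp_mat (c t) $ i $ j)) has_vector_derivative of_real (X $ i $ j)) (at 0)" for i j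
    using bounded_linear.has_vector_derivative[OF
      bounded_linear_compose[OF bounded_linear_of_real bounded_linear_compose[OF bounded_linear_vec_nth bounded_linear_vec_nth]] d] .
  have E: "((\<lambda>t. complex_of_real (?E t $ i $ j)) has_vector_derivative of_real ((A ** X) $ i $ j)) (at 0)" for i j
    unfolding mat_mult_2 of_real_add of_real_mult
    by (intro has_vector_derivative_add has_vector_derivative_mult_right nth)
  let ?\<alpha> = "\<lambda>t. aut_factor (?E t) \<i>"
  have \<alpha>: "(?\<alpha> has_vector_derivative of_real ((A**X)$2$1) * \<i> + of_real ((A**X)$2$2)) (at 0)"
    unfolding aut_factor_def by (intro has_vector_derivative_add has_vector_derivative_mult_left E)
  have det: "det (?E t) = 1" for t by (simp add: det_mul mp_mat_det A_def)
  have nz: "?\<alpha> t \<noteq> 0" for t by (rule aut_factor_nz[OF det i_uhp])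
  have a0: "?\<alpha> 0 = (mp_root x \<i>)\<^sup>2" by (simp add: c0 mp_root_sq i_uhp A_def)
  have a0': "?\<alpha> 0 = of_real (A$2$1) * \<i> + of_real (A$2$2)" by (simp add: aut_factor_def c0)
  show ?root
  proof -
    have act: "continuous_on UNIV (\<lambda>t. mp_act (c t) \<i>)"
    proof -
      have "continuous_on UNIV (\<lambda>t. mp_mat (c t))"
        using one_param_mat(3)[OF c] has_vector_derivative_continuous
        by (simp add: continuous_on_eq_continuous_at) blast
      then show ?thesis
        unfolding mp_act_def mat_act_eq using aut_factor_nz[OF mp_mat_det i_uhp]
        by (intro continuous_intros) (auto simp: aut_factor_def intro!: continuous_intros)
    qed
    let ?w = "\<lambda>t. mp_root (x \<otimes>\<^bsub>Mp1R\<^esub> c t) \<i>"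
    have "continuous_on UNIV ?w"
      by (simp add: mp_mult_eq mp_root_mult i_uhp)
         (intro continuous_intros one_param_root_continuous[OF c]
           continuous_on_compose2[OF holomorphic_on_imp_continuous_on[OF mp_root_holo] act],
          auto intro: mp_act_uhp i_uhp)
    moreover have "(?w t)\<^sup>2 = ?\<alpha> t" for t
      using mp_root_sq[OF i_uhp, of "x \<otimes>\<^bsub>Mp1R\<^esub> c t"] by (simp add: mp_mult_eq mp_mat_mult A_def)
    moreover have w0: "?w 0 = mp_root x \<i>"
      using one_param_mat(2)[OF c] i_uhp c0 by (simp add: mp_mult_eq mp_root_mult mp_root_one)
    ultimately have "(?w has_vector_derivative (of_real ((A**X)$2$1) * \<i> + of_real ((A**X)$2$2)) / (2 * ?w 0)) (at 0)"
      using mp_root_nz[OF i_uhp, of x] by (intro has_vector_derivative_root[OF _ _ _ \<alpha>]) auto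
    then show ?thesis
      unfolding w0 by (rule has_vector_derivative_eq_rhs) (simp add: mat_mult_2 X22 algebra_simps)
  qed
  show ?act
  proof -
    let ?N = "\<lambda>t. of_real (?E t$1$1) * \<i> + complex_of_real (?E t$1$2)"
    have N: "(?N has_vector_derivative of_real ((A**X)$1$1) * \<i> + of_real ((A**X)$1$2)) (at 0)"
      by (intro has_vector_derivative_add has_vector_derivative_mult_left E)
    have inv: "(inverse has_field_derivative - (inverse (?\<alpha> 0) * 1 * inverse (?\<alpha> 0))) (at (?\<alpha> 0))"
      using nz[of 0] by (intro DERIV_inverse' DERIV_ident) auto
    have "((\<lambda>t. ?N t * inverse (?\<alpha> t)) has_vector_derivative
        ?N 0 * ((of_real ((A**X)$2$1) * \<i> + of_real ((A**X)$2$2)) * - (inverse (?\<alpha> 0) * 1 * inverse (?\<alpha> 0)))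
        + (of_real ((A**X)$1$1) * \<i> + of_real ((A**X)$1$2)) * inverse (?\<alpha> 0)) (at 0)"
      using field_vector_diff_chain_at[OF \<alpha> inv] by (intro has_vector_derivative_mult N) (simp add: o_def)
    moreover have "(\<lambda>t. mp_act (x \<otimes>\<^bsub>Mp1R\<^esub> c t) \<i>) = (\<lambda>t. ?N t * inverse (?\<alpha> t))"
      by (simp add: fun_eq_iff mp_mult_eq mp_act_def mp_mat_mult mat_act_eq A_def divide_inverse)
    moreover have "?N 0 * ((of_real ((A**X)$2$1) * \<i> + of_real ((A**X)$2$2)) * - (inverse (?\<alpha> 0) * 1 * inverse (?\<alpha> 0)))
        + (of_real ((A**X)$1$1) * \<i> + of_real ((A**X)$1$2)) * inverse (?\<alpha> 0)
      = (of_real (X$1$2 + X$2$1) + 2 * of_real (X$1$1) * \<i>) / (?\<alpha> 0)\<^sup>2" (is "?L = ?R")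
    proof -
      have det: "of_real (A$1$1) * of_real (A$2$2) = 1 + of_real (A$1$2) * complex_of_real (A$2$1)"
      proof -
        have "A$1$1 * A$2$2 = 1 + A$1$2 * A$2$1"
          using mp_mat_det[of x] unfolding A_def det_2 by linarith
        from arg_cong[OF this, of complex_of_real] show ?thesis by simp
      qed
      have quotient: "(n * (a' * - (inverse a * 1 * inverse a)) + n' * inverse a) * a\<^sup>2 = n' * a - n * a'"
        if "a \<noteq> 0" for n n' a a' :: complex
        using that by (simp add: field_simps power2_eq_square)
      have "?L * (?\<alpha> 0)\<^sup>2 = (of_real ((A**X)$1$1) * \<i> + of_real ((A**X)$1$2)) * ?\<alpha> 0
          - ?N 0 * (of_real ((A**X)$2$1) * \<i> + of_real ((A**X)$2$2))"
        by (rule quotient[OF nz])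
      also have "\<dots> = (of_real (A$1$1) * of_real (A$2$2) - of_real (A$1$2) * complex_of_real (A$2$1))
          * (of_real (X$1$2 + X$2$1) + 2 * of_real (X$1$1) * \<i>)"
        unfolding a0' by (simp add: c0 mat_mult_2 X22 algebra_simps)
      also have "\<dots> = of_real (X$1$2 + X$2$1) + 2 * of_real (X$1$1) * \<i>" by (simp add: det)
      finally show ?thesis using nz[of 0] by (simp add: eq_divide_eq)
    qed
    ultimately show ?thesis by (simp add: a0 flip: power_mult)
  qed
qed

text \<open>
  The coefficients of a traceless matrix in the basis \<open>H\<close>, \<open>X\<^sub>+\<close>, \<open>X\<^sub>-\<close>.
\<close>

definition coord_H :: "complex^2^2 \<Rightarrow> complex" where
  "coord_H Z = (Z$2$1 - Z$1$2) / (2 * \<i>)"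

definition coord_plus :: "complex^2^2 \<Rightarrow> complex" where
  "coord_plus Z = Z$1$1 + (Z$1$2 + Z$2$1) / (2 * \<i>)"

definition coord_minus :: "complex^2^2 \<Rightarrow> complex" where
  "coord_minus Z = Z$1$1 - (Z$1$2 + Z$2$1) / (2 * \<i>)"

lemma trace_Re_Im:
  assumes "Z \<in> sl2C"
  shows "trace (\<chi> i j. Re (Z$i$j)) = 0" "trace (\<chi> i j. Im (Z$i$j)) = 0"
  using assms by (simp_all add: sl2C_def trace_def sum_2 complex_eq_iff)

context complex_normed begin

text \<open>
  For functions of any weight and with values in any of the spaces considered, the passage from
  \<open>f\<close> to the function on the group that generates \<^const>\<open>varpi\<close>.
\<close>

definition lift :: "(complex \<Rightarrow> 'v) \<Rightarrow> real \<Rightarrow> mp1 \<Rightarrow> 'v" where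
  "lift h j x = s (mp_root x \<i> powi \<lfloor>- 2 * j\<rfloor>) (h (mp_act x \<i>))"

lemma lift_K:
  assumes "\<kappa> \<in> mp_K"
  shows "lift h j (x \<otimes>\<^bsub>Mp1R\<^esub> \<kappa>) = s (mp_root \<kappa> \<i> powi \<lfloor>- 2 * j\<rfloor>) (lift h j x)"
  by (simp add: lift_def mp_mult_eq mp_root_mult mp_act_mult i_uhp mp_act_K[OF assms]
      power_int_mult_distrib mult.commute)

lemma lift_iwasawa:
  assumes "a > 0" "- 2 * j = of_int n"
  shows "lift h j (iwasawa b a \<theta>) =
    s (of_real (a powr j) * exp (\<i> * of_real j * of_real \<theta>)) (h (Complex b (a\<^sup>2)))"
proof -
  have "complex_of_real (a powr (- 1/2)) powi n = of_real (a powr j)"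
  proof -
    have "(a powr (- 1/2)) powi n = a powr (- 1/2 * of_int n)"
      using assms(1) by (simp add: powr_real_of_int'[symmetric] powr_powr)
    also have "- 1/2 * of_int n = j" using assms(2) by simp
    finally show ?thesis by (metis of_real_power_int)
  qed
  moreover have "exp (- \<i> * complex_of_real \<theta> / 2) powi n = exp (\<i> * of_real j * of_real \<theta>)"
  proof -
    have "complex_of_int n = - 2 * of_real j"
      using arg_cong[OF assms(2), of complex_of_real] by simp
    then show ?thesis by (simp add: exp_power_int mult_ac)
  qed
  ultimately show ?thesis
    using assms by (simp add: lift_def mp_act_iwasawa mp_root_iwasawa power_int_mult_distrib)
qed

lemma mp_smooth_lift:
  assumes h: "smooth_on h uhp" and j: "- 2 * j = of_int n"
  shows "mp_smooth (lift h j)"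
proof -
  let ?S = "UNIV \<times> {0::real<..} \<times> (UNIV :: real set) :: (real \<times> real \<times> real) set"
  have S: "open ?S" by (intro open_Times) auto
  have pr: "smooth_on (\<lambda>p. fst (snd p)) ?S" "smooth_on (\<lambda>p. snd (snd p)) ?S" "smooth_on fst ?S"
    by (intro smooth_on_bounded_linear S bounded_linear_fst bounded_linear_compose[OF bounded_linear_fst]
      bounded_linear_compose[OF bounded_linear_snd] bounded_linear_snd)+
  have powr: "smooth_on (\<lambda>p. fst (snd p) powr r) ?S" for r
    by (rule smooth_on_compose[OF S open_greaterThan _ smooth_on_powr pr(1)]) auto
  have of_real: "smooth_on (\<lambda>p. complex_of_real (f p)) ?S" if "smooth_on f ?S" for f
    by (rule smooth_on_compose[OF S open_UNIV subset_UNIV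
        smooth_on_bounded_linear[OF bounded_linear_of_real open_UNIV] that])
  have mult: "smooth_on (\<lambda>p. f p * g p) ?S" if "smooth_on f ?S" "smooth_on g ?S" for f g :: "_ \<Rightarrow> complex"
    by (rule smooth_on_bilinear[OF bounded_bilinear_mult S that])
  have exp: "smooth_on (\<lambda>p. exp (f p)) ?S" if "smooth_on f ?S" for f :: "_ \<Rightarrow> complex"
    by (rule smooth_on_compose[OF S open_UNIV subset_UNIV smooth_on_exp that])
  have point: "smooth_on (\<lambda>p. of_real (fst p) + \<i> * of_real (fst (snd p) powr 2)) ?S"
    by (intro smooth_on_add S of_real pr mult smooth_on_const powr)
  have "smooth_on (\<lambda>p. s (of_real (fst (snd p) powr j) * exp (\<i> * of_real j * of_real (snd (snd p))))
      (h (of_real (fst p) + \<i> * of_real (fst (snd p) powr 2)))) ?S"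
    by (intro smooth_on_bilinear[OF bounded_bilinear_axioms S] mult of_real powr exp smooth_on_const pr
        smooth_on_compose[OF S open_uhp _ h point]) (auto simp: uhp_def)
  then show ?thesis
    unfolding mp_smooth_def
    by (rule smooth_on_cong[OF S, THEN iffD1, rotated])
       (auto simp: lift_iwasawa[OF _ j] Complex_eq)
qed

text \<open>
  The real derivative splits into a complex linear and an antilinear part. This is what allows
  formulas for real directions to be extended complex linearly.
\<close>

lemma D_wirtinger:
  assumes h: "smooth_on h uhp" and t: "\<tau> \<in> uhp"
  shows "D h \<tau> w = s w (wirtinger h \<tau>) + s (cnj w) (wirtinger_bar h \<tau>)"
proof -
  have lin: "linear (D h \<tau>)"
    using smooth_on_has_derivative[OF h t] has_derivative_bounded_linear bounded_linear.linear by blast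
  have "D h \<tau> w = D h \<tau> (Re w *\<^sub>R 1 + Im w *\<^sub>R \<i>)"
    by (rule arg_cong[of _ _ "D h \<tau>"]) (simp add: complex_eq_iff)
  also have "\<dots> = s (of_real (Re w)) (D h \<tau> 1) + s (of_real (Im w)) (D h \<tau> \<i>)"
    by (simp only: linear_add[OF lin] linear_scale[OF lin] scale_of_real)
  also have "\<dots> = s (w/2 + cnj w/2) (D h \<tau> 1) + s (- (w * \<i>/2) + cnj w * \<i>/2) (D h \<tau> \<i>)"
  proof -
    have "complex_of_real (Re w) = w/2 + cnj w/2" "complex_of_real (Im w) = - (w * \<i>/2) + cnj w * \<i>/2"
      by (simp_all add: complex_eq_iff)
    then show ?thesis by (simp only:)
  qed
  also have "\<dots> = s w (wirtinger h \<tau>) + s (cnj w) (wirtinger_bar h \<tau>)"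
    unfolding wirtinger_def wirtinger_bar_def scale_left_distrib
    by (simp add: scale_right_distrib scale_right_diff_distrib)
  finally show ?thesis .
qed

text \<open>
  The product rule applied to the two curves in \<open>group_point_derivative\<close>. Wirtinger derivatives
  turn the coefficients into linear functions of the entries of \<open>X\<close>.
\<close>

lemma lift_has_vector_derivative:
  fixes x :: mp1
  assumes h: "smooth_on h uhp" and j: "- 2 * j = of_int n" and X: "trace X = 0"
  defines "A \<equiv> mp_mat x" and "\<omega> \<equiv> mp_root x \<i>" and "\<tau> \<equiv> mp_act x \<i>"
  shows "((\<lambda>t. lift h j (x \<otimes>\<^bsub>Mp1R\<^esub> mp_exp (t *\<^sub>R X))) has_vector_derivative
    s (\<omega> powi n * ((of_real (X$1$2 + X$2$1) + 2 * of_real (X$1$1) * \<i>) / \<omega>^4)) (wirtinger h \<tau>) +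
    s (\<omega> powi n * ((of_real (X$1$2 + X$2$1) - 2 * of_real (X$1$1) * \<i>) / (cnj \<omega>)^4)) (wirtinger_bar h \<tau>) +
    s (\<omega> powi n * (- of_real j * (of_real (X$1$1) * (of_real (A$2$1) * \<i> - of_real (A$2$2))
        + of_real (A$2$2 * X$2$1) * \<i> + of_real (A$2$1 * X$1$2)) / \<omega>\<^sup>2)) (h \<tau>)) (at 0)"
proof -
  obtain c where c: "one_param_subgroup X c" using one_param_exists[OF X] by blast
  let ?w = "\<lambda>t. mp_root (x \<otimes>\<^bsub>Mp1R\<^esub> c t) \<i>" and ?p = "\<lambda>t. mp_act (x \<otimes>\<^bsub>Mp1R\<^esub> c t) \<i>"
  let ?u = "(of_real (X$1$2 + X$2$1) + 2 * of_real (X$1$1) * \<i>) / \<omega>^4"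
  let ?\<beta> = "of_real (X$1$1) * (of_real (A$2$1) * \<i> - of_real (A$2$2)) + of_real (A$2$2 * X$2$1) * \<i>
        + of_real (A$2$1 * X$1$2)"
  interpret G: group Mp1R by (rule group_Mp1R)
  have x0: "x \<otimes>\<^bsub>Mp1R\<^esub> c 0 = x"
    using one_param_mat(2)[OF c] G.r_one[of x] by (simp add: Mp1R_def)
  have \<omega>: "\<omega> \<noteq> 0" using mp_root_nz[OF i_uhp] by (simp add: \<omega>_def)
  have \<tau>: "\<tau> \<in> uhp" unfolding \<tau>_def by (rule mp_act_uhp[OF i_uhp])
  have p: "(?p has_vector_derivative ?u) (at 0)"
    using group_point_derivative(1)[OF c X, of x] by (simp add: \<omega>_def)
  have w: "(?w has_vector_derivative ?\<beta> / (2 * \<omega>)) (at 0)"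
    using group_point_derivative(2)[OF c X, of x] by (simp add: \<omega>_def A_def)
  have "((\<lambda>z. z powi n) has_field_derivative of_int n * ?w 0 powi (n - 1) * 1) (at (?w 0))"
    by (rule DERIV_power_int[OF DERIV_ident]) (use \<omega> in \<open>simp add: x0 \<omega>_def\<close>)
  from field_vector_diff_chain_at[OF w this]
  have wn: "((\<lambda>t. ?w t powi n) has_vector_derivative ?\<beta> / (2 * \<omega>) * (of_int n * \<omega> powi (n - 1))) (at 0)"
    by (simp add: o_def x0 \<omega>_def)
  have hp: "((\<lambda>t. h (?p t)) has_vector_derivative D h \<tau> ?u) (at 0)"
  proof -
    have "(h has_derivative D h \<tau>) (at (?p 0))"
      using smooth_on_has_derivative[OF h \<tau>] by (simp add: x0 \<tau>_def)
    from has_derivative_compose[OF p[unfolded has_vector_derivative_def] this]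
    have "((\<lambda>t. h (?p t)) has_derivative (\<lambda>t. D h \<tau> (t *\<^sub>R ?u))) (at 0)" .
    moreover have "linear (D h \<tau>)"
      using smooth_on_has_derivative[OF h \<tau>] has_derivative_bounded_linear bounded_linear.linear by blast
    ultimately show ?thesis by (simp add: has_vector_derivative_def linear_scale)
  qed
  have "((\<lambda>t. s (?w t powi n) (h (?p t))) has_vector_derivative
      s (?w 0 powi n) (D h \<tau> ?u) + s (?\<beta> / (2 * \<omega>) * (of_int n * \<omega> powi (n - 1))) (h (?p 0))) (at 0)"
    by (rule has_vector_derivative[OF wn hp])
  moreover have "lift h j (x \<otimes>\<^bsub>Mp1R\<^esub> mp_exp (t *\<^sub>R X)) = s (?w t powi n) (h (?p t))" for t
    unfolding lift_def mp_exp_scale[OF c] j floor_of_int ..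
  moreover have "s (?w 0 powi n) (D h \<tau> ?u) = s (\<omega> powi n * ?u) (wirtinger h \<tau>)
      + s (\<omega> powi n * ((of_real (X$1$2 + X$2$1) - 2 * of_real (X$1$1) * \<i>) / (cnj \<omega>)^4)) (wirtinger_bar h \<tau>)"
  proof -
    have "cnj ?u = (of_real (X$1$2 + X$2$1) - 2 * of_real (X$1$1) * \<i>) / (cnj \<omega>)^4" by simp
    then show ?thesis
      unfolding D_wirtinger[OF h \<tau>] x0 \<omega>_def[symmetric] scale_right_distrib scale_scale by (simp only:)
  qed
  moreover have "s (?\<beta> / (2 * \<omega>) * (of_int n * \<omega> powi (n - 1))) (h (?p 0)) =
      s (\<omega> powi n * (- of_real j * ?\<beta> / \<omega>\<^sup>2)) (h \<tau>)"
  proof -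
    have "complex_of_int n = - 2 * of_real j"
      using arg_cong[OF j, of complex_of_real] by simp
    then have "b / (2 * \<omega>) * (of_int n * \<omega> powi (n - 1)) = \<omega> powi n * (- of_real j * b / \<omega>\<^sup>2)" for b
      using \<omega> by (simp add: power_int_diff field_simps power2_eq_square)
    then show ?thesis by (simp only: x0 \<tau>_def)
  qed
  ultimately show ?thesis by simp
qed

text \<open>
  The coefficients in \<open>lift_has_vector_derivative\<close> extend complex linearly from real to complex
  matrices. Expressed through the coordinates of \<open>Z\<close>, the term with \<open>\<partial>h\<close> only involves \<open>X\<^sub>+\<close>, the term
  with the antilinear derivative only \<open>X\<^sub>-\<close>, and the term with \<open>h\<close> splits into the eigenvalue of \<open>H\<close>
  and the part \<open>j / Im \<tau>\<close> of the raising operator.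
\<close>

lemma lie_act_lift:
  assumes h: "smooth_on h uhp" and j: "- 2 * j = of_int n" and Z: "Z \<in> sl2C"
  shows "lie_act s Z (lift h j) x = s (coord_H Z * of_real j) (lift h j x)
    + s (coord_plus Z) (lift (raise j h) (j + 2) x) + s (coord_minus Z) (lift (lower h) (j - 2) x)"
proof -
  define A \<omega> \<tau> where "A = mp_mat x" and "\<omega> = mp_root x \<i>" and "\<tau> = mp_act x \<i>"
  note lift = lift_has_vector_derivative[OF h j, of _ x, folded A_def \<omega>_def \<tau>_def]
  let ?a = "complex_of_real (A$2$1)" and ?d = "complex_of_real (A$2$2)"
  let ?p = "\<lambda>x y z. \<omega> powi n * ((y + z + 2 * x * \<i>) / \<omega>^4)"
    and ?q = "\<lambda>x y z. \<omega> powi n * ((y + z - 2 * x * \<i>) / (cnj \<omega>)^4)"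
    and ?r = "\<lambda>x y z. \<omega> powi n * (- of_real j * (x * (?a * \<i> - ?d) + ?d * z * \<i> + ?a * y) / \<omega>\<^sup>2)"
  have \<omega>: "\<omega> \<noteq> 0" using mp_root_nz[OF i_uhp] by (simp add: \<omega>_def)
  have \<omega>2: "\<omega>\<^sup>2 = ?a * \<i> + ?d" unfolding \<omega>_def A_def by (simp add: mp_root_sq[OF i_uhp] aut_factor_def)
  have "(cnj \<omega>)\<^sup>2 = cnj (\<omega>\<^sup>2)" by simp
  also have "\<dots> = ?d - ?a * \<i>" unfolding \<omega>2 by simp
  finally have c\<omega>2: "(cnj \<omega>)\<^sup>2 = ?d - ?a * \<i>" .
  have v: "complex_of_real (Im \<tau>) = 1 / (\<omega>\<^sup>2 * (cnj \<omega>)\<^sup>2)"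
  proof -
    have "complex_of_real (cmod \<omega> ^ 4) = (\<omega> * cnj \<omega>)\<^sup>2"
      unfolding complex_norm_square[symmetric] by (simp flip: power_mult)
    then show ?thesis by (simp add: \<tau>_def \<omega>_def Im_mp_act power_mult_distrib)
  qed
  have deriv: "lie_deriv X (lift h j) x = s (?p (of_real (X$1$1)) (of_real (X$1$2)) (of_real (X$2$1))) (wirtinger h \<tau>)
      + s (?q (of_real (X$1$1)) (of_real (X$1$2)) (of_real (X$2$1))) (wirtinger_bar h \<tau>)
      + s (?r (of_real (X$1$1)) (of_real (X$1$2)) (of_real (X$2$1))) (h \<tau>)" if "trace X = 0" for X
    unfolding lie_deriv_def using vector_derivative_at[OF lift[OF that]] by simp
  let ?x = "Z$1$1" and ?y = "Z$1$2" and ?z = "Z$2$1"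
  have lin: "?p x y z = ?p (of_real (Re x)) (of_real (Re y)) (of_real (Re z))
        + \<i> * ?p (of_real (Im x)) (of_real (Im y)) (of_real (Im z))"
    "?q x y z = ?q (of_real (Re x)) (of_real (Re y)) (of_real (Re z))
        + \<i> * ?q (of_real (Im x)) (of_real (Im y)) (of_real (Im z))"
    "?r x y z = ?r (of_real (Re x)) (of_real (Re y)) (of_real (Re z))
        + \<i> * ?r (of_real (Im x)) (of_real (Im y)) (of_real (Im z))" for x y z
    by (subst (1 2 3) complex_eq[of x], subst (1 2 3) complex_eq[of y], subst (1 2 3) complex_eq[of z],
        simp add: add_divide_distrib diff_divide_distrib algebra_simps; fail)+
  have "lie_act s Z (lift h j) x = s (?p ?x ?y ?z) (wirtinger h \<tau>) + s (?q ?x ?y ?z) (wirtinger_bar h \<tau>)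
      + s (?r ?x ?y ?z) (h \<tau>)"
    unfolding lie_act_def deriv[OF trace_Re_Im(1)[OF Z]] deriv[OF trace_Re_Im(2)[OF Z]]
      lin[where x = ?x and y = ?y and z = ?z] scale_left_distrib
    by (simp only: vec_lambda_beta scale_right_distrib scale_scale) (simp only: ac_simps)
  also have "?p ?x ?y ?z = coord_plus Z * \<omega> powi (n - 4) * (2 * \<i>)"
    using \<omega> by (simp add: coord_plus_def power_int_diff field_simps)
  also have "?q ?x ?y ?z = coord_minus Z * \<omega> powi (n + 4) * (- 2 * \<i> * of_real ((Im \<tau>)\<^sup>2))"
  proof -
    have "complex_of_real ((Im \<tau>)\<^sup>2) = 1 / (\<omega>^4 * (cnj \<omega>)^4)"
      unfolding of_real_power v by (simp add: power_divide power_mult_distrib flip: power_mult)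
    then show ?thesis
      using \<omega> by (simp only:) (simp add: coord_minus_def power_int_add field_simps)
  qed
  also have "?r ?x ?y ?z = coord_H Z * of_real j * \<omega> powi n + coord_plus Z * \<omega> powi (n - 4) * of_real (j / Im \<tau>)"
  proof -
    have "of_real (j / Im \<tau>) = of_real j * \<omega>\<^sup>2 * (cnj \<omega>)\<^sup>2"
      by (simp add: v)
    moreover have "\<omega> powi (n - 4) * \<omega>\<^sup>2 = \<omega> powi n / \<omega>\<^sup>2"
      using \<omega> by (simp add: power_int_diff field_simps)
    ultimately have "coord_H Z * of_real j * \<omega> powi n + coord_plus Z * \<omega> powi (n - 4) * of_real (j / Im \<tau>)
      = \<omega> powi n * of_real j * (coord_H Z * \<omega>\<^sup>2 + coord_plus Z * (cnj \<omega>)\<^sup>2) / \<omega>\<^sup>2"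
      using \<omega> by (simp add: field_simps)
    moreover have "coord_H Z * \<omega>\<^sup>2 + coord_plus Z * (cnj \<omega>)\<^sup>2 = - (?x * (?a * \<i> - ?d) + ?d * ?z * \<i> + ?a * ?y)"
      unfolding \<omega>2 c\<omega>2 coord_H_def coord_plus_def by (simp add: field_simps)
    ultimately show ?thesis
      by (simp only: times_divide_eq_right mult_minus_left mult_minus_right mult.assoc)
  qed
  also have "s (coord_plus Z * \<omega> powi (n - 4) * (2 * \<i>)) (wirtinger h \<tau>)
      + s (coord_minus Z * \<omega> powi (n + 4) * (- 2 * \<i> * of_real ((Im \<tau>)\<^sup>2))) (wirtinger_bar h \<tau>)
      + s (coord_H Z * of_real j * \<omega> powi n + coord_plus Z * \<omega> powi (n - 4) * of_real (j / Im \<tau>)) (h \<tau>)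
    = s (coord_H Z * of_real j) (s (\<omega> powi n) (h \<tau>))
      + s (coord_plus Z) (s (\<omega> powi (n - 4)) (raise j h \<tau>))
      + s (coord_minus Z) (s (\<omega> powi (n + 4)) (lower h \<tau>))"
    unfolding raise_def lower_def scale_left_distrib scale_right_distrib scale_scale
    by (simp only: ac_simps)
  finally show ?thesis
  proof -
    have "- 2 * (j + 2) = of_int (n - 4)" "- 2 * (j - 2) = of_int (n + 4)" using j by simp_all
    then have "\<lfloor>- 2 * j\<rfloor> = n" "\<lfloor>- 2 * (j + 2)\<rfloor> = n - 4" "\<lfloor>- 2 * (j - 2)\<rfloor> = n + 4"
      using j by (simp_all only: floor_of_int)
    then show "lie_act s Z (lift h j) x = s (coord_H Z * of_real j) (s (\<omega> powi n) (h \<tau>))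
        + s (coord_plus Z) (s (\<omega> powi (n - 4)) (raise j h \<tau>))
        + s (coord_minus Z) (s (\<omega> powi (n + 4)) (lower h \<tau>)) \<Longrightarrow> ?thesis"
      by (simp only: lift_def \<omega>_def \<tau>_def)
  qed
qed

end

section \<open>K-types and linearity of the Lie algebra action\<close>

lemma sum_fun_apply: "(\<Sum>i\<in>A. f i) x = (\<Sum>i\<in>A. f i x)"
  by (induction A rule: infinite_finite_induct) auto

context complex_normed begin

lemma fscale_apply: "gk_scale (smooth_module s) c F g = s c (F g)"
  by (simp add: smooth_module_def)

sublocale funs: vector_space "gk_scale (smooth_module s) :: complex \<Rightarrow> (mp1 \<Rightarrow> 'v) \<Rightarrow> mp1 \<Rightarrow> 'v"
  by unfold_locales (simp_all add: fun_eq_iff fscale_apply scale_right_distrib scale_left_distrib)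

definition K_type :: "int \<Rightarrow> (mp1 \<Rightarrow> 'v) \<Rightarrow> bool" where
  "K_type N F \<longleftrightarrow> (\<forall>\<kappa>\<in>mp_K. \<forall>x. F (x \<otimes>\<^bsub>Mp1R\<^esub> \<kappa>) = s (mp_root \<kappa> \<i> powi N) (F x))"

text \<open>
  The root of \<open>k(\<theta>)\<close> at \<open>\<i>\<close> is \<open>exp (- \<i> \<theta> / 2)\<close>.
\<close>

lemma K_character_separates:
  assumes "N \<noteq> N'"
  obtains \<kappa> where "\<kappa> \<in> mp_K" "mp_root \<kappa> \<i> powi N \<noteq> mp_root \<kappa> \<i> powi N'"
proof -
  \<comment> \<open>The two characters then differ by the factor \<open>exp (- \<i> \<pi>) = - 1\<close>.\<close>
  define \<theta> where "\<theta> = 2 * pi / of_int (N - N')"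
  let ?z = "mp_root (mp_k \<theta>) \<i>"
  have "of_int (N - N') * (- \<i> * complex_of_real \<theta> / 2) = - (\<i> * of_real pi)"
    using assms by (simp add: \<theta>_def field_simps)
  then have "?z powi (N - N') = exp (- (\<i> * of_real pi))"
    unfolding mp_root_k exp_power_int by (simp only:)
  then have "?z powi (N - N') = - 1" by (simp add: exp_minus)
  then have "?z powi N \<noteq> ?z powi N'"
    using mp_root_nz[OF i_uhp] by (auto simp: power_int_diff)
  then show thesis by (rule that[OF mp_k_in_K])
qed

text \<open>
  Right translation by an element \<open>\<kappa>\<close> of \<open>K\<close>, minus the character of one member \<open>e p\<close>, removes \<open>e p\<close>
  from a linear relation and multiplies the other coefficients by differences of characters. A
  suitable \<open>\<kappa>\<close> makes any given difference nonzero, so the shorter relation forces the coefficients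
  to vanish.
\<close>

lemma K_types_independent:
  assumes "finite F" "inj_on N F" "\<And>m. m \<in> F \<Longrightarrow> K_type (N m) (e m)" "\<And>m. m \<in> F \<Longrightarrow> e m \<noteq> 0"
    "(\<Sum>m\<in>F. gk_scale (smooth_module s) (c m) (e m)) = 0" "m \<in> F"
  shows "c m = 0"
  using assms
proof (induction F arbitrary: c m)
  case empty
  then show ?case by simp
next
  case (insert p F)
  have rel: "(\<Sum>m\<in>F. s (c m) (e m x)) + s (c p) (e p x) = 0" for x
    using fun_cong[OF insert.prems(4), of x] insert.hyps by (simp add: fscale_apply sum_fun_apply add.commute)
  have c0: "c m = 0" if m: "m \<in> F" for m
  proof -
    have "N m \<noteq> N p" using insert.prems(1) insert.hyps m by (auto simp: inj_on_def)
    then obtain \<kappa> where \<kappa>: "\<kappa> \<in> mp_K" "mp_root \<kappa> \<i> powi N m \<noteq> mp_root \<kappa> \<i> powi N p"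
      by (rule K_character_separates)
    let ?\<chi> = "\<lambda>m. mp_root \<kappa> \<i> powi N m"
    have "(\<Sum>m\<in>F. gk_scale (smooth_module s) (c m * (?\<chi> m - ?\<chi> p)) (e m)) = 0"
    proof
      fix x
      have "(\<Sum>m\<in>F. s (c m * ?\<chi> m) (e m x)) + s (c p * ?\<chi> p) (e p x) = 0"
      proof -
        have ex: "e i (x \<otimes>\<^bsub>Mp1R\<^esub> \<kappa>) = s (?\<chi> i) (e i x)" if "i \<in> insert p F" for i
          using insert.prems(2)[OF that] \<kappa>(1) by (simp only: K_type_def)
        have "(\<Sum>m\<in>F. s (c m) (e m (x \<otimes>\<^bsub>Mp1R\<^esub> \<kappa>))) = (\<Sum>m\<in>F. s (c m * ?\<chi> m) (e m x))"
          by (intro sum.cong) (simp_all add: ex)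
        then show ?thesis using rel[of "x \<otimes>\<^bsub>Mp1R\<^esub> \<kappa>"] ex[of p] by simp
      qed
      moreover have "(\<Sum>m\<in>F. s (c m * ?\<chi> p) (e m x)) + s (c p * ?\<chi> p) (e p x) = 0"
        using arg_cong[OF rel[of x], of "s (?\<chi> p)"]
        by (simp add: scale_right_distrib scale_sum_right mult.commute)
      ultimately have "(\<Sum>m\<in>F. s (c m * ?\<chi> m) (e m x)) - (\<Sum>m\<in>F. s (c m * ?\<chi> p) (e m x)) = 0"
        by (simp only: eq_neg_iff_add_eq_0[symmetric] diff_self)
      then show "(\<Sum>m\<in>F. gk_scale (smooth_module s) (c m * (?\<chi> m - ?\<chi> p)) (e m)) x = 0 x"
        by (simp add: fscale_apply sum_fun_apply right_diff_distrib scale_left_diff_distrib sum_subtractf)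
    qed
    from insert.IH[OF _ _ _ this m] insert.prems have "c m * (?\<chi> m - ?\<chi> p) = 0"
      by (auto simp: inj_on_def)
    then show ?thesis using \<kappa>(2) by simp
  qed
  have "s (c p) (e p x) = 0" for x using rel[of x] c0 by simp
  moreover obtain x where "e p x \<noteq> 0" using insert.prems(3)[of p] by (auto simp: fun_eq_iff)
  ultimately have "c p = 0" by (metis scale_eq_0_iff)
  then show ?case using c0 insert.prems(5) by auto
qed

lemma K_types_independent_family:
  assumes N: "inj_on N S" and e: "\<And>m. m \<in> S \<Longrightarrow> K_type (N m) (e m)" "\<And>m. m \<in> S \<Longrightarrow> e m \<noteq> 0"
  shows "inj_on e S" "funs.independent (e ` S)"
proof -
  note indep = K_types_independent[OF _ inj_on_subset[OF N], of _ e]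
  show inj: "inj_on e S"
  proof (rule inj_onI, rule ccontr)
    fix m m' assume m: "m \<in> S" "m' \<in> S" "e m = e m'" "m \<noteq> m'"
    have "(\<Sum>i\<in>{m, m'}. gk_scale (smooth_module s) (if i = m then 1 else - 1) (e i)) = 0"
      using m by simp
    from indep[OF _ _ _ _ this, of m] m e show False by auto
  qed
  show "funs.independent (e ` S)"
    unfolding funs.dependent_explicit
  proof clarify
    fix T u v
    assume T: "finite T" "T \<subseteq> e ` S" "v \<in> T" "(\<Sum>v\<in>T. gk_scale (smooth_module s) (u v) v) = 0" "u v \<noteq> 0"
    define F where "F = {m \<in> S. e m \<in> T}"
    have TF: "T = e ` F" "F \<subseteq> S" using T(2) by (auto simp: F_def)
    have injF: "inj_on e F" using inj TF by (blast intro: inj_on_subset)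
    have "finite F" using T(1) TF injF finite_imageD by blast
    moreover have "(\<Sum>m\<in>F. gk_scale (smooth_module s) (u (e m)) (e m)) = 0"
      using T(4) unfolding TF(1) by (simp add: sum.reindex[OF injF])
    moreover obtain m where "m \<in> F" "v = e m" using T(3) TF by auto
    ultimately have "u (e m) = 0"
      using indep[of F "\<lambda>m. u (e m)" m] TF e by blast
    then show False using T(5) \<open>v = e m\<close> by simp
  qed
qed

lemma span_family:
  assumes "x \<in> funs.span (e ` S)"
  obtains F c where "finite F" "F \<subseteq> S" "x = (\<Sum>m\<in>F. gk_scale (smooth_module s) (c m) (e m))"
proof -
  have "\<exists>F c. finite F \<and> F \<subseteq> S \<and> x = (\<Sum>m\<in>F. gk_scale (smooth_module s) (c m) (e m))"
    using assms
  proof (induction rule: funs.span_induct_alt)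
    case base
    show ?case by (intro exI[of _ "{}"]) simp
  next
    case (step a v y)
    then obtain m F c where m: "m \<in> S" "v = e m" and F: "finite F" "F \<subseteq> S"
      "y = (\<Sum>m\<in>F. gk_scale (smooth_module s) (c m) (e m))" by auto
    let ?c = "\<lambda>i. (if i = m then a else 0) + (if i \<in> F then c i else 0)"
    have "(\<Sum>i\<in>insert m F. gk_scale (smooth_module s) (?c i) (e i))
        = (\<Sum>i\<in>insert m F. gk_scale (smooth_module s) (if i = m then a else 0) (e i))
          + (\<Sum>i\<in>insert m F. gk_scale (smooth_module s) (if i \<in> F then c i else 0) (e i))"
      by (simp add: funs.scale_left_distrib sum.distrib)
    also have "(\<Sum>i\<in>insert m F. gk_scale (smooth_module s) (if i = m then a else 0) (e i))
        = gk_scale (smooth_module s) a (e m)"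
      using F(1) by (subst sum.mono_neutral_right[of _ "{m}"]) auto
    also have "(\<Sum>i\<in>insert m F. gk_scale (smooth_module s) (if i \<in> F then c i else 0) (e i)) = y"
      unfolding F(3) using F(1) by (intro sum.mono_neutral_cong_right) auto
    finally show ?case using m F by (intro exI[of _ "insert m F"] exI[of _ ?c]) simp
  qed
  then show thesis using that by blast
qed

text \<open>
  The Lie derivative is defined by the total function \<^const>\<open>vector_derivative\<close>, which is additive only
  where derivatives exist.
\<close>

definition lie_differentiable :: "(mp1 \<Rightarrow> 'v) \<Rightarrow> bool" where
  "lie_differentiable F \<longleftrightarrow> (\<forall>X g. trace X = 0 \<longrightarrow>
     ((\<lambda>t. F (g \<otimes>\<^bsub>Mp1R\<^esub> mp_exp (t *\<^sub>R X))) has_vector_derivative lie_deriv X F g) (at 0))"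

lemma lie_deriv_add:
  assumes "lie_differentiable F" "lie_differentiable G" "trace X = 0"
  shows "((\<lambda>t. (F + G) (g \<otimes>\<^bsub>Mp1R\<^esub> mp_exp (t *\<^sub>R X))) has_vector_derivative lie_deriv X F g + lie_deriv X G g) (at 0)"
    "lie_deriv X (F + G) g = lie_deriv X F g + lie_deriv X G g"
proof -
  show *: "((\<lambda>t. (F + G) (g \<otimes>\<^bsub>Mp1R\<^esub> mp_exp (t *\<^sub>R X))) has_vector_derivative lie_deriv X F g + lie_deriv X G g) (at 0)"
    using assms unfolding lie_differentiable_def plus_fun_apply by (intro has_vector_derivative_add) auto
  then show "lie_deriv X (F + G) g = lie_deriv X F g + lie_deriv X G g"
    unfolding lie_deriv_def by (rule vector_derivative_at)
qed

lemma lie_deriv_scale: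
  assumes "lie_differentiable F" "trace X = 0"
  shows "((\<lambda>t. gk_scale (smooth_module s) c F (g \<otimes>\<^bsub>Mp1R\<^esub> mp_exp (t *\<^sub>R X))) has_vector_derivative s c (lie_deriv X F g)) (at 0)"
    "lie_deriv X (gk_scale (smooth_module s) c F) g = s c (lie_deriv X F g)"
proof -
  show *: "((\<lambda>t. gk_scale (smooth_module s) c F (g \<otimes>\<^bsub>Mp1R\<^esub> mp_exp (t *\<^sub>R X))) has_vector_derivative s c (lie_deriv X F g)) (at 0)"
    using assms unfolding lie_differentiable_def fscale_apply
    by (intro bounded_linear.has_vector_derivative[OF bounded_linear_right]) auto
  then show "lie_deriv X (gk_scale (smooth_module s) c F) g = s c (lie_deriv X F g)"
    unfolding lie_deriv_def by (rule vector_derivative_at)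
qed

lemma lie_differentiable_add: "lie_differentiable F \<Longrightarrow> lie_differentiable G \<Longrightarrow> lie_differentiable (F + G)"
  using lie_deriv_add unfolding lie_differentiable_def[of "F + G"] by metis

lemma lie_differentiable_scale: "lie_differentiable F \<Longrightarrow> lie_differentiable (gk_scale (smooth_module s) c F)"
  using lie_deriv_scale unfolding lie_differentiable_def[of "gk_scale (smooth_module s) c F"] by metis

lemma lie_act_zero: "lie_act s Z 0 = 0"
  by (simp add: fun_eq_iff lie_act_def lie_deriv_def)

lemma lie_differentiable_zero: "lie_differentiable 0"
  by (simp add: lie_differentiable_def lie_deriv_def)

lemma lie_act_add:
  "lie_differentiable F \<Longrightarrow> lie_differentiable G \<Longrightarrow> Z \<in> sl2C \<Longrightarrow> lie_act s Z (F + G) = lie_act s Z F + lie_act s Z G"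
  by (simp add: fun_eq_iff lie_act_def lie_deriv_add(2) trace_Re_Im scale_right_distrib)

lemma lie_act_scale:
  "lie_differentiable F \<Longrightarrow> Z \<in> sl2C \<Longrightarrow>
    lie_act s Z (gk_scale (smooth_module s) c F) = gk_scale (smooth_module s) c (lie_act s Z F)"
  by (simp add: fun_eq_iff lie_act_def lie_deriv_scale(2) trace_Re_Im scale_right_distrib fscale_apply mult.commute)

lemma mp_smooth_subspace: "funs.subspace {F. mp_smooth F}"
proof -
  let ?S = "UNIV \<times> {0::real<..} \<times> (UNIV :: real set) :: (real \<times> real \<times> real) set"
  have S: "open ?S" by (intro open_Times) auto
  have eq: "mp_smooth F \<longleftrightarrow> smooth_on (\<lambda>p. F (iwasawa (fst p) (fst (snd p)) (snd (snd p)))) ?S"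
    for F :: "mp1 \<Rightarrow> 'v" by (simp add: mp_smooth_def split_beta')
  show ?thesis
    unfolding funs.subspace_def eq mem_Collect_eq
    by (auto simp: fscale_apply intro!: smooth_on_const smooth_on_add[OF S]
        smooth_on_bilinear[OF bounded_bilinear_axioms S])
qed

end

section \<open>Ladders and the modules they span\<close>

text \<open>
  The structure constants of a ladder whose rung \<open>m\<close> has weight \<open>k + 2 m\<close>: \<open>X\<^sub>+ e\<^sub>m = up k m e\<^sub>m\<^sub>+\<^sub>1\<close> and
  \<open>X\<^sub>- e\<^sub>m = down k m e\<^sub>m\<^sub>-\<^sub>1\<close>. For \<open>m \<ge> 0\<close> and for \<open>m < 0\<close> the constants are those of \<open>X\<^sub>\<plusminus>\<close> on the functions
  \<open>\<phi>\<^sub>k\<^sub>+\<^sub>2\<^sub>m\<close> in the principal series with parameters \<open>k - 1\<close> and \<open>1 - k\<close>. The one exception is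
  \<open>down k 0 = 1\<close> in place of \<open>0\<close>. It joins the two halves, whereas \<open>up k (- 1) = 0\<close>, so that the
  lower half spans a submodule.
\<close>

definition up :: "real \<Rightarrow> int \<Rightarrow> real" where
  "up k m = (if m \<ge> 0 then k + of_int m else of_int m + 1)"

definition down :: "real \<Rightarrow> int \<Rightarrow> real" where
  "down k m = (if m \<ge> 1 then - of_int m else if m = 0 then 1 else 1 - k - of_int m)"

context complex_normed begin

text \<open>
  Only the rungs with index in \<open>S\<close> are constrained, but the equations at the boundary of \<open>S\<close> mention
  the neighbours outside. Smoothness and differentiability are included so that the rungs span a
  submodule on which the action is linear.
\<close>

definition ladder :: "real \<Rightarrow> int set \<Rightarrow> (int \<Rightarrow> mp1 \<Rightarrow> 'v) \<Rightarrow> bool" where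
  "ladder k S e \<longleftrightarrow> (\<forall>m\<in>S. mp_smooth (e m) \<and> lie_differentiable (e m) \<and>
     K_type (\<lfloor>- 2 * k\<rfloor> - 4 * m) (e m) \<and>
     (\<forall>Z\<in>sl2C. lie_act s Z (e m) =
        gk_scale (smooth_module s) (coord_H Z * of_real (k + 2 * of_int m)) (e m)
        + gk_scale (smooth_module s) (coord_plus Z * of_real (up k m)) (e (m + 1))
        + gk_scale (smooth_module s) (coord_minus Z * of_real (down k m)) (e (m - 1))))"

lemma ladder_independent:
  assumes "ladder k S e" "\<And>m. m \<in> S \<Longrightarrow> e m \<noteq> 0"
  shows "inj_on e S" "funs.independent (e ` S)"
  using K_types_independent_family[of "\<lambda>m. \<lfloor>- 2 * k\<rfloor> - 4 * m" S e] assms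
  by (auto simp: ladder_def inj_on_def)

end

text \<open>
  The elements \<open>X\<^sub>+\<close> and, below, \<open>X\<^sub>-\<close> of the basis.
\<close>

definition sl2_plus :: "complex^2^2" where
  "sl2_plus = vector [vector [1/2, \<i>/2], vector [\<i>/2, - 1/2]]"

definition sl2_minus :: "complex^2^2" where
  "sl2_minus = vector [vector [1/2, - \<i>/2], vector [- \<i>/2, - 1/2]]"

lemma coord_sl2_plus: "sl2_plus \<in> sl2C" "coord_H sl2_plus = 0" "coord_plus sl2_plus = 1" "coord_minus sl2_plus = 0"
  by (simp_all add: sl2_plus_def sl2C_def trace_def sum_2 coord_H_def coord_plus_def coord_minus_def)

lemma coord_sl2_minus: "sl2_minus \<in> sl2C" "coord_H sl2_minus = 0" "coord_plus sl2_minus = 0" "coord_minus sl2_minus = 1"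
  by (simp_all add: sl2_minus_def sl2C_def trace_def sum_2 coord_H_def coord_plus_def coord_minus_def)

context complex_normed begin

lemma ladder_raise_lower:
  assumes "ladder k S e" "m \<in> S"
  shows "lie_act s sl2_plus (e m) = gk_scale (smooth_module s) (of_real (up k m)) (e (m + 1))"
    and "lie_act s sl2_minus (e m) = gk_scale (smooth_module s) (of_real (down k m)) (e (m - 1))"
  using assms by (simp_all add: ladder_def coord_sl2_plus coord_sl2_minus)

lemma ladder_submodule:
  assumes e: "ladder k UNIV e"
  shows "gk_submodule (funs.span (range e)) (smooth_module s)"
  unfolding gk_submodule_def
proof (intro conjI ballI)
  let ?W = "funs.span (range e)"
  have base: "e m \<in> ?W" for m by (intro funs.span_base) simp
  show "?W \<subseteq> gk_space (smooth_module s)"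
  proof -
    have "?W \<subseteq> {F. mp_smooth F}"
      using e by (intro funs.span_minimal mp_smooth_subspace) (auto simp: ladder_def)
    then show ?thesis by (simp add: smooth_module_def)
  qed
  show "funs.subspace ?W" by simp
  show "gk_lie (smooth_module s) Z x \<in> ?W" if Z: "Z \<in> sl2C" and x: "x \<in> ?W" for Z x
  proof -
    have "lie_differentiable x \<and> lie_act s Z x \<in> ?W"
      using x
    proof (induction rule: funs.span_induct_alt)
      case base
      show ?case using lie_differentiable_zero lie_act_zero[of Z] funs.span_zero[of "range e"]
        by (simp add: zero_fun_def)
    next
      case (step c v y)
      then obtain m where m: "v = e m" by auto
      have v: "lie_differentiable v" "lie_act s Z v \<in> ?W"
        using e Z by (auto simp: ladder_def m intro!: funs.span_add funs.span_scale base)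
      have y: "lie_differentiable y" "lie_act s Z y \<in> ?W" using step.IH by auto
      show ?case
        unfolding lie_act_add[OF lie_differentiable_scale[OF v(1)] y(1) Z] lie_act_scale[OF v(1) Z]
        by (intro conjI lie_differentiable_add lie_differentiable_scale funs.span_add funs.span_scale v y)
    qed
    then show ?thesis by (simp add: smooth_module_def)
  qed
  show "gk_K (smooth_module s) \<kappa> x \<in> ?W" if \<kappa>: "\<kappa> \<in> mp_K" and x: "x \<in> ?W" for \<kappa> x
  proof -
    have "(\<lambda>g. x (g \<otimes>\<^bsub>Mp1R\<^esub> \<kappa>)) \<in> ?W"
      using x
    proof (induction rule: funs.span_induct_alt)
      case base
      show ?case using funs.span_zero by (simp add: zero_fun_def)
    next
      case (step c v y)
      then obtain m where m: "v = e m" by auto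
      have "K_type (\<lfloor>- 2 * k\<rfloor> - 4 * m) (e m)" using e by (simp add: ladder_def)
      then have "(\<lambda>g. (gk_scale (smooth_module s) c v + y) (g \<otimes>\<^bsub>Mp1R\<^esub> \<kappa>)) =
          gk_scale (smooth_module s) (c * (mp_root \<kappa> \<i> powi (\<lfloor>- 2 * k\<rfloor> - 4 * m))) (e m) + (\<lambda>g. y (g \<otimes>\<^bsub>Mp1R\<^esub> \<kappa>))"
        using \<kappa> by (simp add: fun_eq_iff fscale_apply m K_type_def)
      then show ?case using step by (simp only:) (intro funs.span_add funs.span_scale base)
    qed
    then show ?thesis by (simp add: smooth_module_def)
  qed
qed

text \<open>
  From \<open>e 0\<close> every rung is reached by raising and lowering, because the constants that are met on the
  way do not vanish.
\<close>

lemma ladder_generated: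
  assumes e: "ladder k UNIV e" and nz: "\<And>m. m \<ge> 0 \<Longrightarrow> up k m \<noteq> 0" "\<And>m. m \<le> 0 \<Longrightarrow> down k m \<noteq> 0"
  shows "gk_generated (smooth_module s) {e 0} = (smooth_module s)\<lparr>gk_space := funs.span (range e)\<rparr>"
proof -
  have "e m \<in> W" if W: "gk_submodule W (smooth_module s)" "e 0 \<in> W" for W m
  proof -
    have sub: "funs.subspace W" and lie: "\<And>Z x. Z \<in> sl2C \<Longrightarrow> x \<in> W \<Longrightarrow> lie_act s Z x \<in> W"
      using W by (auto simp: gk_submodule_def smooth_module_def)
    have unscale: "x \<in> W" if "gk_scale (smooth_module s) c x \<in> W" "c \<noteq> 0" for c x
      using funs.subspace_scale[OF sub that(1), of "inverse c"] that(2) by simp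
    show ?thesis
    proof (induction m rule: int_induct[of _ 0])
      case base show ?case by (rule W(2))
    next
      case (step1 i)
      have "gk_scale (smooth_module s) (of_real (up k i)) (e (i + 1)) \<in> W"
        using lie[OF coord_sl2_plus(1) step1(2)] ladder_raise_lower(1)[OF e] by simp
      then show ?case by (rule unscale) (use nz step1 in simp)
    next
      case (step2 i)
      have "gk_scale (smooth_module s) (of_real (down k i)) (e (i - 1)) \<in> W"
        using lie[OF coord_sl2_minus(1) step2(2)] ladder_raise_lower(2)[OF e] by simp
      then show ?case by (rule unscale) (use nz step2 in simp)
    qed
  qed
  then have "funs.span (range e) \<subseteq> W" if "gk_submodule W (smooth_module s)" "e 0 \<in> W" for W
    using that by (intro funs.span_minimal) (auto simp: gk_submodule_def smooth_module_def)
  then have "\<Inter>{W. gk_submodule W (smooth_module s) \<and> {e 0} \<subseteq> W} = funs.span (range e)"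
    using ladder_submodule[OF e] funs.span_base[of "e 0" "range e"] by (intro equalityI) auto
  then show ?thesis by (simp add: gk_generated_def)
qed

end

locale complex_normed_pair = V: complex_normed s + W: complex_normed s'
  for s :: "complex \<Rightarrow> 'v::euclidean_space \<Rightarrow> 'v" and s' :: "complex \<Rightarrow> 'w::euclidean_space \<Rightarrow> 'w"
begin

sublocale funs2: vector_space_pair
  "gk_scale (smooth_module s) :: complex \<Rightarrow> (mp1 \<Rightarrow> 'v) \<Rightarrow> mp1 \<Rightarrow> 'v"
  "gk_scale (smooth_module s') :: complex \<Rightarrow> (mp1 \<Rightarrow> 'w) \<Rightarrow> mp1 \<Rightarrow> 'w"
  by unfold_locales

text \<open>
  The target \<open>d\<close> may have vanishing rungs, so this covers inclusions, projections and isomorphisms.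
  The conditions at the boundary of \<open>S\<close> say that the equations for \<open>d\<close>, like those for \<open>e\<close>, do not
  leave \<open>S\<close>.
\<close>

lemma ladder_hom:
  assumes e: "V.ladder k S e" and d: "W.ladder k S d"
    and nz: "\<And>m. m \<in> S \<Longrightarrow> e m \<noteq> 0" and zero: "\<And>m. m \<notin> S \<Longrightarrow> e m = 0"
    and up: "\<And>m. m \<in> S \<Longrightarrow> m + 1 \<notin> S \<Longrightarrow> up k m = 0 \<or> d (m + 1) = 0"
    and down: "\<And>m. m \<in> S \<Longrightarrow> m - 1 \<notin> S \<Longrightarrow> down k m = 0 \<or> d (m - 1) = 0"
  obtains T where "Vector_Spaces.linear (gk_scale (smooth_module s)) (gk_scale (smooth_module s')) T"
    "\<And>m. m \<in> S \<Longrightarrow> T (e m) = d m"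
    "\<And>U. W.funs.span (d ` S) \<subseteq> U \<Longrightarrow>
      gk_hom ((smooth_module s)\<lparr>gk_space := V.funs.span (e ` S)\<rparr>) ((smooth_module s')\<lparr>gk_space := U\<rparr>) T"
proof -
  have inj: "inj_on e S" and ind: "V.funs.independent (e ` S)"
    using V.ladder_independent[OF e] nz by blast+
  obtain T where lin: "Vector_Spaces.linear (gk_scale (smooth_module s)) (gk_scale (smooth_module s')) T"
    and T: "\<forall>v\<in>e ` S. T v = d (the_inv_into S e v)"
    using funs2.linear_independent_extend[OF ind, of "\<lambda>v. d (the_inv_into S e v)"] by blast
  interpret T: Vector_Spaces.linear "gk_scale (smooth_module s)" "gk_scale (smooth_module s')" T by (rule lin)
  have Te: "T (e m) = d m" if "m \<in> S" for m
    using T that the_inv_into_f_f[OF inj that] by simp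
  have up': "gk_scale (smooth_module s') (c * of_real (up k m)) (T (e (m + 1)))
      = gk_scale (smooth_module s') (c * of_real (up k m)) (d (m + 1))" if "m \<in> S" for m c
    using up[OF that] zero[of "m + 1"] Te[of "m + 1"] by (cases "m + 1 \<in> S") (auto simp: T.zero)
  have down': "gk_scale (smooth_module s') (c * of_real (down k m)) (T (e (m - 1)))
      = gk_scale (smooth_module s') (c * of_real (down k m)) (d (m - 1))" if "m \<in> S" for m c
    using down[OF that] zero[of "m - 1"] Te[of "m - 1"] by (cases "m - 1 \<in> S") (auto simp: T.zero)
  have lie: "V.lie_differentiable x \<and> W.lie_differentiable (T x) \<and>
      (\<forall>Z\<in>sl2C. T (lie_act s Z x) = lie_act s' Z (T x))" if "x \<in> V.funs.span (e ` S)" for x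
    using that
  proof (induction rule: V.funs.span_induct_alt)
    case base
    show ?case using T.zero V.lie_differentiable_zero W.lie_differentiable_zero
          V.lie_act_zero W.lie_act_zero by (simp add: zero_fun_def)
  next
    case (step c v y)
    then obtain m where m: "m \<in> S" "v = e m" by auto
    have v: "V.lie_differentiable v" "W.lie_differentiable (T v)"
      using e d m by (auto simp: V.ladder_def W.ladder_def Te)
    have "T (lie_act s Z v) = lie_act s' Z (T v)" if "Z \<in> sl2C" for Z
      using e d m that
      by (simp add: V.ladder_def W.ladder_def T.add T.scale up' down') (simp add: Te)
    moreover have y: "V.lie_differentiable y" "W.lie_differentiable (T y)"
      "\<And>Z. Z \<in> sl2C \<Longrightarrow> T (lie_act s Z y) = lie_act s' Z (T y)"
      using step.IH by auto
    ultimately show ?case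
      unfolding T.add T.scale
      by (intro conjI ballI V.lie_differentiable_add V.lie_differentiable_scale W.lie_differentiable_add
           W.lie_differentiable_scale v y)
         (simp only: V.lie_act_add[OF V.lie_differentiable_scale[OF v(1)] y(1)] V.lie_act_scale[OF v(1)]
           W.lie_act_add[OF W.lie_differentiable_scale[OF v(2)] y(2)] W.lie_act_scale[OF v(2)] T.add T.scale)
  qed
  have K: "T (\<lambda>g. x (g \<otimes>\<^bsub>Mp1R\<^esub> \<kappa>)) = (\<lambda>g. T x (g \<otimes>\<^bsub>Mp1R\<^esub> \<kappa>))"
    if "x \<in> V.funs.span (e ` S)" and \<kappa>: "\<kappa> \<in> mp_K" for x \<kappa>
    using that(1)
  proof (induction rule: V.funs.span_induct_alt)
    case base
    show ?case using T.zero by (simp add: zero_fun_def)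
  next
    case (step c v y)
    then obtain m where m: "m \<in> S" "v = e m" by auto
    let ?\<chi> = "mp_root \<kappa> \<i> powi (\<lfloor>- 2 * k\<rfloor> - 4 * m)"
    have K: "V.K_type (\<lfloor>- 2 * k\<rfloor> - 4 * m) (e m)" "W.K_type (\<lfloor>- 2 * k\<rfloor> - 4 * m) (d m)"
      using e d m by (simp_all add: V.ladder_def W.ladder_def)
    have "(\<lambda>g. (gk_scale (smooth_module s) c v + y) (g \<otimes>\<^bsub>Mp1R\<^esub> \<kappa>)) =
        gk_scale (smooth_module s) (c * ?\<chi>) (e m) + (\<lambda>g. y (g \<otimes>\<^bsub>Mp1R\<^esub> \<kappa>))"
      using \<kappa> K(1) by (simp add: fun_eq_iff V.fscale_apply m V.K_type_def)
    then have "T (\<lambda>g. (gk_scale (smooth_module s) c v + y) (g \<otimes>\<^bsub>Mp1R\<^esub> \<kappa>)) =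
        gk_scale (smooth_module s') (c * ?\<chi>) (d m) + (\<lambda>g. T y (g \<otimes>\<^bsub>Mp1R\<^esub> \<kappa>))"
      by (simp only: T.add T.scale Te[OF m(1)] step.IH)
    also have "\<dots> = (\<lambda>g. T (gk_scale (smooth_module s) c v + y) (g \<otimes>\<^bsub>Mp1R\<^esub> \<kappa>))"
      using \<kappa> K(2) by (simp add: fun_eq_iff W.fscale_apply T.add T.scale Te[OF m(1)] m(2) W.K_type_def)
    finally show ?case .
  qed
  have "T x \<in> W.funs.span (d ` S)" if "x \<in> V.funs.span (e ` S)" for x
    using that
  proof (induction rule: V.funs.span_induct_alt)
    case base
    show ?case using T.zero W.funs.span_zero[of "d ` S"] by (simp add: zero_fun_def)
  next
    case (step c v y)
    then obtain m where m: "m \<in> S" "v = e m" by auto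
    show ?case
      unfolding T.add T.scale m(2) Te[OF m(1)]
      by (intro W.funs.span_add W.funs.span_scale step.IH W.funs.span_base imageI m(1))
  qed
  then have "gk_hom ((smooth_module s)\<lparr>gk_space := V.funs.span (e ` S)\<rparr>) ((smooth_module s')\<lparr>gk_space := U\<rparr>) T"
    if "W.funs.span (d ` S) \<subseteq> U" for U
    using that lie K T.scale unfolding gk_hom_def
    by (auto simp: smooth_module_def T.add)
  then show thesis using that[OF lin Te] by blast
qed

end

section \<open>Ladders from functions on the upper half plane\<close>

context complex_normed begin

lemma lift_cong: "(\<And>\<tau>. \<tau> \<in> uhp \<Longrightarrow> g \<tau> = h \<tau>) \<Longrightarrow> lift g j = lift h j"
  by (simp add: fun_eq_iff lift_def mp_act_uhp i_uhp)

lemma lift_scale: "lift (\<lambda>\<tau>. s c (h \<tau>)) j = gk_scale (smooth_module s) c (lift h j)"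
  by (simp add: fun_eq_iff lift_def fscale_apply mult.commute)

lemma lift_nonzero:
  assumes "\<tau> \<in> uhp" "h \<tau> \<noteq> 0"
  shows "lift h j \<noteq> 0"
proof -
  have v: "Im \<tau> > 0" using assms(1) by (simp add: uhp_def)
  have "mp_act (iwasawa (Re \<tau>) (sqrt (Im \<tau>)) 0) \<i> = \<tau>"
    using v by (simp add: mp_act_iwasawa)
  then have "lift h j (iwasawa (Re \<tau>) (sqrt (Im \<tau>)) 0) \<noteq> 0"
    using assms(2) mp_root_nz[OF i_uhp] by (simp add: lift_def)
  then show ?thesis by (metis zero_fun_apply)
qed

text \<open>
  For lifts the ladder equations become differential equations on the upper half plane.
\<close>

lemma ladder_lift:
  assumes k: "- 2 * k = of_int n" and h: "\<And>m. m \<in> S \<Longrightarrow> smooth_on (h m) uhp"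
    and raise: "\<And>m \<tau>. m \<in> S \<Longrightarrow> \<tau> \<in> uhp \<Longrightarrow>
      raise (k + 2 * of_int m) (h m) \<tau> = s (of_real (up k m)) (h (m + 1) \<tau>)"
    and lower: "\<And>m \<tau>. m \<in> S \<Longrightarrow> \<tau> \<in> uhp \<Longrightarrow>
      lower (h m) \<tau> = s (of_real (down k m)) (h (m - 1) \<tau>)"
  shows "ladder k S (\<lambda>m. lift (h m) (k + 2 * of_int m))"
  unfolding ladder_def
proof (intro ballI conjI)
  fix m assume m: "m \<in> S"
  let ?j = "k + 2 * of_int m :: real"
  have j: "- 2 * ?j = of_int (n - 4 * m)" using k by simp
  have floor: "\<lfloor>- 2 * ?j\<rfloor> = \<lfloor>- 2 * k\<rfloor> - 4 * m"
    unfolding j k floor_of_int ..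
  show "mp_smooth (lift (h m) ?j)" by (rule mp_smooth_lift[OF h[OF m] j])
  show "lie_differentiable (lift (h m) ?j)"
    unfolding lie_differentiable_def lie_deriv_def
    using lift_has_vector_derivative[OF h[OF m] j] vector_derivative_at by metis
  show "K_type (\<lfloor>- 2 * k\<rfloor> - 4 * m) (lift (h m) ?j)"
    unfolding K_type_def floor[symmetric] using lift_K by blast
  fix Z assume Z: "Z \<in> sl2C"
  have "lift (raise ?j (h m)) (?j + 2) = gk_scale (smooth_module s) (of_real (up k m)) (lift (h (m + 1)) (k + 2 * of_int (m + 1)))"
  proof -
    have j': "k + 2 * of_int (m + 1) = ?j + 2" by simp
    show ?thesis
      unfolding lift_scale[symmetric] j' by (rule lift_cong) (rule raise[OF m])
  qed
  moreover have "lift (lower (h m)) (?j - 2) = gk_scale (smooth_module s) (of_real (down k m)) (lift (h (m - 1)) (k + 2 * of_int (m - 1)))"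
  proof -
    have j': "k + 2 * of_int (m - 1) = ?j - 2" by simp
    show ?thesis
      unfolding lift_scale[symmetric] j' by (rule lift_cong) (rule lower[OF m])
  qed
  ultimately show "lie_act s Z (lift (h m) ?j) =
      gk_scale (smooth_module s) (coord_H Z * of_real ?j) (lift (h m) ?j)
      + gk_scale (smooth_module s) (coord_plus Z * of_real (up k m)) (lift (h (m + 1)) (k + 2 * of_int (m + 1)))
      + gk_scale (smooth_module s) (coord_minus Z * of_real (down k m)) (lift (h (m - 1)) (k + 2 * of_int (m - 1)))"
    by (simp add: fun_eq_iff lie_act_lift[OF h[OF m] j Z] fscale_apply)
qed

end

section \<open>Principal series as lifts of powers of the imaginary part\<close>

text \<open>
  For \<open>r = (\<nu> + 1 - j) / 2\<close> these are the formulas for \<open>X\<^sub>+ \<phi>\<^sub>j\<close> and \<open>X\<^sub>- \<phi>\<^sub>j\<close>.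
\<close>

lemma raise_lower_Im_powr:
  assumes "\<tau> \<in> uhp"
  shows "cplx.raise j (\<lambda>z. of_real (Im z powr r)) \<tau> = of_real (r + j) * of_real (Im \<tau> powr (r - 1))"
    and "cplx.lower (\<lambda>z. of_real (Im z powr r)) \<tau> = of_real r * of_real (Im \<tau> powr (r + 1))"
proof -
  have v: "Im \<tau> > 0" using assms by (simp add: uhp_def)
  have "((\<lambda>z. Im z powr r) has_derivative (\<lambda>w. r * Im \<tau> powr (r - 1) * Im w)) (at \<tau>)"
    using has_derivative_compose[OF bounded_linear_imp_has_derivative[OF bounded_linear_Im]
        has_real_derivative_powr[OF v, unfolded has_field_derivative_def]] by simp
  then have "((\<lambda>z. complex_of_real (Im z powr r)) has_derivative (\<lambda>w. of_real (r * Im \<tau> powr (r - 1) * Im w))) (at \<tau>)"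
    by (rule has_derivative_of_real)
  from fun_cong[OF frechet_derivative_at[OF this]]
  have D: "frechet_derivative (\<lambda>z. complex_of_real (Im z powr r)) (at \<tau>) w = of_real (r * Im \<tau> powr (r - 1) * Im w)" for w
    by (rule sym)
  have p: "Im \<tau> powr r = Im \<tau> * Im \<tau> powr (r - 1)" "Im \<tau> powr (r + 1) = (Im \<tau>)\<^sup>2 * Im \<tau> powr (r - 1)"
    using v by (simp_all add: powr_diff powr_add power2_eq_square)
  show "cplx.raise j (\<lambda>z. of_real (Im z powr r)) \<tau> = of_real (r + j) * of_real (Im \<tau> powr (r - 1))"
    unfolding cplx.raise_def cplx.wirtinger_def D p using v by (simp add: field_simps)
  show "cplx.lower (\<lambda>z. of_real (Im z powr r)) \<tau> = of_real r * of_real (Im \<tau> powr (r + 1))"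
    unfolding cplx.lower_def cplx.wirtinger_bar_def D p using v by (simp add: field_simps)
qed

text \<open>
  At \<open>n(b) m(a) k(\<theta>)\<close> the automorphy factor contributes \<open>a\<^sup>j exp (\<i> j \<theta>)\<close> and \<open>Im \<tau> = a\<^sup>2\<close>. The Iwasawa
  decomposition covers the group, so these values determine the function.
\<close>

lemma ps_phi_lift:
  assumes "- 2 * j = of_int n"
  shows "ps_phi (of_real \<nu>) j = cplx.lift (\<lambda>\<tau>. of_real (Im \<tau> powr ((\<nu> + 1 - j) / 2))) j"
  unfolding ps_phi_def
proof (rule the_equality)
  let ?F = "cplx.lift (\<lambda>\<tau>. of_real (Im \<tau> powr ((\<nu> + 1 - j) / 2))) j"
  have F: "?F (iwasawa b a \<theta>) = of_real a powr (of_real \<nu> + 1) * exp (\<i> * of_real j * of_real \<theta>)"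
    if a: "a > 0" for b a \<theta>
  proof -
    have "a powr j * (a\<^sup>2) powr ((\<nu> + 1 - j) / 2) = a powr (\<nu> + 1)"
    proof -
      have "(a\<^sup>2) powr r = a powr t" if "2 * r = t" for r t
        using a that by (auto simp: powr_powr simp flip: powr_numeral)
      then have "(a\<^sup>2) powr ((\<nu> + 1 - j) / 2) = a powr (\<nu> + 1 - j)" by this simp
      then show ?thesis using a by (simp flip: powr_add)
    qed
    then have "complex_of_real (a powr j) * of_real ((a\<^sup>2) powr ((\<nu> + 1 - j) / 2)) = of_real (a powr (\<nu> + 1))"
      by (metis of_real_mult)
    also have "\<dots> = of_real a powr (of_real \<nu> + 1)"
      using a powr_of_real[of a "\<nu> + 1"] by simp
    finally show ?thesis
      by (simp add: cplx.lift_iwasawa[OF a assms] mult_ac)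
  qed
  then show "\<forall>b a \<theta>. a > 0 \<longrightarrow> ?F (iwasawa b a \<theta>)
      = of_real a powr (of_real \<nu> + 1) * exp (\<i> * of_real j * of_real \<theta>)" by blast
  fix G :: "mp1 \<Rightarrow> complex"
  assume G: "\<forall>b a \<theta>. a > 0 \<longrightarrow> G (iwasawa b a \<theta>)
      = of_real a powr (of_real \<nu> + 1) * exp (\<i> * of_real j * of_real \<theta>)"
  show "G = ?F"
  proof
    fix x
    show "G x = ?F x" using iwasawa_exists[of x] F G by metis
  qed
qed

text \<open>
  The function \<open>\<phi>\<^sub>k\<^sub>+\<^sub>2\<^sub>m\<close> with \<open>\<nu> = k - 1\<close>, set to zero below the lowest weight \<open>k\<close> of \<open>\<varpi>\<^sup>+(k - 1)\<close>, so that
  the family is a ladder over all integers.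
\<close>

definition phi_plus :: "real \<Rightarrow> int \<Rightarrow> mp1 \<Rightarrow> complex" where
  "phi_plus k m = cplx.lift (\<lambda>\<tau>. if m \<ge> 0 then of_real (Im \<tau> powr (- of_int m)) else 0) (k + 2 * of_int m)"

text \<open>
  The function \<open>\<phi>\<^sub>k\<^sub>+\<^sub>2\<^sub>m\<close> with \<open>\<nu> = 1 - k\<close>, set to zero above the highest weight \<open>k - 2\<close> of \<open>\<varpi>\<^sup>-(1 - k)\<close>.
\<close>

definition phi_minus :: "real \<Rightarrow> int \<Rightarrow> mp1 \<Rightarrow> complex" where
  "phi_minus k m = cplx.lift (\<lambda>\<tau>. if m < 0 then of_real (Im \<tau> powr (1 - k - of_int m)) else 0) (k + 2 * of_int m)"

lemma phi_zero: "m < 0 \<Longrightarrow> phi_plus k m = 0" "m \<ge> 0 \<Longrightarrow> phi_minus k m = 0"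
  by (simp_all add: phi_plus_def phi_minus_def fun_eq_iff cplx.lift_def)

lemma phi_nonzero: "m \<ge> 0 \<Longrightarrow> phi_plus k m \<noteq> 0" "m < 0 \<Longrightarrow> phi_minus k m \<noteq> 0"
  unfolding phi_plus_def phi_minus_def
  by (rule cplx.lift_nonzero[OF i_uhp]; simp)+

lemma ladder_phi_plus:
  assumes "- 2 * k = of_int n"
  shows "cplx.ladder k UNIV (phi_plus k)"
  unfolding phi_plus_def
proof (rule cplx.ladder_lift[OF assms])
  fix m
  show "smooth_on (\<lambda>\<tau>. if m \<ge> 0 then complex_of_real (Im \<tau> powr (- of_int m)) else 0) uhp"
    by (cases "m \<ge> 0") (simp_all add: smooth_on_Im_powr smooth_on_const)
  fix \<tau> assume t: "\<tau> \<in> uhp"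
  have 0: "cplx.raise j (\<lambda>\<tau>. 0) \<tau> = 0" "cplx.lower (\<lambda>\<tau>. 0) \<tau> = 0" for j
    by (simp_all add: cplx.raise_def cplx.wirtinger_def cplx.lower_def cplx.wirtinger_bar_def)
  show "cplx.raise (k + 2 * of_int m) (\<lambda>\<tau>. if m \<ge> 0 then complex_of_real (Im \<tau> powr (- of_int m)) else 0) \<tau>
      = of_real (up k m) * (if m + 1 \<ge> 0 then complex_of_real (Im \<tau> powr (- of_int (m + 1))) else 0)"
  proof -
    have "- real_of_int (m + 1) = - of_int m - 1" by simp
    then show ?thesis
      by (cases "m \<ge> 0"; cases "m = - 1") (simp_all add: raise_lower_Im_powr[OF t] 0 up_def)
  qed
  show "cplx.lower (\<lambda>\<tau>. if m \<ge> 0 then complex_of_real (Im \<tau> powr (- of_int m)) else 0) \<tau>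
      = of_real (down k m) * (if m - 1 \<ge> 0 then complex_of_real (Im \<tau> powr (- of_int (m - 1))) else 0)"
    by (cases "m \<ge> 0") (auto simp: raise_lower_Im_powr[OF t] 0 down_def algebra_simps)
qed

lemma ladder_phi_minus:
  assumes "- 2 * k = of_int n"
  shows "cplx.ladder k {..<0} (phi_minus k)"
  unfolding phi_minus_def
proof (rule cplx.ladder_lift[OF assms])
  fix m :: int assume m: "m \<in> {..<0}"
  show "smooth_on (\<lambda>\<tau>. if m < 0 then complex_of_real (Im \<tau> powr (1 - k - of_int m)) else 0) uhp"
    by (cases "m < 0") (simp_all add: smooth_on_Im_powr smooth_on_const)
  fix \<tau> assume t: "\<tau> \<in> uhp"
  show "cplx.raise (k + 2 * of_int m) (\<lambda>\<tau>. if m < 0 then complex_of_real (Im \<tau> powr (1 - k - of_int m)) else 0) \<tau>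
      = of_real (up k m) * (if m + 1 < 0 then complex_of_real (Im \<tau> powr (1 - k - of_int (m + 1))) else 0)"
    using m by (cases "m = - 1") (auto simp: raise_lower_Im_powr[OF t] up_def algebra_simps)
  show "cplx.lower (\<lambda>\<tau>. if m < 0 then complex_of_real (Im \<tau> powr (1 - k - of_int m)) else 0) \<tau>
      = of_real (down k m) * (if m - 1 < 0 then complex_of_real (Im \<tau> powr (1 - k - of_int (m - 1))) else 0)"
    using m by (auto simp: raise_lower_Im_powr[OF t] down_def algebra_simps)
qed

lemma varpi_plus_eq:
  assumes "- 2 * k = of_int n"
  shows "varpi_plus (k - 1) = (smooth_module (*))\<lparr>gk_space := cplx.funs.span (phi_plus k ` {0..})\<rparr>"
proof -
  have "ps_phi (of_real (k - 1)) (k - 1 + 1 + 2 * of_nat i) = phi_plus k (int i)" for i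
  proof -
    have "- 2 * (k + 2 * of_nat i) = of_int (n - 4 * int i)" using assms by simp
    from ps_phi_lift[OF this, of "k - 1"] show ?thesis by (simp add: phi_plus_def)
  qed
  then have "{ps_phi (of_real (k - 1)) (k - 1 + 1 + 2 * of_nat n) | n. True} = phi_plus k ` (int ` UNIV)"
    by (auto simp: image_image)
  also have "int ` UNIV = {0..}" using zero_le_imp_eq_int by (auto simp: image_iff)
  finally show ?thesis
    by (simp add: varpi_plus_def principal_series_def Let_def smooth_module_def)
qed

lemma varpi_minus_eq:
  assumes "- 2 * k = of_int n"
  shows "varpi_minus (1 - k) = (smooth_module (*))\<lparr>gk_space := cplx.funs.span (phi_minus k ` {..<0})\<rparr>"
proof -
  have "ps_phi (of_real (1 - k)) (- (1 - k) - 1 - 2 * of_nat i) = phi_minus k (- 1 - int i)" for i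
  proof -
    have "- 2 * (k - 2 - 2 * of_nat i) = of_int (n + 4 + 4 * int i)" using assms by simp
    from ps_phi_lift[OF this, of "1 - k"] show ?thesis by (simp add: phi_minus_def algebra_simps add_divide_distrib diff_divide_distrib)
  qed
  then have "{ps_phi (of_real (1 - k)) (- (1 - k) - 1 - 2 * of_nat n) | n. True} = phi_minus k ` ((\<lambda>i. - 1 - int i) ` UNIV)"
    by (auto simp: image_image)
  also have "(\<lambda>i. - 1 - int i) ` UNIV = {..<0}"
  proof (intro equalityI subsetI)
    fix m :: int assume "m \<in> {..<0}"
    then have "m = - 1 - int (nat (- 1 - m))" by simp
    then show "m \<in> (\<lambda>i. - 1 - int i) ` UNIV" by blast
  qed auto
  finally show ?thesis
    by (simp add: varpi_minus_def principal_series_def Let_def smooth_module_def)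
qed

section \<open>Repeated raising and lowering of a harmonic form\<close>

text \<open>
  The factors are chosen such that raising \<open>raised k f i\<close> and lowering \<open>lowered k f i\<close> produce the
  constants \<^const>\<open>up\<close> and \<^const>\<open>down\<close> of the principal series. The denominators do not vanish
  because \<open>k\<close> is not an integer.
\<close>

primrec raised :: "real \<Rightarrow> (complex \<Rightarrow> complex^'n) \<Rightarrow> nat \<Rightarrow> complex \<Rightarrow> complex^'n" where
  "raised k f 0 = f"
| "raised k f (Suc i) = (\<lambda>\<tau>. of_real (1 / (k + of_nat i)) *s cvec.raise (k + 2 * of_nat i) (raised k f i) \<tau>)"

primrec lowered :: "real \<Rightarrow> (complex \<Rightarrow> complex^'n) \<Rightarrow> nat \<Rightarrow> complex \<Rightarrow> complex^'n" where
  "lowered k f 0 = cvec.lower f"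
| "lowered k f (Suc i) = (\<lambda>\<tau>. of_real (1 / (2 - k + of_nat i)) *s cvec.lower (lowered k f i) \<tau>)"

lemma smooth_raised: "smooth_on f uhp \<Longrightarrow> smooth_on (raised k f i) uhp"
  by (induction i) (auto intro!: cvec.smooth_on_scale smooth_on_const cvec.smooth_on_raise)

lemma smooth_lowered: "smooth_on f uhp \<Longrightarrow> smooth_on (lowered k f i) uhp"
  by (induction i) (auto intro!: cvec.smooth_on_scale smooth_on_const cvec.smooth_on_lower)

lemma half_integer_nonzero:
  fixes k :: real
  assumes "k - 1/2 \<in> \<int>"
  shows "k + of_int m \<noteq> 0"
proof
  assume "k + of_int m = 0"
  moreover obtain l where "k - 1/2 = of_int l" using assms by (auto elim: Ints_cases)
  ultimately have "2 * of_int (l + m) = (- 1 :: real)" by simp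
  then have "2 * (l + m) = - 1" by linarith
  then show False by presburger
qed

lemma scale_inverse_cancel:
  fixes x :: "complex^'n"
  shows "c \<noteq> 0 \<Longrightarrow> of_real c *s (of_real (1 / c) *s x) = x"
  by (simp add: vector_smult_assoc)

lemma raise_raised:
  assumes "k - 1/2 \<in> \<int>"
  shows "cvec.raise (k + 2 * of_nat i) (raised k f i) \<tau> = of_real (k + of_nat i) *s raised k f (Suc i) \<tau>"
proof -
  have "k + of_nat i \<noteq> 0" using half_integer_nonzero[OF assms, of "int i"] by simp
  then show ?thesis unfolding raised.simps by (rule scale_inverse_cancel[symmetric])
qed

lemma lower_lowered:
  assumes "k - 1/2 \<in> \<int>"
  shows "cvec.lower (lowered k f i) \<tau> = of_real (2 - k + of_nat i) *s lowered k f (Suc i) \<tau>"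
proof -
  have "2 - k + of_nat i \<noteq> 0"
    using half_integer_nonzero[OF assms, of "- 2 - int i"] by (simp add: algebra_simps)
  then show ?thesis unfolding lowered.simps by (rule scale_inverse_cancel[symmetric])
qed

text \<open>
  Induction with \<open>lower_raise\<close>, where harmonicity starts the induction. The step comes down to the
  identity \<open>i (k + i - 1) + (k + 2 i) = (i + 1) (k + i)\<close>.
\<close>

lemma lower_raised:
  assumes f: "smooth_on f uhp" and harm: "\<And>\<tau>. \<tau> \<in> uhp \<Longrightarrow> cvec.raise (k - 2) (cvec.lower f) \<tau> = 0"
    and k: "k - 1/2 \<in> \<int>" and t: "\<tau> \<in> uhp"
  shows "cvec.lower (raised k f (Suc i)) \<tau> = of_real (- (of_nat i + 1)) *s raised k f i \<tau>"
  using t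
proof (induction i arbitrary: \<tau>)
  case 0
  have "k \<noteq> 0" using half_integer_nonzero[OF k, of 0] by simp
  then show ?case
    using harm[OF 0] by (simp add: cvec.lower_scale cvec.smooth_on_raise f 0 lower_raise vec_eq_iff)
next
  case (Suc i)
  let ?g = "raised k f (Suc i)" and ?j = "k + 2 * of_nat (Suc i)"
  have g: "smooth_on ?g uhp" by (rule smooth_raised[OF f])
  have nz: "k + of_nat i \<noteq> 0" "k + of_nat i + 1 \<noteq> 0"
    using half_integer_nonzero[OF k, of "int i"] half_integer_nonzero[OF k, of "int i + 1"]
    by (simp_all add: add.assoc)
  have "cvec.raise (?j - 2) (cvec.lower ?g) \<tau>
      = cvec.raise (?j - 2) (\<lambda>\<tau>. of_real (- (of_nat i + 1)) *s raised k f i \<tau>) \<tau>"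
    using Suc by (intro cvec.raise_cong) auto
  also have "\<dots> = of_real (- (of_nat i + 1)) *s cvec.raise (?j - 2) (raised k f i) \<tau>"
    by (rule cvec.raise_scale[OF smooth_raised[OF f] Suc.prems])
  also have "cvec.raise (?j - 2) (raised k f i) \<tau> = of_real (k + of_nat i) *s ?g \<tau>"
  proof -
    have "?j - 2 = k + 2 * of_nat i" by simp
    then show ?thesis by (simp only: raise_raised[OF k])
  qed
  finally have R: "cvec.raise (?j - 2) (cvec.lower ?g) \<tau>
      = of_real (- (of_nat i + 1) * (k + of_nat i)) *s ?g \<tau>"
    by (simp only: vector_smult_assoc of_real_mult)
  have "cvec.lower (raised k f (Suc (Suc i))) \<tau> = of_real (1 / (k + of_nat (Suc i))) *s cvec.lower (cvec.raise ?j ?g) \<tau>"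
    unfolding raised.simps(2)[of k f "Suc i"]
    by (rule cvec.lower_scale[OF cvec.smooth_on_raise[OF g] Suc.prems])
  also have "cvec.lower (cvec.raise ?j ?g) \<tau> = of_real (- (of_nat i + 1) * (k + of_nat i) - ?j) *s ?g \<tau>"
    unfolding lower_raise[OF g Suc.prems] R by (simp only: of_real_diff vec.scale_left_diff_distrib)
  also have "of_real (1 / (k + of_nat (Suc i))) *s (of_real (- (of_nat i + 1) * (k + of_nat i) - ?j) *s ?g \<tau>)
      = of_real (- (of_nat (Suc i) + 1)) *s ?g \<tau>"
  proof -
    have "1 / (k + of_nat (Suc i)) * (- (of_nat i + 1) * (k + of_nat i) - ?j) = - (of_nat (Suc i) + 1)"
      using nz by (simp add: divide_simps) (simp add: algebra_simps)
    then show ?thesis unfolding vector_smult_assoc of_real_mult[symmetric] by (simp only:)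
  qed
  finally show ?case .
qed

text \<open>
  The mirror image of \<open>lower_raised\<close>, starting from \<open>R\<^sub>k\<^sub>-\<^sub>2 (L f) = 0\<close>.
\<close>

lemma raise_lowered:
  assumes f: "smooth_on f uhp" and harm: "\<And>\<tau>. \<tau> \<in> uhp \<Longrightarrow> cvec.raise (k - 2) (cvec.lower f) \<tau> = 0"
    and k: "k - 1/2 \<in> \<int>" and t: "\<tau> \<in> uhp"
  shows "cvec.raise (k - 4 - 2 * of_nat i) (lowered k f (Suc i)) \<tau> = of_real (- (of_nat i + 1)) *s lowered k f i \<tau>"
  using t
proof (induction i arbitrary: \<tau>)
  case 0
  have nz: "2 - k \<noteq> 0" using half_integer_nonzero[OF k, of "- 2"] by simp
  have g: "smooth_on (cvec.lower f) uhp" by (rule cvec.smooth_on_lower[OF f])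
  have "cvec.lower (cvec.raise (k - 2) (cvec.lower f)) \<tau> = cvec.lower (\<lambda>_. 0) \<tau>"
    using harm by (intro cvec.lower_cong[OF 0]) auto
  also have "\<dots> = 0" by (simp add: cvec.lower_def cvec.wirtinger_bar_def)
  finally have L: "cvec.raise (k - 2 - 2) (cvec.lower (cvec.lower f)) \<tau> = of_real (k - 2) *s cvec.lower f \<tau>"
    using lower_raise[OF g 0, of "k - 2"] by simp
  have "cvec.raise (k - 4) (lowered k f (Suc 0)) \<tau> = of_real (1 / (2 - k)) *s (of_real (k - 2) *s cvec.lower f \<tau>)"
    using cvec.raise_scale[OF cvec.smooth_on_lower[OF g] 0, of "k - 4" "of_real (1 / (2 - k))"] L by simp
  also have "\<dots> = of_real (- 1) *s cvec.lower f \<tau>"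
  proof -
    have "1 / (2 - k) * (k - 2) = - 1" using nz by (simp add: field_simps)
    then show ?thesis unfolding vector_smult_assoc of_real_mult[symmetric] by (simp only:)
  qed
  finally show ?case by simp
next
  case (Suc i)
  let ?g = "lowered k f (Suc i)" and ?j = "k - 4 - 2 * of_nat i"
  have g: "smooth_on ?g uhp" by (rule smooth_lowered[OF f])
  have nz: "2 - k + of_nat i \<noteq> 0" "2 - k + of_nat (Suc i) \<noteq> 0"
    using half_integer_nonzero[OF k, of "- 2 - int i"] half_integer_nonzero[OF k, of "- 3 - int i"]
    by (simp_all add: algebra_simps)
  have "cvec.lower (cvec.raise ?j ?g) \<tau> = cvec.lower (\<lambda>\<tau>. of_real (- (of_nat i + 1)) *s lowered k f i \<tau>) \<tau>"
    using Suc by (intro cvec.lower_cong) auto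
  also have "\<dots> = of_real (- (of_nat i + 1)) *s cvec.lower (lowered k f i) \<tau>"
    by (rule cvec.lower_scale[OF smooth_lowered[OF f] Suc.prems])
  also note lower_lowered[OF k]
  finally have L: "cvec.lower (cvec.raise ?j ?g) \<tau> = of_real (- (of_nat i + 1) * (2 - k + of_nat i)) *s ?g \<tau>"
    by (simp only: vector_smult_assoc of_real_mult)
  have "cvec.raise (?j - 2) (cvec.lower ?g) \<tau> = cvec.lower (cvec.raise ?j ?g) \<tau> + of_real ?j *s ?g \<tau>"
    unfolding lower_raise[OF g Suc.prems] by (rule diff_add_cancel[symmetric])
  then have R: "cvec.raise (?j - 2) (cvec.lower ?g) \<tau> = of_real (- (of_nat i + 1) * (2 - k + of_nat i) + ?j) *s ?g \<tau>"
    unfolding L by (simp only: of_real_add vector_sadd_rdistrib)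
  have "cvec.raise (?j - 2) (lowered k f (Suc (Suc i))) \<tau>
      = of_real (1 / (2 - k + of_nat (Suc i))) *s cvec.raise (?j - 2) (cvec.lower ?g) \<tau>"
    unfolding lowered.simps(2)[of k f "Suc i"]
    by (rule cvec.raise_scale[OF cvec.smooth_on_lower[OF g] Suc.prems])
  also have "\<dots> = of_real (- (of_nat (Suc i) + 1)) *s ?g \<tau>"
  proof -
    have "1 / (2 - k + of_nat (Suc i)) * (- (of_nat i + 1) * (2 - k + of_nat i) + ?j) = - (of_nat (Suc i) + 1)"
      using nz(2) by (simp add: divide_simps) (simp add: algebra_simps)
    then show ?thesis unfolding R vector_smult_assoc of_real_mult[symmetric] by (simp only:)
  qed
  finally show ?case by (simp add: algebra_simps)
qed

text \<open>
  The raised forms for \<open>m \<ge> 0\<close> and the lowered ones for \<open>m < 0\<close>; \<open>nat (- 1 - m)\<close> counts down from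
  \<open>L f\<close> at \<open>m = - 1\<close>.
\<close>

definition rung :: "real \<Rightarrow> (complex \<Rightarrow> complex^'n) \<Rightarrow> int \<Rightarrow> complex \<Rightarrow> complex^'n" where
  "rung k f m = (if m \<ge> 0 then raised k f (nat m) else lowered k f (nat (- 1 - m)))"

lemma rung_of_nat: "rung k f (int i) = raised k f i" "rung k f (- 1 - int i) = lowered k f i"
  by (simp_all add: rung_def)

lemma int_rung_cases:
  obtains i where "m = int i" | i where "m = - 1 - int i"
proof (cases "m \<ge> 0")
  case True
  then show thesis using that(1)[of "nat m"] by simp
next
  case False
  then show thesis using that(2)[of "nat (- 1 - m)"] by simp
qed

lemma ladder_maass:
  assumes f: "smooth_on f uhp" and harm: "\<And>\<tau>. \<tau> \<in> uhp \<Longrightarrow> cvec.raise (k - 2) (cvec.lower f) \<tau> = 0"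
    and k: "k - 1/2 \<in> \<int>" "- 2 * k = of_int n"
  shows "cvec.ladder k UNIV (\<lambda>m. cvec.lift (rung k f m) (k + 2 * of_int m))"
proof (rule cvec.ladder_lift[OF k(2)])
  fix m
  show "smooth_on (rung k f m) uhp"
    unfolding rung_def using smooth_raised[OF f] smooth_lowered[OF f] by simp
  fix \<tau> assume t: "\<tau> \<in> uhp"
  show "cvec.raise (k + 2 * of_int m) (rung k f m) \<tau> = of_real (up k m) *s rung k f (m + 1) \<tau>"
  proof (cases m rule: int_rung_cases)
    case (1 i)
    have "rung k f m = raised k f i" "rung k f (m + 1) = raised k f (Suc i)"
      using 1 rung_of_nat(1)[of k f i] rung_of_nat(1)[of k f "Suc i"] by (simp_all add: add.commute)
    moreover have "up k m = k + of_nat i" "real_of_int m = of_nat i" using 1 by (simp_all add: up_def)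
    ultimately show ?thesis by (simp only: raise_raised[OF k(1)])
  next
    case (2 i)
    show ?thesis
    proof (cases i)
      case 0
      then show ?thesis using harm[OF t] by (simp add: 2 rung_def up_def)
    next
      case (Suc i')
      have m: "m + 1 = - 1 - int i'" "m = - 1 - int (Suc i')" using 2 Suc by simp_all
      then have "rung k f (m + 1) = lowered k f i'" "rung k f m = lowered k f (Suc i')"
        by (simp_all only: rung_of_nat)
      moreover have "up k m = - (of_nat i' + 1)" "k + 2 * of_int m = k - 4 - 2 * of_nat i'"
        using m(2) by (simp_all add: up_def)
      ultimately show ?thesis using raise_lowered[OF f harm k(1) t, of i'] by (simp only:)
    qed
  qed
  show "cvec.lower (rung k f m) \<tau> = of_real (down k m) *s rung k f (m - 1) \<tau>"
  proof (cases m rule: int_rung_cases)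
    case (1 i)
    show ?thesis
    proof (cases i)
      case 0
      then show ?thesis by (simp add: 1 rung_def down_def)
    next
      case (Suc i')
      have "m - 1 = int i'" "m = int (Suc i')" using 1 Suc by simp_all
      then show ?thesis
        using lower_raised[OF f harm k(1) t, of i'] rung_of_nat(1)[of k f i'] rung_of_nat(1)[of k f "Suc i'"]
        by (simp add: down_def)
    qed
  next
    case (2 i)
    have "m - 1 = - 1 - int (Suc i)" using 2 by simp
    then have "rung k f m = lowered k f i" "rung k f (m - 1) = lowered k f (Suc i)"
      using 2 rung_of_nat(2)[of k f i] rung_of_nat(2)[of k f "Suc i"] by simp_all
    moreover have "down k m = 2 - k + of_nat i" using 2 by (simp add: down_def)
    ultimately show ?thesis by (simp only: lower_lowered[OF k(1)])
  qed
qed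

lemma lower_op_eq: "lower_op f = cvec.lower f"
  by (simp add: fun_eq_iff lower_op_def cvec.lower_def d_taubar_def cvec.wirtinger_bar_def)

lemma raise_op_eq: "raise_op k f = cvec.raise k f"
  by (simp add: fun_eq_iff raise_op_def cvec.raise_def d_tau_def cvec.wirtinger_def)

text \<open>
  The Cauchy-Riemann equations, as the vanishing of the antilinear part of the real derivative.
\<close>

lemma holomorphic_iff_lower:
  fixes f :: "complex \<Rightarrow> complex^'n"
  assumes f: "smooth_on f uhp"
  shows "(\<forall>i. (\<lambda>\<tau>. f \<tau> $ i) holomorphic_on uhp) \<longleftrightarrow> (\<forall>\<tau>\<in>uhp. cvec.lower f \<tau> = 0)"
proof -
  have comp: "((\<lambda>z. f z $ i) has_derivative (\<lambda>w. w * cvec.wirtinger f \<tau> $ i + cnj w * cvec.wirtinger_bar f \<tau> $ i)) (at \<tau>)"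
    if t: "\<tau> \<in> uhp" for \<tau> i
    using bounded_linear.has_derivative[OF bounded_linear_vec_nth smooth_on_has_derivative[OF f t], of i]
    unfolding cvec.D_wirtinger[OF f t] by simp
  have lower: "cvec.lower f \<tau> = 0 \<longleftrightarrow> (\<forall>i. cvec.wirtinger_bar f \<tau> $ i = 0)" if "\<tau> \<in> uhp" for \<tau>
    using that by (simp add: cvec.lower_def uhp_def vec_eq_iff)
  have diff: "(\<lambda>z. f z $ i) field_differentiable (at \<tau>) \<longleftrightarrow> cvec.wirtinger_bar f \<tau> $ i = 0" if t: "\<tau> \<in> uhp" for \<tau> i
  proof
    assume "(\<lambda>z. f z $ i) field_differentiable (at \<tau>)"
    then obtain c where "((\<lambda>z. f z $ i) has_derivative (*) c) (at \<tau>)"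
      by (auto simp: field_differentiable_def has_field_derivative_def)
    from has_derivative_unique[OF this comp[OF t]]
    have eq: "c * w = w * cvec.wirtinger f \<tau> $ i + cnj w * cvec.wirtinger_bar f \<tau> $ i" for w by (rule fun_cong)
    show "cvec.wirtinger_bar f \<tau> $ i = 0" using eq[of 1] eq[of \<i>] by (simp add: algebra_simps)
  next
    assume "cvec.wirtinger_bar f \<tau> $ i = 0"
    moreover have "(\<lambda>w. w * c) = (*) c" for c :: complex by (simp add: fun_eq_iff mult.commute)
    ultimately have "((\<lambda>z. f z $ i) has_field_derivative cvec.wirtinger f \<tau> $ i) (at \<tau>)"
      using comp[OF t, of i] by (simp add: has_field_derivative_def)
    then show "(\<lambda>z. f z $ i) field_differentiable (at \<tau>)" by (auto simp: field_differentiable_def)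
  qed
  show ?thesis
    using diff lower by (auto simp: holomorphic_on_open[OF open_uhp] field_differentiable_def)
qed

section \<open>Structure of the module generated by a harmonic form\<close>

text \<open>
  Homomorphisms into the module of a form start from \<open>\<complex>\<close>-valued functions; those out of it end there.
\<close>

interpretation cc: complex_normed_pair "(*) :: complex \<Rightarrow> complex \<Rightarrow> complex" "(*s) :: complex \<Rightarrow> complex^'n \<Rightarrow> complex^'n" ..

interpretation vc: complex_normed_pair "(*s) :: complex \<Rightarrow> complex^'n \<Rightarrow> complex^'n" "(*) :: complex \<Rightarrow> complex \<Rightarrow> complex" ..

lemma (in complex_normed) ladder_nonzero_neighbours:
  assumes e: "ladder k S e" "m \<in> S"
  shows "e (m + 1) \<noteq> 0 \<Longrightarrow> up k m \<noteq> 0 \<Longrightarrow> e m \<noteq> 0"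
    and "e (m - 1) \<noteq> 0 \<Longrightarrow> down k m \<noteq> 0 \<Longrightarrow> e m \<noteq> 0"
  using ladder_raise_lower[OF e] lie_act_zero by auto

lemma (in complex_normed) ladder_subset: "ladder k S e \<Longrightarrow> S' \<subseteq> S \<Longrightarrow> ladder k S' e"
  by (auto simp: ladder_def)

text \<open>
  The number \<open>n\<close> serves to evaluate the exponent \<open>\<lfloor>- 2 * k\<rfloor>\<close> of the automorphy factor.
\<close>

locale harmonic_ladder =
  fixes k :: real and f :: "complex \<Rightarrow> complex^'n" and n :: int
  assumes k: "k - 1/2 \<in> \<int>" and k2: "- 2 * k = of_int n" and f: "smooth_on f uhp"
    and harm: "\<And>\<tau>. \<tau> \<in> uhp \<Longrightarrow> cvec.raise (k - 2) (cvec.lower f) \<tau> = 0"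
begin

definition e :: "int \<Rightarrow> mp1 \<Rightarrow> complex^'n" where
  "e m = cvec.lift (rung k f m) (k + 2 * of_int m)"

lemma ladder_e: "cvec.ladder k S e"
  unfolding e_def using cvec.ladder_subset[OF ladder_maass[OF f harm k k2]] by auto

lemma up_nonzero: "m \<noteq> - 1 \<Longrightarrow> up k m \<noteq> 0"
  using half_integer_nonzero[OF k, of m] by (auto simp: up_def)

lemma down_nonzero: "down k m \<noteq> 0"
  using half_integer_nonzero[OF k, of "m - 1"] by (auto simp: down_def)

lemma varpi_eq: "varpi f k = (smooth_module (*s))\<lparr>gk_space := cvec.funs.span (range e)\<rparr>"
proof -
  have "mp_lift f k = e 0"
    by (simp add: fun_eq_iff e_def mp_lift_def cvec.lift_def rung_def)
  then show ?thesis
    using cvec.ladder_generated[OF ladder_e] up_nonzero down_nonzero by (simp add: varpi_def)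
qed

lemma e_nonneg_nonzero:
  assumes "\<tau> \<in> uhp" "f \<tau> \<noteq> 0" "m \<ge> 0"
  shows "e m \<noteq> 0"
  using assms(3)
proof (induction m rule: int_ge_induct)
  case base
  show ?case unfolding e_def by (rule cvec.lift_nonzero[OF assms(1)]) (simp add: rung_def assms)
next
  case (step i)
  then have "e i \<noteq> 0" by (simp add: zero_fun_def)
  then show "e (i + 1) \<noteq> 0"
    using cvec.ladder_nonzero_neighbours(2)[OF ladder_e, of "i + 1" UNIV] down_nonzero by simp
qed

lemma e_neg_nonzero:
  assumes "\<tau> \<in> uhp" "cvec.lower f \<tau> \<noteq> 0" "m < 0"
  shows "e m \<noteq> 0"
proof -
  have "m \<le> - 1" using assms(3) by simp
  then show ?thesis
  proof (induction m rule: int_le_induct)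
    case base
    show ?case unfolding e_def by (rule cvec.lift_nonzero[OF assms(1)]) (simp add: rung_def assms)
  next
    case (step i)
    then have "e i \<noteq> 0" by (simp add: zero_fun_def)
    then show "e (i - 1) \<noteq> 0"
      using step(1) cvec.ladder_nonzero_neighbours(1)[OF ladder_e, of "i - 1" UNIV] up_nonzero[of "i - 1"] by simp
  qed
qed

lemma e_neg_zero:
  assumes "\<And>\<tau>. \<tau> \<in> uhp \<Longrightarrow> cvec.lower f \<tau> = 0" "m < 0"
  shows "e m = 0"
proof -
  have "m \<le> - 1" using assms(2) by simp
  then show ?thesis
  proof (induction m rule: int_le_induct)
    case base
    show ?case using assms(1) by (simp add: fun_eq_iff e_def cvec.lift_def rung_def mp_act_uhp i_uhp)
  next
    case (step i)
    have "gk_scale (smooth_module (*s)) (of_real (down k i)) (e (i - 1)) = lie_act (*s) sl2_minus (e i)"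
      using cvec.ladder_raise_lower(2)[OF ladder_e, of i UNIV] by simp
    also have "\<dots> = 0" unfolding step.IH by (rule cvec.lie_act_zero)
    finally show ?case using down_nonzero[of i] by simp
  qed
qed

text \<open>
  All rungs with \<open>m < 0\<close> vanish, so matching the rungs with \<open>m \<ge> 0\<close> is a map on the whole module. It
  takes a basis to a basis.
\<close>

lemma varpi_isomorphic_plus:
  assumes "\<tau> \<in> uhp" "f \<tau> \<noteq> 0" and hol: "\<And>\<tau>. \<tau> \<in> uhp \<Longrightarrow> cvec.lower f \<tau> = 0"
  shows "gk_isomorphic (varpi f k) (varpi_plus (k - 1))"
proof -
  let ?S = "{0::int..}"
  have nz: "e m \<noteq> 0" if "m \<in> ?S" for m using e_nonneg_nonzero[OF assms(1,2)] that by simp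
  have zero: "e m = 0" if "m \<notin> ?S" for m using e_neg_zero[OF hol] that by simp
  have phi: "cplx.ladder k ?S (phi_plus k)" by (rule cplx.ladder_subset[OF ladder_phi_plus[OF k2]]) simp
  have phi_nz: "phi_plus k m \<noteq> 0" if "m \<in> ?S" for m using phi_nonzero that by simp
  obtain T where lin: "Vector_Spaces.linear (gk_scale (smooth_module (*s))) (gk_scale (smooth_module (*))) T"
    and T: "\<And>m. m \<in> ?S \<Longrightarrow> T (e m) = phi_plus k m"
    and hom: "\<And>U. cplx.funs.span (phi_plus k ` ?S) \<subseteq> U \<Longrightarrow>
      gk_hom ((smooth_module (*s))\<lparr>gk_space := cvec.funs.span (e ` ?S)\<rparr>) ((smooth_module (*))\<lparr>gk_space := U\<rparr>) T"
    by (rule vc.ladder_hom[OF ladder_e phi nz zero]) (auto simp: phi_zero)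
  have image: "T ` e ` ?S = phi_plus k ` ?S" using T by (auto simp: image_image)
  have "inj_on T (cvec.funs.span (e ` ?S))"
  proof (rule vc.funs2.linear_inj_on_span_independent_image[OF lin])
    show "cplx.funs.independent (T ` e ` ?S)"
      unfolding image by (rule cplx.ladder_independent(2)[OF phi phi_nz])
    show "inj_on T (e ` ?S)"
      using cplx.ladder_independent(1)[OF phi phi_nz] T by (auto simp: inj_on_def)
  qed
  moreover have "T ` cvec.funs.span (e ` ?S) = cplx.funs.span (phi_plus k ` ?S)"
    unfolding image[symmetric] by (rule vc.funs2.linear_span_image[OF lin, symmetric])
  moreover have "cvec.funs.span (range e) = cvec.funs.span (e ` ?S)"
  proof (rule cvec.funs.span_eq[THEN iffD2], intro conjI subsetI)
    fix x assume "x \<in> range e"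
    then obtain m where "x = e m" by auto
    then show "x \<in> cvec.funs.span (e ` ?S)"
      using zero[of m] by (cases "m \<in> ?S") (auto simp: cvec.funs.span_zero intro: cvec.funs.span_base)
  qed (auto intro: cvec.funs.span_base)
  ultimately show ?thesis
    unfolding gk_isomorphic_def varpi_eq varpi_plus_eq[OF k2]
    using hom[OF order_refl] by (auto simp: bij_betw_def)
qed

text \<open>
  Now all rungs are nonzero. The inclusion matches the negative rungs; \<open>up k (- 1) = 0\<close> makes them
  a submodule. The projection matches the rungs with \<open>m \<ge> 0\<close> and sends the others to zero, so its
  kernel is the span of the negative rungs.
\<close>

lemma varpi_extension:
  assumes "\<tau> \<in> uhp" "cvec.lower f \<tau> \<noteq> 0"
  shows "\<exists>i p. gk_short_exact (varpi_minus (1 - k)) (varpi f k) (varpi_plus (k - 1)) i p \<and>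
    \<not> gk_splits (varpi f k) (varpi_plus (k - 1)) p"
proof -
  let ?N = "{..<0::int}" and ?P = "{0::int..}"
  obtain \<tau>' where "\<tau>' \<in> uhp" "f \<tau>' \<noteq> 0"
  proof -
    have False if "\<And>\<tau>. \<tau> \<in> uhp \<Longrightarrow> f \<tau> = 0"
    proof -
      have "cvec.lower f \<tau> = cvec.lower (\<lambda>_. 0) \<tau>" by (rule cvec.lower_cong[OF assms(1) that])
      then show False using assms(2) by (simp add: cvec.lower_def cvec.wirtinger_bar_def)
    qed
    then show thesis using that by blast
  qed
  then have nz: "e m \<noteq> 0" for m
    using e_nonneg_nonzero[of \<tau>' m] e_neg_nonzero[OF assms, of m] by (cases "m \<ge> 0") auto
  have plus: "cplx.ladder k S (phi_plus k)" for S by (rule cplx.ladder_subset[OF ladder_phi_plus[OF k2]]) simp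
  have minus: "cplx.ladder k ?N (phi_minus k)" by (rule ladder_phi_minus[OF k2])
  obtain i where lin_i: "Vector_Spaces.linear (gk_scale (smooth_module (*))) (gk_scale (smooth_module (*s))) i"
    and i: "\<And>m. m \<in> ?N \<Longrightarrow> i (phi_minus k m) = e m"
    and hom_i: "\<And>U. cvec.funs.span (e ` ?N) \<subseteq> U \<Longrightarrow>
      gk_hom ((smooth_module (*))\<lparr>gk_space := cplx.funs.span (phi_minus k ` ?N)\<rparr>) ((smooth_module (*s))\<lparr>gk_space := U\<rparr>) i"
  proof (rule cc.ladder_hom[OF minus ladder_e])
    show "phi_minus k m \<noteq> 0" if "m \<in> ?N" for m using phi_nonzero that by simp
    show "phi_minus k m = 0" if "m \<notin> ?N" for m using phi_zero that by simp
    show "up k m = 0 \<or> e (m + 1) = 0" if "m \<in> ?N" "m + 1 \<notin> ?N" for m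
      using that by (auto simp: up_def)
  qed auto
  obtain p where lin_p: "Vector_Spaces.linear (gk_scale (smooth_module (*s))) (gk_scale (smooth_module (*))) p"
    and p: "\<And>m. p (e m) = phi_plus k m"
    and hom_p: "\<And>U. cplx.funs.span (range (phi_plus k)) \<subseteq> U \<Longrightarrow>
      gk_hom ((smooth_module (*s))\<lparr>gk_space := cvec.funs.span (range e)\<rparr>) ((smooth_module (*))\<lparr>gk_space := U\<rparr>) p"
    by (rule vc.ladder_hom[OF ladder_e plus[of UNIV]]) (auto simp: nz)
  interpret i: Vector_Spaces.linear "gk_scale (smooth_module (*))" "gk_scale (smooth_module (*s))" i by (rule lin_i)
  interpret p: Vector_Spaces.linear "gk_scale (smooth_module (*s))" "gk_scale (smooth_module (*))" p by (rule lin_p)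
  let ?B = "cvec.funs.span (range e)" and ?C = "cplx.funs.span (phi_plus k ` ?P)"
  have C: "cplx.funs.span (range (phi_plus k)) = ?C"
  proof (rule cplx.funs.span_eq[THEN iffD2], intro conjI subsetI)
    fix x assume "x \<in> range (phi_plus k)"
    then obtain m where "x = phi_plus k m" by auto
    then show "x \<in> ?C"
      using phi_zero(1)[of m k] by (cases "m \<in> ?P") (auto simp: cplx.funs.span_zero intro: cplx.funs.span_base)
  qed (auto intro: cplx.funs.span_base)
  have image_i: "i ` phi_minus k ` ?N = e ` ?N" using i by (auto simp: image_image)
  have span_i: "i ` cplx.funs.span (phi_minus k ` ?N) = cvec.funs.span (e ` ?N)"
    unfolding image_i[symmetric] by (rule cc.funs2.linear_span_image[OF lin_i, symmetric])
  have e_indep: "inj_on e S" "cvec.funs.independent (e ` S)" for S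
    using cvec.ladder_independent[OF ladder_e nz] by auto
  have inj_i: "inj_on i (cplx.funs.span (phi_minus k ` ?N))"
  proof (rule cc.funs2.linear_inj_on_span_independent_image[OF lin_i])
    show "cvec.funs.independent (i ` phi_minus k ` ?N)" unfolding image_i by (rule e_indep)
    show "inj_on i (phi_minus k ` ?N)" using e_indep(1)[of ?N] i by (auto simp: inj_on_def)
  qed
  have p_zero: "cvec.funs.span (e ` ?N) \<subseteq> {x. p x = 0}"
    by (rule cvec.funs.span_minimal[OF _ p.subspace_kernel]) (auto simp: p phi_zero)
  have ker: "cvec.funs.span (e ` ?N) = {x \<in> ?B. p x = 0}"
  proof (intro equalityI subsetI CollectI conjI)
    fix x assume x: "x \<in> cvec.funs.span (e ` ?N)"
    show "x \<in> ?B" using cvec.funs.span_mono[of "e ` ?N" "range e"] x by auto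
    show "p x = 0" using p_zero x by blast
  next
    fix x assume x: "x \<in> {x \<in> ?B. p x = 0}"
    have "range e = e ` ?N \<union> e ` ?P" by (auto simp: image_iff) (metis atLeast_iff lessThan_iff not_less)
    then have "x \<in> cvec.funs.span (e ` ?N \<union> e ` ?P)" using x by simp
    then obtain y z where yz: "y \<in> cvec.funs.span (e ` ?N)" "z \<in> cvec.funs.span (e ` ?P)" "x = y + z"
      unfolding cvec.funs.span_Un by auto
    have "p y = 0"
      using yz(1) p_zero by blast
    then have "p z = p 0" using x yz(3) by (simp add: p.add p.zero)
    moreover have "inj_on p (cvec.funs.span (e ` ?P))"
    proof (rule vc.funs2.linear_inj_on_span_independent_image[OF lin_p])
      have image: "p ` e ` ?P = phi_plus k ` ?P" using p by (auto simp: image_image)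
      note indep = cplx.ladder_independent[OF plus[of ?P]]
      show "cplx.funs.independent (p ` e ` ?P)" unfolding image using indep(2) phi_nonzero by auto
      have "inj_on (phi_plus k) ?P" using indep(1) phi_nonzero by auto
      then show "inj_on p (e ` ?P)" using p by (auto simp: inj_on_def)
    qed
    ultimately have "z = 0" using yz(2) by (auto simp: inj_on_def cvec.funs.span_zero)
    then show "x \<in> cvec.funs.span (e ` ?N)" using yz by simp
  qed
  have surj: "p ` ?B = ?C"
    unfolding C[symmetric] using vc.funs2.linear_span_image[OF lin_p, of "range e"] p
    by (simp add: image_image)
  have exact: "gk_short_exact (varpi_minus (1 - k)) (varpi f k) (varpi_plus (k - 1)) i p"
    unfolding gk_short_exact_def varpi_eq varpi_plus_eq[OF k2] varpi_minus_eq[OF k2]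
    using hom_i[of ?B] hom_p[of ?C] inj_i span_i ker surj C cvec.funs.span_mono[of "e ` ?N" "range e"]
    by auto
  have "\<not> gk_splits (varpi f k) (varpi_plus (k - 1)) p"
  proof
    assume "gk_splits (varpi f k) (varpi_plus (k - 1)) p"
    then obtain \<sigma> where hom: "gk_hom ((smooth_module (*))\<lparr>gk_space := ?C\<rparr>) ((smooth_module (*s))\<lparr>gk_space := ?B\<rparr>) \<sigma>"
      and \<sigma>: "\<And>x. x \<in> ?C \<Longrightarrow> p (\<sigma> x) = x"
      unfolding gk_splits_def varpi_eq varpi_plus_eq[OF k2] by auto
    have \<sigma>_mem: "\<sigma> x \<in> ?B"
      and \<sigma>_scale: "\<sigma> (gk_scale (smooth_module (*)) a x) = gk_scale (smooth_module (*s)) a (\<sigma> x)"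
      and \<sigma>_lie: "Z \<in> sl2C \<Longrightarrow> \<sigma> (gk_lie (smooth_module (*)) Z x) = gk_lie (smooth_module (*s)) Z (\<sigma> x)"
      and \<sigma>_K: "\<kappa> \<in> mp_K \<Longrightarrow> \<sigma> (gk_K (smooth_module (*)) \<kappa> x) = gk_K (smooth_module (*s)) \<kappa> (\<sigma> x)"
      if "x \<in> ?C" for x a Z \<kappa>
      using hom that unfolding gk_hom_def by simp_all
    let ?\<phi> = "phi_plus k 0" and ?K = "\<lfloor>- 2 * k\<rfloor>"
    have \<phi>: "?\<phi> \<in> ?C" by (intro cplx.funs.span_base) simp
    have K\<phi>: "cplx.K_type ?K ?\<phi>" using plus[of UNIV] by (simp add: cplx.ladder_def) (metis diff_zero mult_zero_right)
    have Ke: "cvec.K_type (?K - 4 * m) (e m)" for m using ladder_e[of UNIV] by (simp add: cvec.ladder_def)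
    \<comment> \<open>The vector \<open>z\<close> has weight \<open>k\<close> and lies in the kernel of \<open>p\<close>, all of whose weights are lower.\<close>
    define z where "z = \<sigma> ?\<phi> - e 0"
    have Kz: "cvec.K_type ?K z"
      unfolding cvec.K_type_def
    proof (intro ballI allI)
      fix \<kappa> x assume \<kappa>: "\<kappa> \<in> mp_K"
      have "gk_K (smooth_module (*)) \<kappa> ?\<phi> = gk_scale (smooth_module (*)) (mp_root \<kappa> \<i> powi ?K) ?\<phi>"
        using K\<phi> \<kappa> by (simp add: smooth_module_def cplx.K_type_def)
      then have "gk_K (smooth_module (*s)) \<kappa> (\<sigma> ?\<phi>) = gk_scale (smooth_module (*s)) (mp_root \<kappa> \<i> powi ?K) (\<sigma> ?\<phi>)"
        using \<sigma>_K[OF \<phi> \<kappa>] \<sigma>_scale[OF \<phi>] by simp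
      then have "\<sigma> ?\<phi> (x \<otimes>\<^bsub>Mp1R\<^esub> \<kappa>) = (mp_root \<kappa> \<i> powi ?K) *s \<sigma> ?\<phi> x"
        by (simp add: smooth_module_def fun_eq_iff)
      then show "z (x \<otimes>\<^bsub>Mp1R\<^esub> \<kappa>) = (mp_root \<kappa> \<i> powi ?K) *s z x"
        using Ke[of 0] \<kappa> by (simp add: z_def cvec.K_type_def vec_eq_iff algebra_simps)
    qed
    have "z \<in> ?B"
      unfolding z_def by (intro cvec.funs.span_diff[OF \<sigma>_mem[OF \<phi>] cvec.funs.span_base]) auto
    moreover have "p z = 0" using \<sigma>[OF \<phi>] p[of 0] by (simp add: z_def p.diff)
    ultimately have "z \<in> cvec.funs.span (e ` ?N)" unfolding ker by simp
    then obtain F c where F: "finite F" "F \<subseteq> ?N" "z = (\<Sum>m\<in>F. gk_scale (smooth_module (*s)) (c m) (e m))"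
      by (rule cvec.span_family)
    have "z = 0"
    proof (rule ccontr)
      assume z: "z \<noteq> 0"
      \<comment> \<open>Replacing \<open>e 0\<close> by \<open>z\<close> gives a family with distinct \<open>K\<close>-types and a linear relation.\<close>
      let ?e = "e(0 := z)" and ?c = "c(0 := - 1)"
      have 0: "0 \<notin> F" using F(2) by auto
      have "(\<Sum>m\<in>F. gk_scale (smooth_module (*s)) (?c m) (?e m)) = z"
        unfolding F(3) using 0 by (intro sum.cong) auto
      then have "(\<Sum>m\<in>insert 0 F. gk_scale (smooth_module (*s)) (?c m) (?e m)) = 0"
        using F(1) 0 by simp
      moreover have "cvec.K_type (?K - 4 * m) (?e m)" for m
        using Ke[of m] Kz by (cases "m = 0") simp_all
      moreover have "?e m \<noteq> 0" for m using z nz[of m] by (cases "m = 0") simp_all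
      moreover have "inj_on (\<lambda>m. ?K - 4 * m) (insert 0 F)" by (simp add: inj_on_def)
      ultimately have "?c 0 = 0"
        using cvec.K_types_independent[of "insert 0 F" "\<lambda>m. ?K - 4 * m" ?e ?c 0] F(1) by blast
      then show False by simp
    qed
    then have \<sigma>\<phi>: "\<sigma> ?\<phi> = e 0" by (simp add: z_def)
    have "lie_act (*) sl2_minus ?\<phi> = 0"
      using cplx.ladder_raise_lower(2)[OF plus[of UNIV], of 0] phi_zero(1)[of "- 1" k] by simp
    then have "lie_act (*s) sl2_minus (e 0) = \<sigma> 0"
      using \<sigma>_lie[OF \<phi> coord_sl2_minus(1)] \<sigma>\<phi> by (simp add: smooth_module_def)
    moreover have "\<sigma> 0 = 0"
      using \<sigma>_scale[OF \<phi>, of 0] by simp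
    moreover have "lie_act (*s) sl2_minus (e 0) = e (- 1)"
      using cvec.ladder_raise_lower(2)[OF ladder_e, of 0 UNIV] by (simp add: down_def)
    ultimately show False using nz[of "- 1"] by simp
  qed
  with exact show ?thesis by blast
qed

end

theorem proposition2p2:
  fixes k :: real
    and \<Gamma> :: "mp1 set"
    and \<rho> :: "mp1 \<Rightarrow> complex^'n^'n"
  assumes "k - 1/2 \<in> \<int>"
    and "subgroup \<Gamma> Mp1Z"
    and "finite (rcosets\<^bsub>Mp1Z\<^esub> \<Gamma>)"
    and "mp_representation \<Gamma> \<rho>"
  shows "(\<forall>f. weakly_holomorphic_form k \<Gamma> \<rho> f \<and> (\<exists>\<tau>\<in>uhp. f \<tau> \<noteq> 0) \<longrightarrow>
            gk_isomorphic (varpi f k) (varpi_plus (k - 1))) \<and>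
         (\<forall>f. harmonic_weak_maass_form k \<Gamma> \<rho> f \<and> \<not> weakly_holomorphic_form k \<Gamma> \<rho> f \<longrightarrow>
            (\<exists>i p. gk_short_exact (varpi_minus (1 - k)) (varpi f k) (varpi_plus (k - 1)) i p \<and>
                   \<not> gk_splits (varpi f k) (varpi_plus (k - 1)) p))"
proof -
  obtain l where "k - 1/2 = of_int l" using assms(1) by (auto elim: Ints_cases)
  then have k2: "- 2 * k = of_int (- 2 * l - 1)" by simp
  have H: "harmonic_ladder k f (- 2 * l - 1)" if "harmonic_weak_maass_form k \<Gamma> \<rho> f" for f
  proof
    show "smooth_on f uhp" using that by (simp add: harmonic_weak_maass_form_def)
    show "cvec.raise (k - 2) (cvec.lower f) \<tau> = 0" if "\<tau> \<in> uhp" for \<tau>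
      using \<open>harmonic_weak_maass_form k \<Gamma> \<rho> f\<close> that
      by (simp add: harmonic_weak_maass_form_def laplace_op_def lower_op_eq raise_op_eq)
  qed (rule assms(1) k2)+
  have hol: "weakly_holomorphic_form k \<Gamma> \<rho> f \<longleftrightarrow> (\<forall>\<tau>\<in>uhp. cvec.lower f \<tau> = 0)"
    if "harmonic_weak_maass_form k \<Gamma> \<rho> f" for f
    using holomorphic_iff_lower[OF harmonic_ladder.f[OF H[OF that]]] that
    by (simp add: weakly_holomorphic_form_def)
  show ?thesis
  proof (intro conjI allI impI)
    fix f assume f: "weakly_holomorphic_form k \<Gamma> \<rho> f \<and> (\<exists>\<tau>\<in>uhp. f \<tau> \<noteq> 0)"
    then have "harmonic_weak_maass_form k \<Gamma> \<rho> f" by (simp add: weakly_holomorphic_form_def)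
    then show "gk_isomorphic (varpi f k) (varpi_plus (k - 1))"
      using f hol harmonic_ladder.varpi_isomorphic_plus[OF H] by blast
  next
    fix f assume f: "harmonic_weak_maass_form k \<Gamma> \<rho> f \<and> \<not> weakly_holomorphic_form k \<Gamma> \<rho> f"
    then show "\<exists>i p. gk_short_exact (varpi_minus (1 - k)) (varpi f k) (varpi_plus (k - 1)) i p \<and>
        \<not> gk_splits (varpi f k) (varpi_plus (k - 1)) p"
      using hol harmonic_ladder.varpi_extension[OF H] by blast
  qed
qed

end
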